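(* Let $f\in\widehat{\mathcal{O}}=\mathbb{C}[[x_1,\dots,x_n]]$ be such that $\mathrm{Der}_f\subset\widehat{\mathfrak m}\,\widehat{\mathrm{Der}}$, and let $s\ge0$ be the maximal number of commuting semisimple derivations in a minimal generating set of $\mathrm{Der}_f$. If $s=0$, then each minimal generating set of $\mathrm{Der}_f$ is formed by topologically nilpotent derivations. Otherwise, there exist a minimal generating set $\{\sigma_1,\dots,\sigma_s,\nu_1,\dots,\nu_r\}$ of $\mathrm{Der}_f$, a formal coordinate system $(y_1,\dots,y_n)$ and a formal unit $u\in\widehat{\mathcal{O}}$ such that: (1) $\sigma_1,\dots,\sigma_s$ are diagonal with rational weights: $\sigma_i=\sum_{j=1}^n w_{ij}\,y_j\frac{\partial}{\partial y_j}$ with $w_{ij}\in\mathbb{Q}$ for all $i=1,\dots,s$ and $j=1,\dots,n$. (2) For $g=uf$ we have $\sigma_i(g)=\alpha_i g$ with $\alpha_i\in\mathbb{Q}$ for all $i=1,\dots,s$. (3) $\nu_1,\dots,\nu_r$ are topologically nilpotent. (4) $[\sigma_i,\nu_j]=c_{ij}\nu_j$ with $c_{ij}\in\mathbb{Q}$ for all $i=1,\dots,s$, $j=1,\dots,r$.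
   Context: $\widehat{\mathfrak m}=(x_1,\dots,x_n)$ is the maximal ideal of $\widehat{\mathcal{O}}$; $\widehat{\mathrm{Der}}$ is the $\widehat{\mathcal{O}}$-module of $\mathbb{C}$-derivations of $\widehat{\mathcal{O}}$ (free with basis $\partial_1,\dots,\partial_n$); for $f\in\widehat{\mathcal{O}}$, $\mathrm{Der}_f=\{\delta\in\widehat{\mathrm{Der}}:\delta(f)\in f\widehat{\mathcal{O}}\}$. A formal coordinate system is a regular system of parameters of $\widehat{\mathcal{O}}$. A derivation $\delta\in\widehat{\mathfrak m}\widehat{\mathrm{Der}}$ (called singular) induces endomorphisms $\delta^{(k)}$ of the finite-dimensional vector spaces $\widehat{\mathcal{O}}/\widehat{\mathfrak m}^k$; it is semisimple if every $\delta^{(k)}$, $k\in\mathbb{N}$, is diagonalizable, and topologically nilpotent if every $\delta^{(k)}$, $k\in\mathbb{N}$, is nilpotent. *)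

theory Defs
  imports Complex_Main "HOL-Library.FuncSet" "HOL-Library.Function_Algebras"
begin

text \<open>
  \<open>'n mfps\<close> is the ring of formal power series over the complex numbers in variables indexed by
  the finite type \<open>'n\<close>, so the number of variables is \<open>CARD('n)\<close>. A series is its family of
  coefficients, indexed by exponent vectors \<open>'n \<Rightarrow> nat\<close>.
\<close>

typedef 'n mfps = "UNIV :: (('n \<Rightarrow> nat) \<Rightarrow> complex) set"
  morphisms mfps_coeff Abs_mfps
  by simp

setup_lifting type_definition_mfps

lemma mfps_eqI: "(\<And>\<alpha>. mfps_coeff p \<alpha> = mfps_coeff q \<alpha>) \<Longrightarrow> p = q"
  by transfer auto

lemma finite_exponent_pairs: "finite {(\<beta>, \<gamma>). \<beta> + \<gamma> = (\<alpha> :: 'n::finite \<Rightarrow> nat)}"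
proof -
  let ?B = "Pi\<^sub>E UNIV (\<lambda>i. {..\<alpha> i})"
  have "finite ?B" by (intro finite_PiE) auto
  moreover have "{(\<beta>, \<gamma>). \<beta> + \<gamma> = \<alpha>} \<subseteq> ?B \<times> ?B"
    by (auto simp: PiE_UNIV_domain)
  ultimately show ?thesis by (meson finite_SigmaI finite_subset)
qed

lemma sum_exponent_triples:
  fixes h :: "('n::finite \<Rightarrow> nat) \<Rightarrow> ('n \<Rightarrow> nat) \<Rightarrow> ('n \<Rightarrow> nat) \<Rightarrow> complex"
  shows "(\<Sum>(\<delta>, \<gamma>) | \<delta> + \<gamma> = \<alpha>. \<Sum>(\<beta>, \<epsilon>) | \<beta> + \<epsilon> = \<delta>. h \<beta> \<epsilon> \<gamma>) =
         (\<Sum>(\<beta>, \<delta>) | \<beta> + \<delta> = \<alpha>. \<Sum>(\<epsilon>, \<gamma>) | \<epsilon> + \<gamma> = \<delta>. h \<beta> \<epsilon> \<gamma>)"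
proof -
  let ?P = "\<lambda>\<alpha> :: 'n \<Rightarrow> nat. {(\<beta>, \<gamma>). \<beta> + \<gamma> = \<alpha>}"
  have "(\<Sum>(\<delta>, \<gamma>)\<in>?P \<alpha>. \<Sum>(\<beta>, \<epsilon>)\<in>?P \<delta>. h \<beta> \<epsilon> \<gamma>) =
        (\<Sum>(x, y)\<in>Sigma (?P \<alpha>) (\<lambda>x. ?P (fst x)). h (fst y) (snd y) (snd x))"
    using sum.Sigma[of "?P \<alpha>" "\<lambda>x. ?P (fst x)" "\<lambda>x y. h (fst y) (snd y) (snd x)"]
    by (simp add: finite_exponent_pairs[unfolded case_prod_unfold] case_prod_unfold)
  also have "\<dots> = (\<Sum>(x, y)\<in>Sigma (?P \<alpha>) (\<lambda>x. ?P (snd x)). h (fst x) (fst y) (snd y))"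
    by (rule sum.reindex_bij_witness[where
          i = "\<lambda>((b, d), (e, c)). ((b + e, c), (b, e))" and
          j = "\<lambda>((d, c), (b, e)). ((b, e + c), (e, c))"]) (auto simp: add.assoc)
  also have "\<dots> = (\<Sum>(\<beta>, \<delta>)\<in>?P \<alpha>. \<Sum>(\<epsilon>, \<gamma>)\<in>?P \<delta>. h \<beta> \<epsilon> \<gamma>)"
    using sum.Sigma[of "?P \<alpha>" "\<lambda>x. ?P (snd x)" "\<lambda>x y. h (fst x) (fst y) (snd y)"]
    by (simp add: finite_exponent_pairs[unfolded case_prod_unfold] case_prod_unfold)
  finally show ?thesis .
qed

lemma sum_exponent_pairs_0:
  fixes h :: "('n::finite \<Rightarrow> nat) \<Rightarrow> complex"
  shows "(\<Sum>(\<beta>, \<gamma>) | \<beta> + \<gamma> = \<alpha>. (if \<beta> = 0 then c else 0) * h \<gamma>) = c * h \<alpha>"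
proof -
  have "(\<Sum>(\<beta>, \<gamma>) | \<beta> + \<gamma> = \<alpha>. (if \<beta> = 0 then c else 0) * h \<gamma>) =
        (\<Sum>(\<beta>, \<gamma>)\<in>{(0 :: 'n \<Rightarrow> nat, \<alpha>)}. (if \<beta> = 0 then c else 0) * h \<gamma>)"
  proof (rule sum.mono_neutral_right)
    show "finite {(\<beta>, \<gamma>). \<beta> + \<gamma> = \<alpha>}" by (rule finite_exponent_pairs)
    show "{(0, \<alpha>)} \<subseteq> {(\<beta>, \<gamma>). \<beta> + \<gamma> = \<alpha>}" by simp
    show "\<forall>x\<in>{(\<beta>, \<gamma>). \<beta> + \<gamma> = \<alpha>} - {(0, \<alpha>)}.
            (case x of (\<beta>, \<gamma>) \<Rightarrow> (if \<beta> = 0 then c else 0) * h \<gamma>) = 0"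
      by (auto split: if_splits)
  qed
  then show ?thesis by simp
qed

instantiation mfps :: (finite) comm_ring_1
begin

lift_definition zero_mfps :: "'a mfps" is "\<lambda>\<alpha>. 0" .
lift_definition one_mfps :: "'a mfps" is "\<lambda>\<alpha>. if \<alpha> = 0 then 1 else 0" .
lift_definition plus_mfps :: "'a mfps \<Rightarrow> 'a mfps \<Rightarrow> 'a mfps" is "\<lambda>p q \<alpha>. p \<alpha> + q \<alpha>" .
lift_definition minus_mfps :: "'a mfps \<Rightarrow> 'a mfps \<Rightarrow> 'a mfps" is "\<lambda>p q \<alpha>. p \<alpha> - q \<alpha>" .
lift_definition uminus_mfps :: "'a mfps \<Rightarrow> 'a mfps" is "\<lambda>p \<alpha>. - p \<alpha>" .
lift_definition times_mfps :: "'a mfps \<Rightarrow> 'a mfps \<Rightarrow> 'a mfps"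
  is "\<lambda>p q \<alpha>. \<Sum>(\<beta>, \<gamma>) | \<beta> + \<gamma> = \<alpha>. p \<beta> * q \<gamma>" .

instance
proof
  fix a b c :: "'a mfps"
  show "a + b + c = a + (b + c)" by transfer (simp add: add.assoc)
  show "a + b = b + a" by transfer (simp add: add.commute)
  show "0 + a = a" by transfer simp
  show "- a + a = 0" by transfer simp
  show "a - b = a + - b" by transfer simp
  show "a * b = b * a"
  proof (transfer, rule ext)
    fix p q :: "('a \<Rightarrow> nat) \<Rightarrow> complex" and \<alpha>
    show "(\<Sum>(\<beta>, \<gamma>) | \<beta> + \<gamma> = \<alpha>. p \<beta> * q \<gamma>) = (\<Sum>(\<beta>, \<gamma>) | \<beta> + \<gamma> = \<alpha>. q \<beta> * p \<gamma>)"
      by (rule sum.reindex_bij_witness[where i = prod.swap and j = prod.swap])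
         (auto simp: add.commute mult.commute)
  qed
  show "a * b * c = a * (b * c)"
  proof (transfer, rule ext)
    fix p q r :: "('a \<Rightarrow> nat) \<Rightarrow> complex" and \<alpha>
    show "(\<Sum>(\<delta>, \<gamma>) | \<delta> + \<gamma> = \<alpha>. (\<Sum>(\<beta>, \<epsilon>) | \<beta> + \<epsilon> = \<delta>. p \<beta> * q \<epsilon>) * r \<gamma>) =
          (\<Sum>(\<beta>, \<delta>) | \<beta> + \<delta> = \<alpha>. p \<beta> * (\<Sum>(\<epsilon>, \<gamma>) | \<epsilon> + \<gamma> = \<delta>. q \<epsilon> * r \<gamma>))"
      using sum_exponent_triples[of "\<lambda>\<beta> \<epsilon> \<gamma>. p \<beta> * q \<epsilon> * r \<gamma>" \<alpha>]
      by (simp add: sum_distrib_left sum_distrib_right case_prod_unfold mult.assoc)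
  qed
  show "1 * a = a" by transfer (simp add: sum_exponent_pairs_0)
  show "(a + b) * c = a * c + b * c"
    by transfer (simp add: distrib_right sum.distrib case_prod_unfold)
  show "(0 :: 'a mfps) \<noteq> 1" by transfer (auto simp: fun_eq_iff)
qed

end

lift_definition mfps_const :: "complex \<Rightarrow> 'n mfps" is "\<lambda>c \<alpha>. if \<alpha> = 0 then c else 0" .

lift_definition mfps_X :: "'n \<Rightarrow> 'n mfps" is
  "\<lambda>i \<alpha>. if \<alpha> = (\<lambda>j. if j = i then 1 else 0) then 1 else 0" .

global_interpretation mfps_ideal: module "(*) :: 'n::finite mfps \<Rightarrow> 'n mfps \<Rightarrow> 'n mfps"
  by unfold_locales (simp_all only: distrib_left distrib_right mult.assoc mult_1_left)

definition max_ideal :: "'n::finite mfps set" where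
  "max_ideal = mfps_ideal.span (range mfps_X)"

primrec max_ideal_pow :: "nat \<Rightarrow> 'n::finite mfps set" where
  "max_ideal_pow 0 = UNIV"
| "max_ideal_pow (Suc k) = mfps_ideal.span {a * b |a b. a \<in> max_ideal \<and> b \<in> max_ideal_pow k}"

text \<open>A regular system of parameters: as many elements as the dimension of the ring, generating
  the maximal ideal.\<close>

definition formal_coordinates :: "('n::finite \<Rightarrow> 'n mfps) \<Rightarrow> bool" where
  "formal_coordinates y \<longleftrightarrow> mfps_ideal.span (range y) = max_ideal"

definition Der :: "('n::finite mfps \<Rightarrow> 'n mfps) set" where
  "Der = {\<delta>. (\<forall>p q. \<delta> (p + q) = \<delta> p + \<delta> q) \<and>
             (\<forall>c p. \<delta> (mfps_const c * p) = mfps_const c * \<delta> p) \<and>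
             (\<forall>p q. \<delta> (p * q) = p * \<delta> q + q * \<delta> p)}"

definition der_scale :: "'n::finite mfps \<Rightarrow> ('n mfps \<Rightarrow> 'n mfps) \<Rightarrow> 'n mfps \<Rightarrow> 'n mfps" where
  "der_scale a \<delta> = (\<lambda>p. a * \<delta> p)"

text \<open>The spans below are those of the module of all maps from the ring to itself, with pointwise
  operations; it contains \<^const>\<open>Der\<close> as a submodule.\<close>

global_interpretation der_module: module "der_scale :: 'n::finite mfps \<Rightarrow> _"
  by unfold_locales
     (simp_all only: der_scale_def fun_eq_iff plus_fun_apply distrib_left distrib_right mult.assoc
       mult_1_left, simp_all)

definition lie_bracket ::
  "('n::finite mfps \<Rightarrow> 'n mfps) \<Rightarrow> ('n mfps \<Rightarrow> 'n mfps) \<Rightarrow> 'n mfps \<Rightarrow> 'n mfps" where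
  "lie_bracket \<delta> \<epsilon> = (\<delta> \<circ> \<epsilon>) - (\<epsilon> \<circ> \<delta>)"

definition max_ideal_Der :: "('n::finite mfps \<Rightarrow> 'n mfps) set" where
  "max_ideal_Der = der_module.span {der_scale a \<delta> |a \<delta>. a \<in> max_ideal \<and> \<delta> \<in> Der}"

definition Der_log :: "'n::finite mfps \<Rightarrow> ('n mfps \<Rightarrow> 'n mfps) set" where
  "Der_log f = {\<delta> \<in> Der. f dvd \<delta> f}"

text \<open>\<open>coord_deriv y j\<close> is \<open>\<partial>/\<partial>y\<^sub>j\<close>, that is, the members of the basis of \<^const>\<open>Der\<close> dual to the
  coordinate system \<open>y\<close>; it is meaningful only if \<open>y\<close> is a coordinate system.\<close>

definition coord_deriv :: "('n::finite \<Rightarrow> 'n mfps) \<Rightarrow> 'n \<Rightarrow> 'n mfps \<Rightarrow> 'n mfps" where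
  "coord_deriv y j = (THE \<delta>. \<delta> \<in> Der \<and> (\<forall>i. \<delta> (y i) = (if i = j then 1 else 0)))"

definition minimal_generating_set ::
  "('n::finite mfps \<Rightarrow> 'n mfps) set \<Rightarrow> ('n mfps \<Rightarrow> 'n mfps) set \<Rightarrow> bool" where
  "minimal_generating_set M G \<longleftrightarrow>
     der_module.span G = M \<and> (\<forall>H. H \<subset> G \<longrightarrow> der_module.span H \<noteq> M)"

text \<open>
  For a subspace \<open>W\<close> of the power series ring, with \<open>\<delta> ` W \<subseteq> W\<close>, the following three predicates
  speak about the endomorphism of the quotient by \<open>W\<close> induced by \<open>\<delta>\<close>, on representatives:
  the classes of the elements of \<open>B\<close> form a basis of the quotient, as a complex vector space;
  this basis consists of eigenvectors; some power of the induced endomorphism vanishes.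
\<close>

definition basis_mod :: "'n::finite mfps set \<Rightarrow> 'n mfps set \<Rightarrow> bool" where
  "basis_mod W B \<longleftrightarrow> finite B \<and>
     (\<forall>p. \<exists>c. p - (\<Sum>b\<in>B. mfps_const (c b) * b) \<in> W) \<and>
     (\<forall>c. (\<Sum>b\<in>B. mfps_const (c b) * b) \<in> W \<longrightarrow> (\<forall>b\<in>B. c b = 0))"

definition diagonalizable_mod ::
  "'n::finite mfps set \<Rightarrow> ('n mfps \<Rightarrow> 'n mfps) \<Rightarrow> bool" where
  "diagonalizable_mod W \<delta> \<longleftrightarrow>
     (\<exists>B. basis_mod W B \<and> (\<forall>b\<in>B. \<exists>c. \<delta> b - mfps_const c * b \<in> W))"

definition nilpotent_mod ::
  "'n::finite mfps set \<Rightarrow> ('n mfps \<Rightarrow> 'n mfps) \<Rightarrow> bool" where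
  "nilpotent_mod W \<delta> \<longleftrightarrow> (\<exists>N. \<forall>p. (\<delta> ^^ N) p \<in> W)"

definition semisimple :: "('n::finite mfps \<Rightarrow> 'n mfps) \<Rightarrow> bool" where
  "semisimple \<delta> \<longleftrightarrow> \<delta> \<in> max_ideal_Der \<and> (\<forall>k. diagonalizable_mod (max_ideal_pow k) \<delta>)"

definition topologically_nilpotent :: "('n::finite mfps \<Rightarrow> 'n mfps) \<Rightarrow> bool" where
  "topologically_nilpotent \<delta> \<longleftrightarrow>
     \<delta> \<in> max_ideal_Der \<and> (\<forall>k. nilpotent_mod (max_ideal_pow k) \<delta>)"

definition max_commuting_semisimple :: "'n::finite mfps \<Rightarrow> nat" where
  "max_commuting_semisimple f =
     Max {card S |S G. minimal_generating_set (Der_log f) G \<and> S \<subseteq> G \<and>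
                       (\<forall>\<sigma>\<in>S. semisimple \<sigma>) \<and> (\<forall>\<sigma>\<in>S. \<forall>\<tau>\<in>S. lie_bracket \<sigma> \<tau> = 0)}"

end

theory Submission
  imports Defs "HOL-Analysis.Cartesian_Space" "HOL-Computational_Algebra.Fundamental_Theorem_Algebra"
    "HOL-Computational_Algebra.Primes"
begin

text \<open>
  Let \<open>M = Der_log f\<close>, let \<open>O\<close> be the ring of power series and \<open>m\<close> its maximal ideal.

  The main tool is a functional calculus for a singular derivation \<open>d\<close>. On each of the
  finite-dimensional spaces \<open>O / m\<^sup>k\<close> and for each function \<open>h\<close> on the complex numbers there is a
  polynomial in \<open>d\<close> that acts on the generalised eigenspace for \<open>z\<close> as the scalar \<open>h z\<close>. These polynomials
  converge to an operator \<open>fcalc d h\<close> on \<open>O\<close>. Eigenvalues add up under multiplication, and therefore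
  \<open>fcalc d h\<close> is a derivation if \<open>h\<close> is additive (\<open>fcalc_derivation\<close>); it is semisimple, it commutes with
  whatever commutes with \<open>d\<close>, and as a limit of polynomials in \<open>d\<close> it preserves all closed
  \<open>d\<close>-stable subspaces. In particular, it belongs to \<open>M\<close> if \<open>d\<close> does, since the ideal of \<open>f\<close> is
  closed. For \<open>h = id\<close> one obtains the semisimple part of \<open>d\<close>, and the rest of \<open>d\<close> is topologically
  nilpotent. For a \<open>\<rat>\<close>-linear coordinate functional \<open>h\<close> of \<open>\<complex>\<close> one obtains a derivation with rational
  weights.

  Minimal generating sets of \<open>M\<close> are the lifts of bases of the complex vector space \<open>M / m M\<close>. This
  follows from Nakayama's lemma, once it is known that \<open>M\<close> is finitely generated, which is shown by
  division with respect to a standard basis (\<open>standard_basis\<close>). Commuting semisimple derivations are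
  diagonal in common coordinates \<open>y\<close> (\<open>joint_eigen_coordinates\<close>). As \<open>M\<close> consists of singular
  derivations, \<open>m M\<close> maps \<open>O\<close> to \<open>m\<^sup>2\<close>, which contains no coordinate; so a linear combination of
  commuting semisimple elements of \<open>M\<close> that lies in \<open>m M\<close> is 0 (\<open>toral_combination_zero\<close>). Hence \<open>s\<close>
  is the largest number of linearly independent commuting semisimple elements of \<open>M\<close>.

  If \<open>s = 0\<close>, then all elements of \<open>M\<close> have semisimple part 0, and thus are topologically nilpotent.
  Otherwise replace a maximal commuting family by a family \<open>B\<close> of equal size with rational weights
  (\<open>rational_toral\<close>). The ideal of \<open>f\<close> is stable under \<open>B\<close>, and so \<open>f\<close> is modulo any power of \<open>m\<close> a sum
  of joint eigenvectors of \<open>B\<close> in this ideal. One of them has the same order as \<open>f\<close>, and is the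
  required \<open>u f\<close>. In the same way \<open>M\<close> is spanned modulo \<open>m M\<close> by joint eigenvectors of the brackets
  with the elements of \<open>B\<close>. Those with a nonzero weight are topologically nilpotent since they shift
  eigenvalues. Those of weight zero have a semisimple part that commutes with \<open>B\<close>; by maximality it
  is in the span of \<open>B\<close>, and it can be subtracted. So \<open>B\<close> together with topologically nilpotent
  homogeneous elements spans \<open>M\<close> modulo \<open>m M\<close> (\<open>Der_log_spanned\<close>), and a basis that contains \<open>B\<close> can
  be selected.
\<close>

section \<open>Linear algebra modulo a subspace\<close>

locale complex_space = vector_space scale
  for scale :: "complex \<Rightarrow> 'b::ab_group_add \<Rightarrow> 'b"
begin

text \<open>Linear independence of the residue classes of the elements of \<open>S\<close> in the quotient by \<open>W\<close>,
  including that these classes are distinct.\<close>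

definition independent_mod :: "'b set \<Rightarrow> 'b set \<Rightarrow> bool" where
  "independent_mod W S \<longleftrightarrow> finite S \<and> (\<forall>c. (\<Sum>v\<in>S. scale (c v) v) \<in> W \<longrightarrow> (\<forall>v\<in>S. c v = 0))"

lemma span_Un_subspace:
  assumes "subspace W"
  shows "x \<in> span (A \<union> W) \<longleftrightarrow> (\<exists>a\<in>span A. x - a \<in> W)"
proof -
  have W: "span W = W" using assms by simp
  show ?thesis
    unfolding span_Un W by (auto simp: algebra_simps) (metis add_diff_cancel_left' add.commute diff_add_cancel)+
qed

text \<open>Gaussian elimination, carried out on representatives: more vectors than the dimension of a
  space that contains their classes satisfy a relation. No quotient space is formed.\<close>

lemma nontrivial_relation_mod:
  assumes "subspace W" "finite A" "finite I" "card A < card I"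
    and "\<And>i. i \<in> I \<Longrightarrow> v i \<in> span (A \<union> W)"
  shows "\<exists>c. (\<exists>i\<in>I. c i \<noteq> 0) \<and> (\<Sum>i\<in>I. scale (c i) (v i)) \<in> W"
  using assms(2-)
proof (induction A arbitrary: I v rule: finite_induct)
  case empty
  then obtain i where i: "i \<in> I" by fastforce
  let ?c = "\<lambda>j. if j = i then 1 else 0 :: complex"
  have "(\<Sum>j\<in>I. scale (?c j) (v j)) = (\<Sum>j\<in>I. if j = i then v j else 0)"
    by (intro sum.cong) auto
  also have "\<dots> = v i" using i empty by simp
  finally have "(\<Sum>j\<in>I. scale (?c j) (v j)) \<in> W"
    using empty.prems(3)[OF i] assms(1) by (simp add: span_eq_iff[THEN iffD2])
  then show ?case using i by (intro exI[of _ ?c]) auto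
next
  case (insert a A)
  have "\<exists>m. \<forall>i\<in>I. v i - scale (m i) a \<in> span (A \<union> W)"
    using insert.prems(3) by (intro bchoice) (simp add: span_insert)
  then obtain m where m: "\<And>i. i \<in> I \<Longrightarrow> v i - scale (m i) a \<in> span (A \<union> W)" by blast
  show ?case
  proof (cases "\<forall>i\<in>I. m i = 0")
    case True
    then have "\<And>i. i \<in> I \<Longrightarrow> v i \<in> span (A \<union> W)" using m by fastforce
    then show ?thesis using insert.IH[of I v] insert.prems insert.hyps by simp
  next
    case False
    then obtain j where j: "j \<in> I" "m j \<noteq> 0" by blast
    define v' where "v' i = v i - scale (m i / m j) (v j)" for i
    have "v' i \<in> span (A \<union> W)" if "i \<in> I - {j}" for i
    proof -
      have "v' i = (v i - scale (m i) a) - scale (m i / m j) (v j - scale (m j) a)"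
        using j by (simp add: v'_def scale_right_diff_distrib)
      then show ?thesis using m j that by (metis DiffD1 span_diff span_scale)
    qed
    moreover have "card A < card (I - {j})" using insert.prems insert.hyps j by simp
    ultimately obtain c where c: "\<exists>i\<in>I-{j}. c i \<noteq> 0" "(\<Sum>i\<in>I-{j}. scale (c i) (v' i)) \<in> W"
      using insert.IH[of "I - {j}" v'] insert.prems by auto
    \<comment> \<open>The coefficient of the pivot vector compensates for the multiples of it in the \<open>v' i\<close>.\<close>
    define d where "d i = (if i = j then - (\<Sum>i\<in>I-{j}. c i * (m i / m j)) else c i)" for i
    have "(\<Sum>i\<in>I. scale (d i) (v i)) = scale (d j) (v j) + (\<Sum>i\<in>I-{j}. scale (d i) (v i))"
      using insert.prems j by (subst sum.remove[of _ j]) auto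
    also have "(\<Sum>i\<in>I-{j}. scale (d i) (v i)) = (\<Sum>i\<in>I-{j}. scale (c i) (v i))"
      by (intro sum.cong) (auto simp: d_def)
    also have "scale (d j) (v j) = - (\<Sum>i\<in>I-{j}. scale (c i * (m i / m j)) (v j))"
      by (simp add: d_def scale_sum_left)
    also have "\<dots> + (\<Sum>i\<in>I-{j}. scale (c i) (v i)) = (\<Sum>i\<in>I-{j}. scale (c i) (v' i))"
      by (simp add: v'_def scale_right_diff_distrib sum_subtractf)
    finally have "(\<Sum>i\<in>I. scale (d i) (v i)) \<in> W" using c by simp
    moreover have "\<exists>i\<in>I. d i \<noteq> 0" using c(1) by (auto simp: d_def)
    ultimately show ?thesis by blast
  qed
qed

lemma card_independent_mod_le:
  assumes "subspace W" "finite A" "independent_mod W S" "S \<subseteq> span (A \<union> W)"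
  shows "card S \<le> card A"
proof (rule ccontr)
  assume "\<not> card S \<le> card A"
  then obtain c where "\<exists>i\<in>S. c i \<noteq> 0" "(\<Sum>i\<in>S. scale (c i) i) \<in> W"
    using nontrivial_relation_mod[of W A S "\<lambda>x. x"] assms
    by (auto simp: independent_mod_def)
  then show False using assms by (auto simp: independent_mod_def)
qed

lemma independent_mod_insert:
  assumes "subspace W" "independent_mod W B" "a \<notin> span (B \<union> W)"
  shows "independent_mod W (insert a B)"
proof -
  have fin: "finite B" using assms by (simp add: independent_mod_def)
  have aB: "a \<notin> B" using assms(3) span_base by blast
  { fix c assume c: "(\<Sum>v\<in>insert a B. scale (c v) v) \<in> W"
    let ?s = "\<Sum>v\<in>B. scale (c v) v"
    have s: "?s \<in> span (B \<union> W)" by (intro span_sum span_scale span_base) auto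
    have "c a = 0"
    proof (rule ccontr)
      assume ca: "c a \<noteq> 0"
      have "scale (c a) a + ?s \<in> span (B \<union> W)"
        using c fin aB by (intro span_base) simp
      then have "scale (c a) a \<in> span (B \<union> W)" using s span_add_eq2 by blast
      then have "scale (inverse (c a)) (scale (c a) a) \<in> span (B \<union> W)" by (rule span_scale)
      then show False using ca assms by simp
    qed
    moreover from this have "?s \<in> W" using c fin aB by simp
    ultimately have "\<forall>v\<in>insert a B. c v = 0"
      using assms(2) by (auto simp: independent_mod_def) }
  then show ?thesis using fin by (auto simp: independent_mod_def)
qed

lemma extend_independent_mod:
  assumes "subspace W" "independent_mod W S" "finite A"
  obtains B where "S \<subseteq> B" "B \<subseteq> S \<union> A" "independent_mod W B" "A \<subseteq> span (B \<union> W)"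
proof -
  have "\<exists>B. S \<subseteq> B \<and> B \<subseteq> S \<union> A \<and> independent_mod W B \<and> A \<subseteq> span (B \<union> W)"
    using assms(3)
  proof (induction A rule: finite_induct)
    case empty
    then show ?case using assms by blast
  next
    case (insert a A)
    then obtain B where B: "S \<subseteq> B" "B \<subseteq> S \<union> A" "independent_mod W B" "A \<subseteq> span (B \<union> W)" by blast
    show ?case
    proof (cases "a \<in> span (B \<union> W)")
      case True
      then show ?thesis using B by blast
    next
      case False
      have "span (B \<union> W) \<subseteq> span (insert a B \<union> W)" by (intro span_mono) auto
      then show ?thesis
        using B independent_mod_insert[OF assms(1) B(3) False]
        by (intro exI[of _ "insert a B"]) (auto intro: span_base)
    qed
  qed
  then show thesis using that by blast
qed

lemma finite_subset_spanning:
  assumes "finite A" "A \<subseteq> span (S \<union> W)"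
  obtains T where "finite T" "T \<subseteq> S" "A \<subseteq> span (T \<union> W)"
proof -
  have "\<exists>T. finite T \<and> T \<subseteq> S \<and> A \<subseteq> span (T \<union> W)"
    using assms
  proof (induction A rule: finite_induct)
    case empty
    then show ?case by blast
  next
    case (insert a A)
    then obtain T where T: "finite T" "T \<subseteq> S" "A \<subseteq> span (T \<union> W)" by auto
    obtain U r where U: "finite U" "U \<subseteq> S \<union> W" "a = (\<Sum>u\<in>U. scale (r u) u)"
      using insert.prems by (auto simp: span_explicit)
    have "a \<in> span (U \<inter> S \<union> W)"
      unfolding U(3) using U(2) by (intro span_sum span_scale span_base) auto
    then have "insert a A \<subseteq> span ((T \<union> (U \<inter> S)) \<union> W)"
      using T(3) span_mono[of "T \<union> W" "T \<union> (U \<inter> S) \<union> W"] span_mono[of "U \<inter> S \<union> W" "T \<union> (U \<inter> S) \<union> W"]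
      by blast
    then show ?case using T U by (intro exI[of _ "T \<union> (U \<inter> S)"]) auto
  qed
  then show thesis using that by blast
qed

lemma independent_mod_not_in_span:
  assumes "subspace W" "independent_mod W B" "b \<in> B"
  shows "b \<notin> span ((B - {b}) \<union> W)"
proof
  assume "b \<in> span ((B - {b}) \<union> W)"
  then obtain s where s: "s \<in> span (B - {b})" "b - s \<in> W" using span_Un_subspace[OF assms(1)] by blast
  have fin: "finite B" using assms(2) by (simp add: independent_mod_def)
  obtain r where r: "s = (\<Sum>v\<in>B - {b}. scale (r v) v)" using s(1) fin by (auto simp: span_finite)
  define c where "c v = (if v = b then 1 else - r v)" for v
  have "(\<Sum>v\<in>B. scale (c v) v) = b + (\<Sum>v\<in>B - {b}. scale (c v) v)"
    using fin assms(3) by (subst sum.remove[of _ b]) (auto simp: c_def)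
  also have "(\<Sum>v\<in>B - {b}. scale (c v) v) = - s"
    unfolding r sum_negf[symmetric] by (rule sum.cong) (auto simp: c_def)
  finally have "(\<Sum>v\<in>B. scale (c v) v) \<in> W" using s(2) by simp
  then have "c b = 0" using assms(2,3) unfolding independent_mod_def by blast
  then show False by (simp add: c_def)
qed

lemma independent_mod_empty [simp]: "independent_mod W {}"
  by (simp add: independent_mod_def)

lemma span_Un_trans:
  assumes "A \<subseteq> span (B \<union> W)"
  shows "span (A \<union> W) \<subseteq> span (B \<union> W)"
  using assms by (intro span_minimal) (auto intro: span_base)

lemma independent_modI_notin:
  assumes "subspace W" "finite S" "\<And>v. v \<in> S \<Longrightarrow> v \<notin> span ((S - {v}) \<union> W)"
  shows "independent_mod W S"
  unfolding independent_mod_def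
proof (intro conjI assms allI impI ballI, rule ccontr)
  fix c v assume c: "(\<Sum>v\<in>S. scale (c v) v) \<in> W" and v: "v \<in> S" "c v \<noteq> 0"
  let ?T = "span ((S - {v}) \<union> W)"
  have "scale (c v) v + (\<Sum>u\<in>S - {v}. scale (c u) u) \<in> ?T"
    using c v(1) assms(2) by (intro span_base) (simp add: sum.remove)
  moreover have "(\<Sum>u\<in>S - {v}. scale (c u) u) \<in> ?T" by (intro span_sum span_scale span_base) auto
  ultimately have "scale (c v) v \<in> ?T" using span_add_eq2 by blast
  then have "scale (inverse (c v)) (scale (c v) v) \<in> ?T" by (rule span_scale)
  then show False using assms(3)[OF v(1)] v(2) by simp
qed

end

section \<open>Polynomials in a linear operator\<close>

context complex_space
begin

definition endo :: "('b \<Rightarrow> 'b) \<Rightarrow> bool" where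
  "endo T \<longleftrightarrow> (\<forall>p q. T (p + q) = T p + T q) \<and> (\<forall>c p. T (scale c p) = scale c (T p))"

lemma endoI:
  assumes "\<And>p q. T (p + q) = T p + T q" "\<And>c p. T (scale c p) = scale c (T p)"
  shows "endo T"
  using assms by (simp add: endo_def)

lemma endo_add: "endo T \<Longrightarrow> T (p + q) = T p + T q"
  and endo_scale: "endo T \<Longrightarrow> T (scale c p) = scale c (T p)"
  by (simp_all add: endo_def)

lemma endo_zero: "endo T \<Longrightarrow> T 0 = 0"
  using endo_scale[of T 0 0] by simp

lemma endo_diff: "endo T \<Longrightarrow> T (p - q) = T p - T q"
  using endo_add[of T "p - q" q] by simp

lemma endo_sum: "endo T \<Longrightarrow> T (sum g A) = (\<Sum>a\<in>A. T (g a))"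
  by (induction A rule: infinite_finite_induct) (auto simp: endo_add endo_zero)

lemma endo_span:
  assumes "endo T" "subspace V" "\<And>a. a \<in> A \<Longrightarrow> T a \<in> V" "p \<in> span A"
  shows "T p \<in> V"
  using assms(4)
  by (induction rule: span_induct_alt)
    (use assms in \<open>auto simp: endo_zero endo_add endo_scale intro!: subspace_0 subspace_add subspace_scale\<close>)

text \<open>The value of a polynomial at an operator, by Horner's scheme.\<close>

definition poly_op :: "('b \<Rightarrow> 'b) \<Rightarrow> complex poly \<Rightarrow> 'b \<Rightarrow> 'b" where
  "poly_op T P = fold_coeffs (\<lambda>a g p. scale a p + T (g p)) P (\<lambda>p. 0)"

context
  fixes T assumes T: "endo T"
begin

lemma poly_op_0 [simp]: "poly_op T 0 p = 0"
  by (simp add: poly_op_def)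

lemma poly_op_pCons [simp]: "poly_op T (pCons a P) p = scale a p + T (poly_op T P p)"
  using T by (cases "P = 0 \<and> a = 0") (auto simp: poly_op_def endo_zero)

lemma endo_poly_op: "endo (poly_op T P)"
proof (induction P)
  case 0
  then show ?case by (simp add: endo_def)
next
  case (pCons a P)
  then show ?case
    using T by (auto simp: endo_def scale_right_distrib algebra_simps scale_left_commute)
qed

lemma poly_op_add: "poly_op T (P + Q) p = poly_op T P p + poly_op T Q p"
proof (induction P arbitrary: Q)
  case (pCons a P Q)
  note IH = pCons.IH
  show ?case
  proof (cases Q)
    case (pCons b R)
    then show ?thesis
      using IH[of R] by (simp add: endo_add[OF T] scale_left_distrib algebra_simps)
  qed
qed simp

lemma poly_op_smult: "poly_op T (smult c P) p = scale c (poly_op T P p)"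
  by (induction P) (auto simp: endo_scale[OF T] scale_right_distrib)

lemma poly_op_diff: "poly_op T (P - Q) p = poly_op T P p - poly_op T Q p"
  using poly_op_add[of "P - Q" Q p] by simp

lemma poly_op_mult: "poly_op T (P * Q) p = poly_op T P (poly_op T Q p)"
  by (induction P) (auto simp: poly_op_add poly_op_smult)

lemma poly_op_1 [simp]: "poly_op T 1 p = p"
  using T by (simp add: one_pCons endo_zero)

lemma poly_op_sum: "poly_op T (sum P A) p = (\<Sum>a\<in>A. poly_op T (P a) p)"
  by (induction A rule: infinite_finite_induct) (auto simp: poly_op_add)

lemma poly_op_linear_factor: "poly_op T [:- z, 1:] p = T p - scale z p"
  using T by (simp add: endo_zero)

lemma poly_op_monom: "poly_op T (monom c n) p = scale c ((T ^^ n) p)"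
  by (induction n) (auto simp: monom_0 monom_Suc endo_zero[OF T] endo_scale[OF T])

lemma poly_op_commute:
  assumes "endo S" "\<And>p. S (T p) = T (S p)"
  shows "S (poly_op T P p) = poly_op T P (S p)"
  by (induction P) (auto simp: assms endo_zero[OF assms(1)] endo_add[OF assms(1)] endo_scale[OF assms(1)])

lemma poly_op_closed:
  assumes "subspace V" "\<And>p. p \<in> V \<Longrightarrow> T p \<in> V" "p \<in> V"
  shows "poly_op T P p \<in> V"
  by (induction P) (auto intro!: subspace_add subspace_scale subspace_0 assms)

lemma poly_op_dvd:
  assumes "subspace V" "\<And>p. p \<in> V \<Longrightarrow> T p \<in> V" "poly_op T P p \<in> V" "P dvd Q"
  shows "poly_op T Q p \<in> V"
proof -
  obtain R where "Q = P * R" using assms(4) by auto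
  then have "poly_op T Q p = poly_op T R (poly_op T P p)"
    by (metis poly_op_mult mult.commute)
  then show ?thesis using poly_op_closed[OF assms(1-3)] by simp
qed

end

end

text \<open>An inverse of \<open>B\<close> modulo a power of \<open>t - z\<close>: since \<open>1 - B / B(z)\<close> is divisible by \<open>t - z\<close>, its
  \<open>N\<close>-th power is divisible by \<open>(t - z) ^ N\<close>, and that power is 1 minus a multiple of \<open>B\<close>.\<close>

lemma poly_inverse_mod_linear_power:
  fixes B :: "'a::field poly"
  assumes "poly B z \<noteq> 0"
  obtains b where "[:- z, 1:] ^ N dvd 1 - b * B"
proof -
  let ?e = "1 - smult (inverse (poly B z)) B"
  have "poly ?e z = 0" using assms by simp
  then have d: "[:- z, 1:] dvd ?e" by (simp only: poly_eq_0_iff_dvd)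
  have "B dvd 1 - ?e ^ N"
  proof -
    have "1 - ?e dvd 1 ^ N - ?e ^ N"
      by (rule dvdI[OF power_diff_sumr2])
    moreover have "B dvd 1 - ?e" by (simp add: dvd_smult)
    ultimately show ?thesis by (simp only: power_one dvd_trans)
  qed
  then obtain b where "1 - ?e ^ N = B * b" by auto
  then have "1 - b * B = ?e ^ N" by (simp add: algebra_simps)
  then have "[:- z, 1:] ^ N dvd 1 - b * B" using dvd_power_same[OF d, of N] by (simp only:)
  then show thesis by (rule that)
qed

lemma prod_linear_powers_nonzero:
  fixes z :: "'a::field"
  assumes "finite L" "z \<notin> L"
  shows "poly (\<Prod>x\<in>L. [:- x, 1:] ^ N) z \<noteq> 0"
  using assms by (auto simp: poly_prod)

text \<open>The Chinese remainder theorem for the moduli \<open>(t - z) ^ N\<close>, by adding one modulus at a time.\<close>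

lemma exists_interpolation_mod_powers:
  fixes h :: "'a::field \<Rightarrow> 'a"
  assumes "finite L"
  obtains Q where "\<And>z. z \<in> L \<Longrightarrow> [:- z, 1:] ^ N dvd Q - [:h z:]"
proof -
  have "\<exists>Q. \<forall>z\<in>L. [:- z, 1:] ^ N dvd Q - [:h z:]"
    using assms
  proof (induction L rule: finite_induct)
    case (insert z L)
    then obtain Q where Q: "\<forall>z\<in>L. [:- z, 1:] ^ N dvd Q - [:h z:]" by blast
    define B where "B = (\<Prod>x\<in>L. [:- x, 1:] ^ N)"
    obtain b where b: "[:- z, 1:] ^ N dvd 1 - b * B"
      using poly_inverse_mod_linear_power prod_linear_powers_nonzero insert.hyps
      unfolding B_def by metis
    define R where "R = Q + ([:h z:] - Q) * (b * B)"
    have "R - [:h z:] = (1 - b * B) * (Q - [:h z:])" by (simp add: R_def algebra_simps)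
    then have "[:- z, 1:] ^ N dvd R - [:h z:]" using b by simp
    moreover have "[:- x, 1:] ^ N dvd R - [:h x:]" if "x \<in> L" for x
    proof -
      have "R - [:h x:] = (Q - [:h x:]) + B * (b * ([:h z:] - Q))" by (simp add: R_def algebra_simps)
      moreover have "[:- x, 1:] ^ N dvd B"
        unfolding B_def using insert.hyps that by (intro dvd_prodI) auto
      ultimately show ?thesis using Q that by (simp only: dvd_add dvd_mult2)
    qed
    ultimately show ?case by blast
  qed simp
  then show thesis using that by blast
qed

lemma nonzero_poly_dvd_linear_powers:
  fixes P :: "complex poly"
  assumes "P \<noteq> 0"
  obtains L N where "finite L" "P dvd (\<Prod>x\<in>L. [:- x, 1:] ^ N)"
proof -
  let ?L = "{z. poly P z = 0}"
  have fin: "finite ?L" using assms by (rule poly_roots_finite)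
  have "P dvd (\<Prod>z\<in>?L. [:- z, 1:] ^ order z P)"
    by (subst complex_poly_decompose[of P, symmetric]) (use assms in \<open>simp add: smult_dvd_iff\<close>)
  also have "\<dots> dvd (\<Prod>z\<in>?L. [:- z, 1:] ^ degree P)"
    by (intro prod_dvd_prod le_imp_power_dvd order_degree assms)
  finally show thesis using that fin by blast
qed

section \<open>Functional calculus on a complete filtered space\<close>

text \<open>This is used for power series, filtered by the powers of the maximal ideal, and for derivations,
  filtered by the orders of their values. The space in question is \<open>F 0\<close>, which need not be the whole
  type: derivations are considered inside the space of all maps.\<close>

locale filtered_space = complex_space scale
  for scale :: "complex \<Rightarrow> 'b::ab_group_add \<Rightarrow> 'b" +
  fixes F :: "nat \<Rightarrow> 'b set"
  assumes subspace_F: "subspace (F k)"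
    and F_Suc: "F (Suc k) \<subseteq> F k"
    and F_separated: "(\<And>k. p \<in> F k) \<Longrightarrow> p = 0"
    and F_complete: "(\<And>k. u k \<in> F 0) \<Longrightarrow> (\<And>k. u (Suc k) - u k \<in> F k) \<Longrightarrow>
                     \<exists>p\<in>F 0. \<forall>k. p - u k \<in> F k"
    and F_finite_codim: "\<exists>A\<subseteq>F 0. finite A \<and> F 0 \<subseteq> span (A \<union> F k)"
begin

lemma F_0: "0 \<in> F k"
  and F_add: "p \<in> F k \<Longrightarrow> q \<in> F k \<Longrightarrow> p + q \<in> F k"
  and F_diff: "p \<in> F k \<Longrightarrow> q \<in> F k \<Longrightarrow> p - q \<in> F k"
  and F_scale: "p \<in> F k \<Longrightarrow> scale c p \<in> F k"
  using subspace_F by (auto intro: subspace_0 subspace_add subspace_diff subspace_scale)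

lemma F_trans: "p - q \<in> F k \<Longrightarrow> q - r \<in> F k \<Longrightarrow> p - r \<in> F k"
  using F_add[of "p - q" k "q - r"] by simp

lemma F_sym: "p - q \<in> F k \<Longrightarrow> q - p \<in> F k"
  using F_diff[OF F_0, of "p - q"] by simp

lemma F_congruent: "p - q \<in> F k \<Longrightarrow> p \<in> F k \<longleftrightarrow> q \<in> F k"
  using F_trans[of p q k 0] F_trans[of q p k 0] F_sym by auto

lemma F_mono: "j \<le> k \<Longrightarrow> F k \<subseteq> F j"
  using F_Suc by (metis lift_Suc_antimono_le)

lemma F_le_0: "p \<in> F k \<Longrightarrow> p \<in> F 0"
  using F_mono[of 0 k] by auto

lemma F_eqI: "(\<And>k. p - q \<in> F k) \<Longrightarrow> p = q"
  using F_separated[of "p - q"] by simp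

definition closed_subspace :: "'b set \<Rightarrow> bool" where
  "closed_subspace V \<longleftrightarrow> subspace V \<and> V \<subseteq> F 0 \<and>
     (\<forall>p\<in>F 0. (\<forall>k. \<exists>v\<in>V. p - v \<in> F k) \<longrightarrow> p \<in> V)"

definition filtered_endo :: "('b \<Rightarrow> 'b) \<Rightarrow> bool" where
  "filtered_endo T \<longleftrightarrow> endo T \<and> (\<forall>k. \<forall>p\<in>F k. T p \<in> F k)"

text \<open>The generalised eigenspace of \<open>T\<close> for \<open>z\<close> in the quotient by \<open>F k\<close>, on representatives.\<close>

definition gen_eigen :: "('b \<Rightarrow> 'b) \<Rightarrow> nat \<Rightarrow> complex \<Rightarrow> 'b set" where
  "gen_eigen T k z = {r \<in> F 0. \<exists>N. poly_op T ([:- z, 1:] ^ N) r \<in> F k}"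

context
  fixes T assumes T: "filtered_endo T"
begin

lemma endo_T: "endo T" and T_F: "p \<in> F k \<Longrightarrow> T p \<in> F k"
  using T by (auto simp: filtered_endo_def)

lemma poly_op_F: "p \<in> F k \<Longrightarrow> poly_op T P p \<in> F k"
  using poly_op_closed[OF endo_T subspace_F T_F] by blast

lemma poly_op_F_dvd: "poly_op T P p \<in> F k \<Longrightarrow> P dvd Q \<Longrightarrow> poly_op T Q p \<in> F k"
  using poly_op_dvd[OF endo_T subspace_F T_F] by blast

text \<open>The powers of \<open>T\<close> applied to one of finitely many spanning vectors are linearly dependent
  modulo \<open>F k\<close>, which gives a polynomial that annihilates this vector. The product over all
  spanning vectors annihilates the quotient, and it splits into linear factors over \<open>\<complex>\<close>.\<close>

lemma annihilating_poly:
  obtains L N where "finite L" "\<And>p. p \<in> F 0 \<Longrightarrow> poly_op T (\<Prod>x\<in>L. [:- x, 1:] ^ N) p \<in> F k"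
proof -
  obtain A where A: "A \<subseteq> F 0" "finite A" "F 0 \<subseteq> span (A \<union> F k)" using F_finite_codim by blast
  have "\<exists>P. P \<noteq> 0 \<and> poly_op T P a \<in> F k" if a: "a \<in> A" for a
  proof -
    have 0: "poly_op T (monom 1 i) a \<in> span (A \<union> F k)" for i
      using A a poly_op_F by blast
    obtain c where c: "\<exists>i\<in>{..card A}. c i \<noteq> 0" "(\<Sum>i\<le>card A. scale (c i) (poly_op T (monom 1 i) a)) \<in> F k"
      using nontrivial_relation_mod[OF subspace_F A(2), of "{..card A}" "\<lambda>i. poly_op T (monom 1 i) a" k, OF _ _ 0]
      by auto
    let ?P = "\<Sum>i\<le>card A. monom (c i) i"
    have "(\<Sum>i\<le>card A. scale (c i) (poly_op T (monom 1 i) a)) = poly_op T ?P a"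
      by (simp add: poly_op_sum[OF endo_T] poly_op_monom[OF endo_T])
    moreover have "coeff ?P i = (if i \<le> card A then c i else 0)" for i
      by (simp add: coeff_sum)
    then have "?P \<noteq> 0" using c(1) by (metis atMost_iff coeff_0)
    ultimately show ?thesis using c(2) by metis
  qed
  then obtain P where P: "\<And>a. a \<in> A \<Longrightarrow> P a \<noteq> 0" "\<And>a. a \<in> A \<Longrightarrow> poly_op T (P a) a \<in> F k" by metis
  have "(\<Prod>a\<in>A. P a) \<noteq> 0" using P A by simp
  then obtain L N where L: "finite L" "(\<Prod>a\<in>A. P a) dvd (\<Prod>x\<in>L. [:- x, 1:] ^ N)"
    using nonzero_poly_dvd_linear_powers by blast
  have "poly_op T (\<Prod>x\<in>L. [:- x, 1:] ^ N) p \<in> F k" if "p \<in> F 0" for p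
  proof (rule endo_span[OF endo_poly_op[OF endo_T] subspace_F])
    show "p \<in> span (A \<union> F k)" using that A by blast
    fix a assume "a \<in> A \<union> F k"
    then show "poly_op T (\<Prod>x\<in>L. [:- x, 1:] ^ N) a \<in> F k"
    proof
      assume a: "a \<in> A"
      have "P a dvd (\<Prod>a\<in>A. P a)" by (rule dvd_prodI[OF A(2) a])
      then show ?thesis using poly_op_F_dvd[OF P(2)[OF a]] dvd_trans L(2) by blast
    qed (rule poly_op_F)
  qed
  then show thesis using that L by blast
qed

text \<open>The primary decomposition, splitting off one eigenvalue at a time: with \<open>b\<close> inverse to \<open>B\<close> modulo
  \<open>(t - z) ^ N\<close>, the summand \<open>b B p\<close> is a generalised eigenvector for \<open>z\<close>, and the rest is
  annihilated by the remaining factors.\<close>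

lemma span_gen_eigen_if_annihilated:
  assumes "finite L" "p \<in> F 0" "poly_op T (\<Prod>x\<in>L. [:- x, 1:] ^ N) p \<in> F k"
  shows "p \<in> span ({r \<in> F 0. \<exists>z\<in>L. poly_op T ([:- z, 1:] ^ N) r \<in> F k} \<union> F k)"
  using assms
proof (induction L arbitrary: p rule: finite_induct)
  case empty
  then show ?case by (auto simp: endo_T intro: span_base)
next
  case (insert z L)
  let ?G = "\<lambda>L. {r \<in> F 0. \<exists>z\<in>L. poly_op T ([:- z, 1:] ^ N) r \<in> F k} \<union> F k"
  define B where "B = (\<Prod>x\<in>L. [:- x, 1:] ^ N)"
  obtain b where b: "[:- z, 1:] ^ N dvd 1 - b * B"
    using poly_inverse_mod_linear_power prod_linear_powers_nonzero insert.hyps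
    unfolding B_def by metis
  have ann: "poly_op T ([:- z, 1:] ^ N * B) p \<in> F k" using insert by (simp add: B_def)
  let ?p1 = "poly_op T (b * B) p" and ?p2 = "poly_op T (1 - b * B) p"
  have "poly_op T ([:- z, 1:] ^ N * (b * B)) p \<in> F k"
    using poly_op_F_dvd[OF ann] by (metis dvd_triv_left mult.assoc mult.commute)
  then have p1: "?p1 \<in> ?G (insert z L)"
    using insert.prems poly_op_F by (auto simp: poly_op_mult[OF endo_T])
  have "poly_op T (B * (1 - b * B)) p \<in> F k"
    using poly_op_F_dvd[OF ann] b by (metis mult.commute mult_dvd_mono dvd_refl)
  then have "poly_op T B ?p2 \<in> F k" by (simp add: poly_op_mult[OF endo_T])
  then have "?p2 \<in> span (?G L)" using insert.IH[of ?p2] insert.prems poly_op_F unfolding B_def by blast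
  moreover have "?G L \<subseteq> ?G (insert z L)" by blast
  ultimately have "?p2 \<in> span (?G (insert z L))" using span_mono by blast
  with span_base[OF p1] have "?p1 + ?p2 \<in> span (?G (insert z L))" by (rule span_add)
  then show ?case by (simp add: poly_op_diff[OF endo_T] endo_T)
qed

text \<open>The exponent \<open>N\<close> serves all vectors at once; this is what makes the nilpotency in
  \<open>semisimple_part_nilpotent\<close> uniform.\<close>

lemma uniform_gen_eigen_span:
  obtains N where "\<And>p. p \<in> F 0 \<Longrightarrow>
    p \<in> span ({r \<in> F 0. \<exists>z. poly_op T ([:- z, 1:] ^ N) r \<in> F k} \<union> F k)"
proof -
  obtain L N where L: "finite L" "\<And>p. p \<in> F 0 \<Longrightarrow> poly_op T (\<Prod>x\<in>L. [:- x, 1:] ^ N) p \<in> F k"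
    using annihilating_poly by metis
  have "p \<in> span ({r \<in> F 0. \<exists>z. poly_op T ([:- z, 1:] ^ N) r \<in> F k} \<union> F k)" if "p \<in> F 0" for p
    using span_gen_eigen_if_annihilated[OF L(1) that L(2)[OF that]]
      span_mono[of "{r \<in> F 0. \<exists>z\<in>L. poly_op T ([:- z, 1:] ^ N) r \<in> F k} \<union> F k"
        "{r \<in> F 0. \<exists>z. poly_op T ([:- z, 1:] ^ N) r \<in> F k} \<union> F k"] by blast
  then show thesis using that by blast
qed

lemma F_subset_gen_eigen: "F k \<subseteq> gen_eigen T k z"
  by (auto simp: gen_eigen_def F_le_0 endo_T intro!: exI[of _ 0])

lemma span_gen_eigen: "F 0 \<subseteq> span (\<Union>z. gen_eigen T k z)"
proof
  fix p assume p: "p \<in> F 0"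
  obtain N where N: "\<And>p. p \<in> F 0 \<Longrightarrow>
    p \<in> span ({r \<in> F 0. \<exists>z. poly_op T ([:- z, 1:] ^ N) r \<in> F k} \<union> F k)"
    using uniform_gen_eigen_span[of k] by blast
  have "({r \<in> F 0. \<exists>z. poly_op T ([:- z, 1:] ^ N) r \<in> F k} \<union> F k) \<subseteq> (\<Union>z. gen_eigen T k z)"
    using F_subset_gen_eigen[of k 0] unfolding gen_eigen_def by blast
  then show "p \<in> span (\<Union>z. gen_eigen T k z)" using N[OF p] span_mono by blast
qed

text \<open>To compare two linear maps modulo \<open>F k\<close> it suffices to do so on generalised eigenvectors.\<close>

lemma gen_eigen_induct:
  assumes "p \<in> F 0" "\<And>z r. r \<in> gen_eigen T k z \<Longrightarrow> P r" "P 0"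
    and "\<And>a b c. a \<in> F 0 \<Longrightarrow> b \<in> F 0 \<Longrightarrow> P a \<Longrightarrow> P b \<Longrightarrow> P (scale c a + b)"
  shows "P p"
proof -
  have "p \<in> span (\<Union>z. gen_eigen T k z)" using assms(1) span_gen_eigen by blast
  then have "p \<in> F 0 \<and> P p"
  proof (induction rule: span_induct_alt)
    case base
    then show ?case using assms F_0 by simp
  next
    case (step c x y)
    then have "x \<in> F 0" "P x" using assms(2) by (auto simp: gen_eigen_def)
    then show ?case using step assms(4) F_add F_scale by blast
  qed
  then show ?thesis ..
qed

lemma gen_eigen_mono: "r \<in> gen_eigen T (Suc k) z \<Longrightarrow> r \<in> gen_eigen T k z"
  using F_Suc by (auto simp: gen_eigen_def)

text \<open>The eigenvalue \<open>z\<close> need not be a root of the annihilating polynomial. If it is not, then the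
  generalised eigenspace is zero in the quotient. This freedom allows one to compare polynomials
  that were chosen at different levels of the filtration.\<close>

lemma interpolation_on_gen_eigen:
  assumes L: "finite L" and ann: "\<And>p. p \<in> F 0 \<Longrightarrow> poly_op T (\<Prod>x\<in>L. [:- x, 1:] ^ N) p \<in> F k"
    and Q: "\<And>z. z \<in> L \<Longrightarrow> [:- z, 1:] ^ N dvd Q - [:h z:]"
    and r: "r \<in> gen_eigen T k z"
  shows "poly_op T Q r - scale (h z) r \<in> F k"
proof -
  obtain M where M: "poly_op T ([:- z, 1:] ^ M) r \<in> F k" and r0: "r \<in> F 0"
    using r by (auto simp: gen_eigen_def)
  define B where "B = (\<Prod>x\<in>L - {z}. [:- x, 1:] ^ N)"
  obtain b where b: "[:- z, 1:] ^ M dvd 1 - b * B"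
    using poly_inverse_mod_linear_power prod_linear_powers_nonzero[of "L - {z}"] L
    unfolding B_def by (metis Diff_iff finite_Diff insertI1)
  have 1: "poly_op T (1 - b * B) r \<in> F k" using poly_op_F_dvd[OF M b] .
  have *: "poly_op T R r \<in> F k" if "poly_op T (R * B) r \<in> F k" for R
  proof -
    have "poly_op T (R * (1 - b * B) + b * (R * B)) r \<in> F k"
      unfolding poly_op_add[OF endo_T]
      by (intro F_add) (auto simp: poly_op_mult[OF endo_T] intro!: poly_op_F 1 that[unfolded poly_op_mult[OF endo_T]])
    then show ?thesis by (simp add: algebra_simps)
  qed
  have "poly_op T (Q - [:h z:]) r \<in> F k"
  proof (cases "z \<in> L")
    case True
    have "poly_op T ([:- z, 1:] ^ N * B) r \<in> F k"
      using ann[OF r0] True L by (simp add: B_def prod.remove)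
    from poly_op_F_dvd[OF *[OF this] Q[OF True]] show ?thesis .
  next
    case False
    then have "poly_op T (1 * B) r \<in> F k" using ann[OF r0] by (simp add: B_def)
    from poly_op_F_dvd[OF *[OF this]] show ?thesis by simp
  qed
  then show ?thesis by (simp add: poly_op_diff[OF endo_T] endo_zero[OF endo_T] poly_op_0[OF endo_T] poly_op_pCons[OF endo_T])
qed

text \<open>A polynomial that acts on the quotient by \<open>F k\<close> as the scalar \<open>h z\<close> on the generalised
  eigenspace of each \<open>z\<close>.\<close>

definition interp_poly :: "(complex \<Rightarrow> complex) \<Rightarrow> nat \<Rightarrow> complex poly" where
  "interp_poly h k = (SOME Q. \<forall>z. \<forall>r\<in>gen_eigen T k z. poly_op T Q r - scale (h z) r \<in> F k)"

lemma interp_poly: "r \<in> gen_eigen T k z \<Longrightarrow> poly_op T (interp_poly h k) r - scale (h z) r \<in> F k"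
proof -
  assume r: "r \<in> gen_eigen T k z"
  obtain L N where L: "finite L" "\<And>p. p \<in> F 0 \<Longrightarrow> poly_op T (\<Prod>x\<in>L. [:- x, 1:] ^ N) p \<in> F k"
    using annihilating_poly[of k] by blast
  obtain Q where Q: "\<And>z. z \<in> L \<Longrightarrow> [:- z, 1:] ^ N dvd Q - [:h z:]"
    using exists_interpolation_mod_powers[OF L(1)] by metis
  have "\<exists>Q. \<forall>z. \<forall>r\<in>gen_eigen T k z. poly_op T Q r - scale (h z) r \<in> F k"
    using interpolation_on_gen_eigen[OF L Q] by blast
  from someI_ex[OF this] r show ?thesis unfolding interp_poly_def by blast
qed

text \<open>The limit of the values at \<open>T\<close> of the polynomials \<open>interp_poly h k\<close>. If the eigenvalues of \<open>T\<close> are thought of as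
  a grading, then this is the operator that multiplies the part of degree \<open>z\<close> by \<open>h z\<close>; for
  \<open>h = id\<close> it is the semisimple part of \<open>T\<close>.\<close>

definition fcalc :: "(complex \<Rightarrow> complex) \<Rightarrow> 'b \<Rightarrow> 'b" where
  "fcalc h p = (SOME q. q \<in> F 0 \<and> (\<forall>k. q - poly_op T (interp_poly h k) p \<in> F k))"

text \<open>Two consecutive approximants agree modulo \<open>F k\<close> because both act there on generalised eigenvectors
  as multiplication by \<open>h z\<close>.\<close>

lemma fcalc_exists:
  assumes p: "p \<in> F 0"
  shows "\<exists>q. q \<in> F 0 \<and> (\<forall>k. q - poly_op T (interp_poly h k) p \<in> F k)"
proof -
  let ?u = "\<lambda>k. poly_op T (interp_poly h k) p"
  have "?u (Suc k) - ?u k \<in> F k" for k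
    using p
  proof (rule gen_eigen_induct[of _ "Suc k"])
    fix z r assume r: "r \<in> gen_eigen T (Suc k) z"
    have "poly_op T (interp_poly h (Suc k)) r - scale (h z) r \<in> F k"
      using interp_poly[OF r] F_Suc by blast
    moreover have "poly_op T (interp_poly h k) r - scale (h z) r \<in> F k"
      using interp_poly gen_eigen_mono[OF r] by blast
    ultimately show "poly_op T (interp_poly h (Suc k)) r - poly_op T (interp_poly h k) r \<in> F k"
      using F_trans F_sym by blast
  next
    show "poly_op T (interp_poly h (Suc k)) 0 - poly_op T (interp_poly h k) 0 \<in> F k"
      by (simp add: endo_zero endo_poly_op endo_T F_0)
  next
    fix a b c
    assume "poly_op T (interp_poly h (Suc k)) a - poly_op T (interp_poly h k) a \<in> F k"
      "poly_op T (interp_poly h (Suc k)) b - poly_op T (interp_poly h k) b \<in> F k"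
    from F_add[OF F_scale[OF this(1), of c] this(2)]
    show "poly_op T (interp_poly h (Suc k)) (scale c a + b) - poly_op T (interp_poly h k) (scale c a + b) \<in> F k"
      by (simp add: endo_add[OF endo_poly_op[OF endo_T]] endo_scale[OF endo_poly_op[OF endo_T]]
          scale_right_diff_distrib algebra_simps)
  qed
  then show ?thesis using F_complete[of ?u] poly_op_F[OF p] by blast
qed

lemma fcalc_F0: "p \<in> F 0 \<Longrightarrow> fcalc h p \<in> F 0"
  and fcalc_approx: "p \<in> F 0 \<Longrightarrow> fcalc h p - poly_op T (interp_poly h k) p \<in> F k"
  using someI_ex[OF fcalc_exists[of p h]] unfolding fcalc_def by auto

lemma fcalc_gen_eigen:
  assumes "r \<in> gen_eigen T k z"
  shows "fcalc h r - scale (h z) r \<in> F k"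
proof -
  have "r \<in> F 0" using assms by (simp add: gen_eigen_def)
  then show ?thesis using F_trans[OF fcalc_approx interp_poly[OF assms]] by blast
qed

lemma fcalc_add:
  assumes "p \<in> F 0" "q \<in> F 0"
  shows "fcalc h (p + q) = fcalc h p + fcalc h q"
proof (rule F_eqI)
  fix k
  let ?Q = "poly_op T (interp_poly h k)"
  have "fcalc h (p + q) - ?Q (p + q) \<in> F k" using assms F_add fcalc_approx by blast
  moreover have "(fcalc h p - ?Q p) + (fcalc h q - ?Q q) \<in> F k" using assms F_add fcalc_approx by blast
  ultimately have "fcalc h (p + q) - ?Q (p + q) - ((fcalc h p - ?Q p) + (fcalc h q - ?Q q)) \<in> F k"
    using F_diff by blast
  then show "fcalc h (p + q) - (fcalc h p + fcalc h q) \<in> F k"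
    by (simp add: endo_add[OF endo_poly_op[OF endo_T]] algebra_simps)
qed

lemma fcalc_scale:
  assumes "p \<in> F 0"
  shows "fcalc h (scale c p) = scale c (fcalc h p)"
proof (rule F_eqI)
  fix k
  let ?Q = "poly_op T (interp_poly h k)"
  have "fcalc h (scale c p) - ?Q (scale c p) \<in> F k" using assms F_scale fcalc_approx by blast
  moreover have "scale c (fcalc h p - ?Q p) \<in> F k" using assms F_scale fcalc_approx by blast
  ultimately have "fcalc h (scale c p) - ?Q (scale c p) - scale c (fcalc h p - ?Q p) \<in> F k"
    using F_diff by blast
  then show "fcalc h (scale c p) - scale c (fcalc h p) \<in> F k"
    by (simp add: endo_scale[OF endo_poly_op[OF endo_T]] scale_right_diff_distrib)
qed

lemma fcalc_F: "p \<in> F k \<Longrightarrow> fcalc h p \<in> F k"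
  using fcalc_approx[of p h k] F_congruent poly_op_F F_le_0 by blast

lemma fcalc_diff: "p \<in> F 0 \<Longrightarrow> q \<in> F 0 \<Longrightarrow> fcalc h (p - q) = fcalc h p - fcalc h q"
  using fcalc_add[of p "scale (-1) q" h] fcalc_scale[of q h "-1"] F_scale[of q 0 "-1"] by simp

text \<open>A limit of polynomials in \<open>T\<close> preserves whatever is closed and stable under \<open>T\<close>. Applied to the
  ideal of \<open>f\<close>, this keeps the operators below among the logarithmic derivations.\<close>

lemma fcalc_closed_subspace:
  assumes "closed_subspace V" "\<And>p. p \<in> V \<Longrightarrow> T p \<in> V" "p \<in> V"
  shows "fcalc h p \<in> V"
proof -
  have V: "subspace V" "V \<subseteq> F 0" using assms by (auto simp: closed_subspace_def)
  have "p \<in> F 0" using assms V by auto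
  then have "\<forall>k. \<exists>v\<in>V. fcalc h p - v \<in> F k"
    using fcalc_approx poly_op_closed[OF endo_T V(1) assms(2,3)] by blast
  then show ?thesis using assms(1) fcalc_F0[OF \<open>p \<in> F 0\<close>] by (auto simp: closed_subspace_def)
qed

lemma fcalc_commute:
  assumes S: "filtered_endo S" and "\<And>p. S (T p) = T (S p)" and p: "p \<in> F 0"
  shows "S (fcalc h p) = fcalc h (S p)"
proof (rule F_eqI)
  fix k
  let ?Q = "poly_op T (interp_poly h k)"
  have "S (fcalc h p) - S (?Q p) \<in> F k"
    using fcalc_approx[OF p] S by (metis endo_diff filtered_endo_def)
  moreover have "S (?Q p) = ?Q (S p)"
    using S assms(2) by (intro poly_op_commute endo_T) (auto simp: filtered_endo_def)
  moreover have "fcalc h (S p) - ?Q (S p) \<in> F k" using fcalc_approx S p by (auto simp: filtered_endo_def)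
  ultimately show "S (fcalc h p) - fcalc h (S p) \<in> F k" using F_trans F_sym by metis
qed

text \<open>The characterisation by generalised eigenvectors, from which the algebraic rules follow.\<close>

lemma fcalc_unique:
  assumes "\<And>p q. p \<in> F 0 \<Longrightarrow> q \<in> F 0 \<Longrightarrow> S (p + q) = S p + S q"
    "\<And>c p. p \<in> F 0 \<Longrightarrow> S (scale c p) = scale c (S p)"
    "\<And>k z r. r \<in> gen_eigen T k z \<Longrightarrow> S r - scale (h z) r \<in> F k" "p \<in> F 0"
  shows "S p = fcalc h p"
proof (rule F_eqI)
  fix k
  have S0: "S 0 = 0" using assms(2)[of 0 0] F_0 by simp
  show "S p - fcalc h p \<in> F k"
    using assms(4)
  proof (rule gen_eigen_induct[of _ k])
    show "S r - fcalc h r \<in> F k" if "r \<in> gen_eigen T k z" for z r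
      using assms(3)[OF that] fcalc_gen_eigen[OF that] F_trans F_sym by blast
    show "S 0 - fcalc h 0 \<in> F k" using fcalc_scale[of 0 h 0] S0 F_0 by simp
    fix a b c assume ab: "a \<in> F 0" "b \<in> F 0" "S a - fcalc h a \<in> F k" "S b - fcalc h b \<in> F k"
    have "S (scale c a + b) - fcalc h (scale c a + b) = scale c (S a - fcalc h a) + (S b - fcalc h b)"
      using ab by (simp add: fcalc_add fcalc_scale assms(1,2) F_scale scale_right_diff_distrib)
    then show "S (scale c a + b) - fcalc h (scale c a + b) \<in> F k" using ab F_add F_scale by metis
  qed
qed

lemma fcalc_comp:
  assumes "p \<in> F 0"
  shows "fcalc g (fcalc h p) = fcalc (\<lambda>z. g z * h z) p"
proof (rule fcalc_unique[of "\<lambda>p. fcalc g (fcalc h p)"])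
  fix k z r assume r: "r \<in> gen_eigen T k z"
  then have r0: "r \<in> F 0" by (simp add: gen_eigen_def)
  have "fcalc g (fcalc h r) - fcalc g (scale (h z) r) \<in> F k"
    using fcalc_F[OF fcalc_gen_eigen[OF r, of h], of g] r0 by (simp add: fcalc_diff fcalc_F0 F_scale)
  moreover have "scale (h z) (fcalc g r - scale (g z) r) \<in> F k" using fcalc_gen_eigen[OF r] F_scale by blast
  then have "fcalc g (scale (h z) r) - scale (g z * h z) r \<in> F k"
    using r0 by (simp add: fcalc_scale scale_right_diff_distrib mult.commute)
  ultimately show "fcalc g (fcalc h r) - scale (g z * h z) r \<in> F k" using F_trans by blast
qed (use assms in \<open>auto simp: fcalc_add fcalc_scale fcalc_F0\<close>)

lemma gen_eigenI: "r \<in> F 0 \<Longrightarrow> T r - scale z r \<in> F k \<Longrightarrow> r \<in> gen_eigen T k z"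
  unfolding gen_eigen_def using endo_T
  by (auto intro!: exI[of _ 1] simp: endo_zero)

lemma fcalc_eigenvector:
  assumes "r \<in> F 0" "T r = scale z r"
  shows "fcalc h r = scale (h z) r"
  using fcalc_gen_eigen[OF gen_eigenI[OF assms(1), of z]] assms F_0 by (intro F_eqI) auto

abbreviation eigenproj :: "complex \<Rightarrow> 'b \<Rightarrow> 'b" where
  "eigenproj z \<equiv> fcalc (\<lambda>x. if x = z then 1 else 0)"

lemma fcalc_eigenproj:
  assumes "p \<in> F 0"
  shows "fcalc h (eigenproj z p) = scale (h z) (eigenproj z p)"
proof -
  have "fcalc (\<lambda>x. h x * (if x = z then 1 else 0)) p = scale (h z) (eigenproj z p)"
    by (rule fcalc_unique[symmetric, of "\<lambda>p. scale (h z) (eigenproj z p)"])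
      (use assms fcalc_gen_eigen F_scale in \<open>auto simp: fcalc_add fcalc_scale scale_right_distrib
        scale_left_commute[of "h z"] fcalc_F0 simp flip: scale_right_diff_distrib split: if_splits
        dest!: fcalc_gen_eigen[where h = "\<lambda>x. if x = z then 1 else 0"]\<close>)
  then show ?thesis using fcalc_comp[OF assms] by simp
qed

lemma sum_eigenproj:
  obtains L where "finite L" "\<And>p. p \<in> F 0 \<Longrightarrow> p - (\<Sum>z\<in>L. eigenproj z p) \<in> F k"
proof -
  obtain L N where L: "finite L" "\<And>p. p \<in> F 0 \<Longrightarrow> poly_op T (\<Prod>x\<in>L. [:- x, 1:] ^ N) p \<in> F k"
    using annihilating_poly by metis
  have "p - (\<Sum>z\<in>L. eigenproj z p) \<in> F k" if "p \<in> F 0" for p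
  proof -
    have "p \<in> span ({r \<in> F 0. \<exists>z\<in>L. poly_op T ([:- z, 1:] ^ N) r \<in> F k} \<union> F k)"
      using span_gen_eigen_if_annihilated[OF L(1) that L(2)[OF that]] .
    then have "p \<in> F 0 \<and> p - (\<Sum>z\<in>L. eigenproj z p) \<in> F k"
    proof (induction rule: span_induct_alt)
      case base
      then show ?case using fcalc_scale[of 0 _ 0] by (simp add: F_0)
    next
      case (step c r q)
      have r: "r \<in> F 0" "r - (\<Sum>z\<in>L. eigenproj z r) \<in> F k"
      proof -
        show r0: "r \<in> F 0" using step(1) F_le_0 by auto
        show "r - (\<Sum>z\<in>L. eigenproj z r) \<in> F k"
        proof (cases "r \<in> F k")
          case True
          then show ?thesis using L by (intro F_diff subspace_sum[OF subspace_F] fcalc_F)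
        next
          case False
          then obtain z where z: "z \<in> L" "r \<in> gen_eigen T k z" using step(1) by (auto simp: gen_eigen_def)
          have "(\<Sum>x\<in>L. eigenproj x r - scale (if z = x then 1 else 0) r) \<in> F k"
            by (intro subspace_sum[OF subspace_F] fcalc_gen_eigen z)
          moreover have "(\<Sum>x\<in>L. scale (if z = x then 1 else 0) r) = r"
            using z L by (subst sum.cong[OF refl, of _ _ "\<lambda>x. if z = x then r else 0"]) auto
          ultimately have "(\<Sum>z\<in>L. eigenproj z r) - r \<in> F k" by (simp add: sum_subtractf)
          then show ?thesis by (rule F_sym)
        qed
      qed
      have q0: "q \<in> F 0" using step by blast
      have "eigenproj z (scale c r + q) = scale c (eigenproj z r) + eigenproj z q" for z
        using r(1) q0 by (simp add: fcalc_add fcalc_scale F_scale)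
      then have "scale c r + q - (\<Sum>z\<in>L. eigenproj z (scale c r + q)) =
            scale c (r - (\<Sum>z\<in>L. eigenproj z r)) + (q - (\<Sum>z\<in>L. eigenproj z q))"
        by (simp only: sum.distrib scale_right_diff_distrib scale_sum_right) (simp add: algebra_simps)
      moreover have "scale c (r - (\<Sum>z\<in>L. eigenproj z r)) + (q - (\<Sum>z\<in>L. eigenproj z q)) \<in> F k"
        using r(2) step(2) by (intro F_add F_scale) auto
      ultimately show ?case using F_add[OF F_scale[OF r(1)] q0] by (simp only:)
    qed
    then show ?thesis ..
  qed
  then show thesis using that L by blast
qed

text \<open>On a generalised eigenspace for \<open>z\<close>, the difference acts as \<open>T - z\<close> modulo \<open>F k\<close>.\<close>

lemma semisimple_part_nilpotent:
  "\<exists>N. \<forall>p\<in>F 0. ((\<lambda>p. T p - fcalc (\<lambda>z. z) p) ^^ N) p \<in> F k"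
proof -
  let ?A = "\<lambda>p. T p - fcalc (\<lambda>z. z) p"
  have A_F: "(?A ^^ n) p \<in> F j" if "p \<in> F j" for p n j
    using that by (induction n) (auto intro: F_diff T_F fcalc_F)
  have A_lin: "(?A ^^ n) (scale c a + b) = scale c ((?A ^^ n) a) + (?A ^^ n) b"
    if "a \<in> F 0" "b \<in> F 0" for a b c n
    by (induction n) (use A_F that in \<open>auto simp: fcalc_add fcalc_scale F_scale endo_add[OF endo_T]
      endo_scale[OF endo_T] scale_right_diff_distrib\<close>)
  obtain N where N: "\<And>p. p \<in> F 0 \<Longrightarrow>
    p \<in> span ({r \<in> F 0. \<exists>z. poly_op T ([:- z, 1:] ^ N) r \<in> F k} \<union> F k)"
    using uniform_gen_eigen_span[of k] by blast
  have gen: "(?A ^^ n) r - poly_op T ([:- z, 1:] ^ n) r \<in> F k" if r': "r \<in> gen_eigen T k z" for r z n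
  proof (induction n)
    case 0
    then show ?case using endo_T F_0 by simp
  next
    case (Suc n)
    let ?r = "poly_op T ([:- z, 1:] ^ n) r"
    have r0: "r \<in> F 0" using r' by (simp add: gen_eigen_def)
    obtain M where "poly_op T ([:- z, 1:] ^ M) r \<in> F k" using r' by (auto simp: gen_eigen_def)
    then have "poly_op T ([:- z, 1:] ^ M) ?r \<in> F k"
      using poly_op_F_dvd[of "[:- z, 1:] ^ M" r k "[:- z, 1:] ^ M * [:- z, 1:] ^ n"] by (simp add: poly_op_mult[OF endo_T])
    then have r: "?r \<in> gen_eigen T k z" using r0 by (auto simp: gen_eigen_def poly_op_F)
    have "?A ((?A ^^ n) r) - ?A ?r = ?A ((?A ^^ n) r - ?r)"
      using r0 A_F by (simp add: fcalc_diff poly_op_F endo_diff[OF endo_T] algebra_simps)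
    then have "?A ((?A ^^ n) r) - ?A ?r \<in> F k" using Suc A_F[of _ k 1] by simp
    moreover have "(?A ^^ Suc n) r = ?A ((?A ^^ n) r)" by simp
    moreover have "?A ?r - (T ?r - scale z ?r) \<in> F k"
      using fcalc_gen_eigen[OF r, of "\<lambda>z. z"] F_sym by fastforce
    moreover have "poly_op T ([:- z, 1:] ^ Suc n) r = T ?r - scale z ?r"
      by (simp add: poly_op_mult[OF endo_T] poly_op_linear_factor[OF endo_T] del: poly_op_pCons mult_pCons_left)
    ultimately show ?case using F_trans by (simp only:)
  qed
  have "(?A ^^ N) p \<in> F k" if "p \<in> F 0" for p
  proof -
    have "p \<in> F 0 \<and> (?A ^^ N) p \<in> F k" using N[OF that]
    proof (induction rule: span_induct_alt)
      case base
      then show ?case using A_F F_0 by blast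
    next
      case (step c r q)
      have r0: "r \<in> F 0" using step(1) F_le_0 by auto
      have "(?A ^^ N) r \<in> F k"
      proof (cases "r \<in> F k")
        case False
        then obtain z where "poly_op T ([:- z, 1:] ^ N) r \<in> F k" using step(1) by auto
        then show ?thesis using gen[of r z N] r0 F_congruent by (auto simp: gen_eigen_def)
      qed (rule A_F)
      moreover have "q \<in> F 0" using step by blast
      ultimately show ?case using step(2) r0 by (simp add: A_lin F_add F_scale)
    qed
    then show ?thesis ..
  qed
  then show ?thesis by blast
qed

end

text \<open>Semisimplicity as a fixed point property: the operator is its own semisimple part.\<close>

definition semisimple_op :: "('b \<Rightarrow> 'b) \<Rightarrow> bool" where
  "semisimple_op T \<longleftrightarrow> filtered_endo T \<and> (\<forall>p\<in>F 0. fcalc T (\<lambda>z. z) p = T p)"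

lemma semisimple_opI:
  assumes T: "filtered_endo T"
    and "\<And>k p. p \<in> F 0 \<Longrightarrow> p \<in> span ({r \<in> F 0. \<exists>z. T r - scale z r \<in> F k} \<union> F k)"
  shows "semisimple_op T"
  unfolding semisimple_op_def
proof (intro conjI T ballI F_eqI)
  fix p k assume p: "p \<in> F 0"
  have E: "endo T" using T by (simp add: filtered_endo_def)
  from assms(2)[OF p, of k] have "p \<in> F 0 \<and> fcalc T (\<lambda>z. z) p - T p \<in> F k"
  proof (induction rule: span_induct_alt)
    case base
    then show ?case using fcalc_scale[OF T, of 0 _ 0] F_0 by (simp add: endo_zero[OF E])
  next
    case (step c r q)
    have r0: "r \<in> F 0" using step(1) F_le_0 by auto
    have q0: "q \<in> F 0" using step by blast
    have fr: "fcalc T (\<lambda>z. z) r - T r \<in> F k"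
    proof (cases "r \<in> F k")
      case True
      then show ?thesis using T fcalc_F[OF T] F_diff by (auto simp: filtered_endo_def)
    next
      case False
      then obtain z where z: "T r - scale z r \<in> F k" using step(1) by auto
      then show ?thesis
        using fcalc_gen_eigen[OF T gen_eigenI[OF T r0 z], of "\<lambda>z. z"] F_trans F_sym by blast
    qed
    have "fcalc T (\<lambda>z. z) (scale c r + q) - T (scale c r + q) =
        scale c (fcalc T (\<lambda>z. z) r - T r) + (fcalc T (\<lambda>z. z) q - T q)"
      using r0 q0 by (simp add: fcalc_add[OF T] fcalc_scale[OF T] F_scale endo_add[OF E] endo_scale[OF E] scale_right_diff_distrib)
    moreover have "scale c (fcalc T (\<lambda>z. z) r - T r) + (fcalc T (\<lambda>z. z) q - T q) \<in> F k"
      using fr step(2) by (intro F_add F_scale) auto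
    ultimately show ?case using F_add[OF F_scale[OF r0] q0] by (simp only:)
  qed
  then show "fcalc T (\<lambda>z. z) p - T p \<in> F k" ..
qed

definition joint_eigenvectors :: "('b \<Rightarrow> 'b) set \<Rightarrow> 'b set" where
  "joint_eigenvectors S = {p. \<forall>T\<in>S. \<exists>z. T p = scale z p}"

text \<open>Each \<open>v\<close> is modulo \<open>F k\<close> the sum of its components \<open>eigenproj T z v\<close>. For semisimple \<open>T\<close> these are
  eigenvectors exactly, not only modulo \<open>F k\<close>; they stay in \<open>V\<close> since \<open>V\<close> is closed, and they remain
  eigenvectors of every operator that commutes with \<open>T\<close>. So one operator can be treated at a time.\<close>

lemma joint_eigenvectors_span:
  assumes "finite S" "\<forall>T\<in>S. semisimple_op T"
    and "\<forall>T\<in>S. \<forall>U\<in>S. \<forall>p. T (U p) = U (T p)"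
    and V: "closed_subspace V" and "\<forall>T\<in>S. \<forall>p\<in>V. T p \<in> V"
  shows "V \<subseteq> span ((V \<inter> joint_eigenvectors S) \<union> F k)"
  using assms(1,2,3,5)
proof (induction S rule: finite_induct)
  case empty
  then show ?case by (auto simp: joint_eigenvectors_def intro: span_base)
next
  case (insert T S)
  have T: "filtered_endo T" and ss: "\<And>p. p \<in> F 0 \<Longrightarrow> fcalc T (\<lambda>z. z) p = T p"
    using insert.prems(1) by (auto simp: semisimple_op_def)
  have V0: "V \<subseteq> F 0" using V by (simp add: closed_subspace_def)
  obtain L where L: "finite L" "\<And>p. p \<in> F 0 \<Longrightarrow> p - (\<Sum>z\<in>L. eigenproj T z p) \<in> F k"
    using sum_eigenproj[OF T] by metis
  let ?J = "(V \<inter> joint_eigenvectors (insert T S)) \<union> F k"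
  have "a \<in> span ?J" if a: "a \<in> (V \<inter> joint_eigenvectors S) \<union> F k" for a
  proof (cases "a \<in> F k")
    case False
    then have aV: "a \<in> V" and aJ: "a \<in> joint_eigenvectors S" using a by auto
    have a0: "a \<in> F 0" using aV V0 by auto
    have "eigenproj T z a \<in> ?J" for z
    proof -
      have "eigenproj T z a \<in> V"
        using fcalc_closed_subspace[OF T V _ aV] insert.prems(3) by blast
      moreover have "T (eigenproj T z a) = scale z (eigenproj T z a)"
        using fcalc_eigenproj[OF T a0, of "\<lambda>z. z" z] ss[OF fcalc_F0[OF T a0]] by simp
      moreover have "\<exists>x. U (eigenproj T z a) = scale x (eigenproj T z a)" if U: "U \<in> S" for U
      proof -
        obtain x where x: "U a = scale x a" using aJ U by (auto simp: joint_eigenvectors_def)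
        have "filtered_endo U" using U insert.prems(1) by (simp add: semisimple_op_def)
        then have "U (eigenproj T z a) = eigenproj T z (U a)"
          using fcalc_commute[OF T _ _ a0] U insert.prems(2) by blast
        then show ?thesis using x fcalc_scale[OF T a0] by metis
      qed
      ultimately show ?thesis by (auto simp: joint_eigenvectors_def)
    qed
    then have "(\<Sum>z\<in>L. eigenproj T z a) \<in> span ?J" by (intro span_sum span_base)
    moreover have "a - (\<Sum>z\<in>L. eigenproj T z a) \<in> span ?J" using L(2)[OF a0] span_base by blast
    ultimately show ?thesis using span_add by fastforce
  qed (auto intro: span_base)
  then have "span ((V \<inter> joint_eigenvectors S) \<union> F k) \<subseteq> span ?J"
    by (intro span_minimal) auto
  moreover have "V \<subseteq> span ((V \<inter> joint_eigenvectors S) \<union> F k)"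
    by (rule insert.IH) (use insert.prems in blast)+
  ultimately show ?case by blast
qed

end

section \<open>The ring of formal power series\<close>

(* In the regular module this rule reverses associativity. *)
declare mfps_ideal.scale_scale [simp del]

lemma mfps_coeff_simps [simp]:
  "mfps_coeff (p + q) a = mfps_coeff p a + mfps_coeff q a"
  "mfps_coeff (p - q) a = mfps_coeff p a - mfps_coeff q a"
  "mfps_coeff (- p) a = - mfps_coeff p a"
  "mfps_coeff 0 a = 0"
  "mfps_coeff 1 a = (if a = 0 then 1 else 0)"
  "mfps_coeff (mfps_const c) a = (if a = 0 then c else 0)"
  by (simp_all add: plus_mfps.rep_eq minus_mfps.rep_eq uminus_mfps.rep_eq zero_mfps.rep_eq
      one_mfps.rep_eq mfps_const.rep_eq)

lemma mfps_coeff_sum [simp]: "mfps_coeff (sum f A) a = (\<Sum>x\<in>A. mfps_coeff (f x) a)"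
  by (induction A rule: infinite_finite_induct) auto

lemma mfps_coeff_mult:
  "mfps_coeff (p * q) a = (\<Sum>(b, c) | b + c = a. mfps_coeff p b * mfps_coeff q c)"
  by (simp add: times_mfps.rep_eq)

lemma mfps_coeff_const_mult [simp]: "mfps_coeff (mfps_const c * p) a = c * mfps_coeff p a"
  using sum_exponent_pairs_0[where \<alpha> = a and c = c and h = "mfps_coeff p"] by (simp add: mfps_coeff_mult)

lemma mfps_const_simps:
  "mfps_const (c + d) = mfps_const c + mfps_const d"
  "mfps_const (c - d) = mfps_const c - mfps_const d"
  "mfps_const (c * d) = mfps_const c * mfps_const d"
  "mfps_const 0 = 0" "mfps_const 1 = 1"
  by (rule mfps_eqI; simp)+

lemma mfps_coeff_Abs [simp]: "mfps_coeff (Abs_mfps f) = f"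
  by (simp add: Abs_mfps_inverse)

lemma mfps_coeff_mult_0 [simp]: "mfps_coeff (p * q) 0 = mfps_coeff p 0 * mfps_coeff q 0"
proof -
  have "{(b, c). b + c = (0 :: 'a \<Rightarrow> nat)} = {(0, 0)}" by (auto simp: fun_eq_iff)
  then show ?thesis by (simp add: mfps_coeff_mult)
qed

definition monomial :: "('n \<Rightarrow> nat) \<Rightarrow> 'n mfps" where
  "monomial b = Abs_mfps (\<lambda>a. if a = b then 1 else 0)"

lemma mfps_coeff_monomial_mult:
  "mfps_coeff (monomial b * q) a = (if b \<le> a then mfps_coeff q (a - b) else 0)"
proof -
  have "mfps_coeff (monomial b * q) a =
        (\<Sum>(x, y) | x + y = a. if x = b then mfps_coeff q y else 0)"
    unfolding mfps_coeff_mult by (intro sum.cong) (auto simp: monomial_def)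
  also have "\<dots> = (\<Sum>(x, y) \<in> (if b \<le> a then {(b, a - b)} else {}). if x = b then mfps_coeff q y else 0)"
  proof (rule sum.mono_neutral_right)
    show "finite {(x, y). x + y = a}" by (rule finite_exponent_pairs)
    show "(if b \<le> a then {(b, a - b)} else {}) \<subseteq> {(x, y). x + y = a}"
      by (auto simp: le_fun_def fun_eq_iff)
    have "c = a - b" "b \<le> a" if "b + c = a" for c
      using that[symmetric] by (simp_all add: le_fun_def fun_eq_iff)
    then show "\<forall>i\<in>{(x, y). x + y = a} - (if b \<le> a then {(b, a - b)} else {}).
       (case i of (x, y) \<Rightarrow> if x = b then mfps_coeff q y else 0) = 0"
      by (auto split: if_splits)
  qed
  finally show ?thesis by simp
qed

definition unit_exponent :: "'n \<Rightarrow> 'n \<Rightarrow> nat" where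
  "unit_exponent i = (\<lambda>j. if j = i then 1 else 0)"

lemma mfps_X_eq_monomial: "mfps_X i = monomial (unit_exponent i)"
  by (rule mfps_eqI) (simp add: mfps_X.rep_eq monomial_def unit_exponent_def)

lemma unit_exponent_le: "unit_exponent i \<le> a \<longleftrightarrow> 0 < a i"
  by (auto simp: unit_exponent_def le_fun_def)

lemma mfps_coeff_X_mult:
  "mfps_coeff (mfps_X i * q) a = (if 0 < a i then mfps_coeff q (a - unit_exponent i) else 0)"
  by (simp add: mfps_X_eq_monomial mfps_coeff_monomial_mult unit_exponent_le)

lemma diff_add_exponent: "b \<le> a \<Longrightarrow> a - b + b = (a :: 'n \<Rightarrow> nat)"
  by (auto simp: le_fun_def fun_eq_iff)

lemma mfps_X_mult_cancel: "mfps_X i * p = mfps_X i * q \<Longrightarrow> p = q"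
proof (rule mfps_eqI)
  fix a assume "mfps_X i * p = mfps_X i * q"
  then have "mfps_coeff (mfps_X i * p) (a + unit_exponent i) = mfps_coeff (mfps_X i * q) (a + unit_exponent i)"
    by simp
  then show "mfps_coeff p a = mfps_coeff q a" by (simp add: mfps_coeff_X_mult) (simp add: unit_exponent_def)
qed

definition total_degree :: "('n::finite \<Rightarrow> nat) \<Rightarrow> nat" where
  "total_degree a = (\<Sum>i\<in>UNIV. a i)"

lemma total_degree_add [simp]: "total_degree (a + b) = total_degree a + total_degree b"
  by (simp add: total_degree_def sum.distrib)

lemma total_degree_unit_exponent [simp]: "total_degree (unit_exponent i) = 1"
  by (simp add: total_degree_def unit_exponent_def)

lemma total_degree_eq_0 [simp]: "total_degree a = 0 \<longleftrightarrow> a = 0"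
  by (auto simp: total_degree_def fun_eq_iff)

text \<open>Collecting the terms of a series without constant term according to some variable that
  occurs in them.\<close>

lemma split_off_variables:
  assumes "mfps_coeff p 0 = 0"
  obtains q where "p = (\<Sum>i\<in>UNIV. mfps_X i * q i)"
    and "\<And>i a. mfps_coeff (q i) a \<noteq> 0 \<Longrightarrow> mfps_coeff p (a + unit_exponent i) \<noteq> 0"
proof -
  define ch where "ch a = (SOME i. 0 < a i)" for a :: "'a \<Rightarrow> nat"
  have ch: "0 < a (ch a)" if "a \<noteq> 0" for a
  proof -
    have "\<exists>i. 0 < a i" using that by (auto simp: fun_eq_iff)
    then show ?thesis unfolding ch_def by (rule someI_ex)
  qed
  define q where "q i = Abs_mfps (\<lambda>a. if ch (a + unit_exponent i) = i then mfps_coeff p (a + unit_exponent i) else 0)" for i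
  have "p = (\<Sum>i\<in>UNIV. mfps_X i * q i)"
  proof (rule mfps_eqI)
    fix a
    have "mfps_coeff (mfps_X i * q i) a = (if 0 < a i \<and> ch a = i then mfps_coeff p a else 0)" for i
      by (auto simp: mfps_coeff_X_mult q_def diff_add_exponent unit_exponent_le)
    moreover have "(if 0 < a i \<and> ch a = i then mfps_coeff p a else 0) = (if i = ch a then mfps_coeff p a else 0)" for i
      using assms ch[of a] by (cases "a = 0") auto
    ultimately show "mfps_coeff p a = mfps_coeff (\<Sum>i\<in>UNIV. mfps_X i * q i) a" by simp
  qed
  moreover have "mfps_coeff p (a + unit_exponent i) \<noteq> 0" if "mfps_coeff (q i) a \<noteq> 0" for i a
    using that by (auto simp: q_def split: if_splits)
  ultimately show thesis using that by blast
qed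

lemma max_ideal_eq: "max_ideal = {p. mfps_coeff p 0 = 0}"
proof (rule set_eqI)
  fix p :: "'a mfps"
  have "mfps_coeff p 0 = 0" if "p \<in> mfps_ideal.span (range mfps_X)"
    using that
  proof (induction rule: mfps_ideal.span_induct_alt)
    case (step c x y)
    have "mfps_coeff (mfps_X i) 0 = 0" for i :: 'a by (auto simp: mfps_X.rep_eq fun_eq_iff)
    then have "mfps_coeff x 0 = 0" using step(1) by blast
    then show ?case using step(2) by (simp only: mfps_coeff_simps mfps_coeff_mult_0) simp
  qed simp
  moreover have "p \<in> mfps_ideal.span (range mfps_X)" if p: "mfps_coeff p 0 = 0"
  proof -
    obtain q where q: "p = (\<Sum>i\<in>UNIV. mfps_X i * q i)" using split_off_variables[OF p] by metis
    show ?thesis unfolding q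
      by (subst mult.commute, intro mfps_ideal.span_sum mfps_ideal.span_scale mfps_ideal.span_base) auto
  qed
  ultimately show "p \<in> max_ideal \<longleftrightarrow> p \<in> {p. mfps_coeff p 0 = 0}" by (auto simp: max_ideal_def)
qed

lemma mult_order:
  assumes "\<And>a. total_degree a < j \<Longrightarrow> mfps_coeff p a = 0" "\<And>a. total_degree a < k \<Longrightarrow> mfps_coeff q a = 0"
    and "total_degree a < j + k"
  shows "mfps_coeff (p * q) a = 0"
  unfolding mfps_coeff_mult
proof (rule sum.neutral, clarify)
  fix b c assume "a = b + c"
  then have "total_degree b < j \<or> total_degree c < k" using assms(3) by auto
  then show "mfps_coeff p b * mfps_coeff q c = 0" using assms by auto
qed

text \<open>Every term of positive degree is divisible by a variable, so a series of order at least
  \<open>k + 1\<close> is a combination of the variables with coefficients of order at least \<open>k\<close>.\<close>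

lemma max_ideal_pow_eq: "max_ideal_pow k = {p. \<forall>a. total_degree a < k \<longrightarrow> mfps_coeff p a = 0}"
proof (induction k)
  case (Suc k)
  let ?M = "{p. \<forall>a. total_degree a < Suc k \<longrightarrow> mfps_coeff p a = 0} :: 'a mfps set"
  let ?G = "{a * b |a b :: 'a mfps. a \<in> max_ideal \<and> b \<in> max_ideal_pow k}"
  have sub: "mfps_ideal.subspace ?M"
    using mult_order[of 0 _ "Suc k"] by (auto simp: mfps_ideal.subspace_def)
  have "?G \<subseteq> ?M"
    using mult_order[of 1 _ k] by (auto simp: Suc.IH max_ideal_eq)
  then have "mfps_ideal.span ?G \<subseteq> ?M" using sub by (rule mfps_ideal.span_minimal)
  moreover have "?M \<subseteq> mfps_ideal.span ?G"
  proof
    fix p assume p: "p \<in> ?M"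
    then have "mfps_coeff p 0 = 0" using total_degree_eq_0[of 0] by (metis (mono_tags, lifting) mem_Collect_eq zero_less_Suc)
    then obtain q where q: "p = (\<Sum>i\<in>UNIV. mfps_X i * q i)"
      "\<And>i a. mfps_coeff (q i) a \<noteq> 0 \<Longrightarrow> mfps_coeff p (a + unit_exponent i) \<noteq> 0"
      using split_off_variables by metis
    have "q i \<in> max_ideal_pow k" for i
      unfolding Suc.IH
    proof (rule CollectI, intro allI impI, rule ccontr)
      fix a assume a: "total_degree a < k" "mfps_coeff (q i) a \<noteq> 0"
      have "total_degree (a + unit_exponent i) < Suc k" using a(1) by simp
      then show False using q(2)[OF a(2)] p by blast
    qed
    moreover have "mfps_X i \<in> max_ideal" for i by (auto simp: max_ideal_def intro: mfps_ideal.span_base)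
    ultimately show "p \<in> mfps_ideal.span ?G"
      unfolding q(1) by (intro mfps_ideal.span_sum mfps_ideal.span_base) blast
  qed
  ultimately show ?case by auto
qed auto

lemma max_ideal_pow_1: "max_ideal_pow (Suc 0) = max_ideal"
  by (auto simp: max_ideal_pow_eq max_ideal_eq simp del: max_ideal_pow.simps)

lemma max_ideal_pow_mult: "p \<in> max_ideal_pow j \<Longrightarrow> q \<in> max_ideal_pow k \<Longrightarrow> p * q \<in> max_ideal_pow (j + k)"
  using mult_order[of j p k q] by (auto simp: max_ideal_pow_eq simp del: max_ideal_pow.simps)

lemma max_ideal_pow_mult_left: "q \<in> max_ideal_pow k \<Longrightarrow> p * q \<in> max_ideal_pow k"
  using max_ideal_pow_mult[of p 0 q k] by simp

lemma max_ideal_mult_pow: "p \<in> max_ideal \<Longrightarrow> q \<in> max_ideal_pow k \<Longrightarrow> p * q \<in> max_ideal_pow (Suc k)"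
  using max_ideal_pow_mult[of p "Suc 0" q k] by (simp only: max_ideal_pow_1 plus_nat.simps)

lemma mfps_X_in_max_ideal: "mfps_X i \<in> max_ideal"
  by (auto simp: max_ideal_def intro: mfps_ideal.span_base)

lemma one_not_in_max_ideal: "1 \<notin> max_ideal"
  by (simp add: max_ideal_eq)

lemma minus_const_in_max_ideal: "p - mfps_const (mfps_coeff p 0) \<in> max_ideal"
  by (simp add: max_ideal_eq)

lemma max_ideal_pow_subspace: "mfps_ideal.subspace (max_ideal_pow k)"
  using max_ideal_pow_mult_left unfolding max_ideal_pow_eq mfps_ideal.subspace_def by auto

lemma max_ideal_pow_separated:
  assumes "\<And>k. p \<in> max_ideal_pow k"
  shows "p = 0"
proof (rule mfps_eqI)
  fix a
  show "mfps_coeff p a = mfps_coeff 0 a"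
    using assms[of "Suc (total_degree a)"] by (auto simp: max_ideal_pow_eq simp del: max_ideal_pow.simps)
qed

text \<open>Every coefficient is eventually constant along the sequence.\<close>

lemma series_complete:
  fixes u :: "nat \<Rightarrow> 'n::finite mfps"
  assumes u: "\<And>k. u (Suc k) - u k \<in> max_ideal_pow k"
  shows "\<exists>p. \<forall>k. p - u k \<in> max_ideal_pow k"
proof -
  have stable: "mfps_coeff (u (j + d)) a = mfps_coeff (u j) a" if "total_degree a < j" for a j d
  proof (induction d)
    case (Suc d)
    have "mfps_coeff (u (Suc (j + d)) - u (j + d)) a = 0"
      using u[of "j + d"] that by (auto simp: max_ideal_pow_eq simp del: max_ideal_pow.simps mfps_coeff_simps)
    then show ?case using Suc by simp
  qed simp
  define p where "p = Abs_mfps (\<lambda>a. mfps_coeff (u (Suc (total_degree a))) a)"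
  have "p - u k \<in> max_ideal_pow k" for k
  proof -
    have "mfps_coeff (p - u k) a = 0" if "total_degree a < k" for a
      using stable[of a "Suc (total_degree a)" "k - Suc (total_degree a)"] that by (simp add: p_def)
    then show ?thesis by (auto simp: max_ideal_pow_eq simp del: max_ideal_pow.simps)
  qed
  then show ?thesis by blast
qed

text \<open>The geometric series, after normalising the constant term to 1.\<close>

lemma mfps_unit:
  fixes p :: "'n::finite mfps"
  assumes "p \<notin> max_ideal"
  shows "p dvd 1"
proof -
  let ?c = "mfps_coeff p 0"
  have c: "?c \<noteq> 0" using assms by (simp add: max_ideal_eq)
  define m where "m = 1 - mfps_const (inverse ?c) * p"
  have m: "m \<in> max_ideal" using c by (simp add: max_ideal_eq m_def)
  have mk: "m ^ k \<in> max_ideal_pow k" for k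
    by (induction k) (auto simp del: max_ideal_pow.simps(2) intro: max_ideal_mult_pow m)
  let ?u = "\<lambda>k. \<Sum>i<k. m ^ i"
  have "\<exists>v. \<forall>k. v - ?u k \<in> max_ideal_pow k"
    by (rule series_complete) (use mk in simp)
  then obtain v where v: "\<And>k. v - ?u k \<in> max_ideal_pow k" by blast
  have "(1 - m) * v - 1 \<in> max_ideal_pow k" for k
  proof -
    have "(1 - m) * (v - ?u k) - m ^ k \<in> max_ideal_pow k"
      using mk v max_ideal_pow_mult_left mfps_ideal.subspace_diff[OF max_ideal_pow_subspace] by blast
    moreover have "(1 - m) * ?u k = 1 - m ^ k" using one_diff_power_eq by metis
    ultimately show ?thesis by (simp add: algebra_simps)
  qed
  then have "(1 - m) * v - 1 = 0" by (rule max_ideal_pow_separated)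
  then have "(1 - m) * v = 1" by simp
  then have "p * (mfps_const (inverse ?c) * v) = 1"
    by (simp only: m_def diff_diff_eq2 add_diff_cancel_left' mult.assoc mult.left_commute)
  then show ?thesis by (metis dvd_triv_left)
qed


text \<open>Multiplication by a scalar as a constant of its own, so that rewriting with the ring laws
  leaves the locale parameter alone.\<close>

definition mfps_scale :: "complex \<Rightarrow> 'n::finite mfps \<Rightarrow> 'n mfps" where
  "mfps_scale c p = mfps_const c * p"

global_interpretation series: complex_space mfps_scale
  by unfold_locales (simp_all only: mfps_scale_def mfps_const_simps distrib_left distrib_right mult.assoc mult_1_left)

lemma series_endo_mult: "series.endo ((*) q)"
  by (auto simp: series.endo_def mfps_scale_def algebra_simps)

lemma finite_codim_max_ideal_pow:
  "\<exists>A::'n::finite mfps set. finite A \<and> UNIV \<subseteq> series.span (A \<union> max_ideal_pow k)"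
proof (induction k)
  case 0
  then show ?case using series.span_superset[of UNIV] by (intro exI[of _ "{}"]) auto
next
  case (Suc k)
  then obtain A :: "'n mfps set" where A: "finite A" "\<And>p. p \<in> series.span (A \<union> max_ideal_pow k)" by blast
  let ?B = "insert 1 (\<Union>i. (*) (mfps_X i) ` A)"
  let ?S = "series.span (?B \<union> max_ideal_pow (Suc k))"
  have X: "mfps_X i * q \<in> ?S" for i q
  proof (rule series.endo_span[OF series_endo_mult _ _ A(2)])
    show "series.subspace ?S" by (rule series.subspace_span)
    show "mfps_X i * a \<in> ?S" if "a \<in> A \<union> max_ideal_pow k" for a
      using that max_ideal_mult_pow[OF mfps_X_in_max_ideal] by (intro series.span_base) blast
  qed
  have "p \<in> ?S" for p
  proof -
    have "mfps_coeff (p - mfps_const (mfps_coeff p 0)) 0 = 0" by simp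
    then obtain q where q: "p - mfps_const (mfps_coeff p 0) = (\<Sum>i\<in>UNIV. mfps_X i * q i)"
      by (rule split_off_variables)
    have "1 \<in> ?S" by (rule series.span_base) simp
    then have "(\<Sum>i\<in>UNIV. mfps_X i * q i) + mfps_scale (mfps_coeff p 0) 1 \<in> ?S"
      using X by (intro series.span_add[OF series.span_sum series.span_scale])
    then show ?thesis unfolding q[symmetric] by (simp add: mfps_scale_def)
  qed
  moreover have "finite ?B" using A by auto
  ultimately show ?case by blast
qed

global_interpretation series: filtered_space "mfps_scale :: complex \<Rightarrow> 'n::finite mfps \<Rightarrow> 'n mfps" max_ideal_pow
proof
  fix k :: nat and p :: "'n mfps" and u :: "nat \<Rightarrow> 'n mfps"
  show "series.subspace (max_ideal_pow k :: 'n mfps set)"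
    using max_ideal_pow_subspace by (auto simp: series.subspace_def mfps_scale_def mfps_ideal.subspace_def)
  show "(max_ideal_pow (Suc k) :: 'n mfps set) \<subseteq> max_ideal_pow k"
    by (auto simp: max_ideal_pow_eq simp del: max_ideal_pow.simps)
  show "(\<And>k. p \<in> max_ideal_pow k) \<Longrightarrow> p = 0" by (rule max_ideal_pow_separated)
  show "(\<And>k. u (Suc k) - u k \<in> max_ideal_pow k) \<Longrightarrow> \<exists>p\<in>max_ideal_pow 0. \<forall>k. p - u k \<in> max_ideal_pow k"
    using series_complete[of u] by simp
  show "\<exists>A\<subseteq>max_ideal_pow 0. finite A \<and> max_ideal_pow 0 \<subseteq> series.span (A \<union> max_ideal_pow k :: 'n mfps set)"
    using finite_codim_max_ideal_pow[where 'n = 'n] by simp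
qed

section \<open>Multiplicative orders on exponents\<close>

text \<open>Assigning distinct primes to the variables turns exponent vectors into positive integers, by
  unique factorisation. This yields a total order on monomials that is compatible with
  multiplication, and in which every monomial has only finitely many predecessors.\<close>

lemma exponent_key:
  obtains key :: "('n::finite \<Rightarrow> nat) \<Rightarrow> nat"
  where "inj key" "\<And>a b. key (a + b) = key a * key b" "\<And>a. 2 ^ total_degree a \<le> key a"
proof -
  obtain B :: "nat set" where B: "finite B" "card B = CARD('n)" "B \<subseteq> {p. prime p}"
    using infinite_arbitrarily_large[OF primes_infinite] by metis
  then obtain pr :: "'n \<Rightarrow> nat" where pr: "bij_betw pr UNIV B"
    using finite_same_card_bij[of "UNIV :: 'n set" B] by auto
  have prime: "prime (pr i)" and inj: "inj pr" and range: "range pr = B" for i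
    using pr B by (auto simp: bij_betw_def)
  define key where "key a = (\<Prod>i\<in>UNIV. pr i ^ a i)" for a
  have "multiplicity (pr i) (key a) = a i" for a i
  proof -
    have "key a = (\<Prod>p\<in>B. p ^ a (inv pr p))"
      unfolding range[symmetric] key_def by (simp add: prod.reindex inj)
    also have "multiplicity (pr i) \<dots> = (if pr i \<in> B then a (inv pr (pr i)) else 0)"
      using B prime by (intro multiplicity_prod_prime_powers) auto
    finally show ?thesis using range inj by auto
  qed
  then have "inj key" by (metis injI ext)
  moreover have "key (a + b) = key a * key b" for a b
    by (simp add: key_def power_add prod.distrib)
  moreover have "2 ^ total_degree a \<le> key a" for a
  proof -
    have "2 ^ total_degree a = (\<Prod>i\<in>UNIV. 2 ^ a i :: nat)" by (simp add: total_degree_def power_sum)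
    also have "\<dots> \<le> key a" unfolding key_def by (intro prod_mono conjI power_mono prime_ge_2_nat prime) auto
    finally show ?thesis .
  qed
  ultimately show thesis using that by blast
qed

text \<open>Among the terms of lowest degree take those with the least key, \<open>a\<close> in \<open>p\<close> and \<open>b\<close> in \<open>q\<close>. Then
  \<open>(a, b)\<close> is the only pair that contributes to the coefficient of the product at \<open>a + b\<close>.\<close>

lemma mult_not_in_max_ideal_pow:
  assumes p: "p \<in> max_ideal_pow j" "p \<notin> max_ideal_pow (Suc j)"
    and q: "q \<in> max_ideal_pow k" "q \<notin> max_ideal_pow (Suc k)"
  shows "p * q \<notin> max_ideal_pow (Suc (j + k))"
proof -
  obtain key :: "('a \<Rightarrow> nat) \<Rightarrow> nat" where key: "inj key" "\<And>a b. key (a + b) = key a * key b"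
    "\<And>a. 2 ^ total_degree a \<le> key a" using exponent_key by blast
  have key0: "0 < key a" for a using key(3)[of a] by (metis less_le_trans zero_less_numeral zero_less_power)
  have least: "\<exists>a. total_degree a = l \<and> mfps_coeff r a \<noteq> 0 \<and>
      (\<forall>b. total_degree b = l \<longrightarrow> mfps_coeff r b \<noteq> 0 \<longrightarrow> key a \<le> key b)"
    if o: "r \<in> max_ideal_pow l" "r \<notin> max_ideal_pow (Suc l)" for r l
  proof -
    let ?P = "\<lambda>a. total_degree a = l \<and> mfps_coeff r a \<noteq> 0"
    obtain a where "total_degree a < Suc l" "mfps_coeff r a \<noteq> 0" "\<not> total_degree a < l"
      using o by (auto simp: max_ideal_pow_eq simp del: max_ideal_pow.simps)
    then have "?P a" by auto
    then have "?P (arg_min key ?P)" by (rule arg_min_natI[of ?P])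
    moreover have "\<And>b. ?P b \<Longrightarrow> key (arg_min key ?P) \<le> key b" by (rule arg_min_nat_le[of ?P])
    ultimately show ?thesis by blast
  qed
  obtain a where a: "total_degree a = j" "mfps_coeff p a \<noteq> 0"
    "\<And>b. total_degree b = j \<Longrightarrow> mfps_coeff p b \<noteq> 0 \<Longrightarrow> key a \<le> key b" using least[OF p] by blast
  obtain b where b: "total_degree b = k" "mfps_coeff q b \<noteq> 0"
    "\<And>c. total_degree c = k \<Longrightarrow> mfps_coeff q c \<noteq> 0 \<Longrightarrow> key b \<le> key c" using least[OF q] by blast
  have "mfps_coeff (p * q) (a + b) = (\<Sum>(x, y)\<in>{(a, b)}. mfps_coeff p x * mfps_coeff q y)"
    unfolding mfps_coeff_mult
  proof (rule sum.mono_neutral_right[OF finite_exponent_pairs])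
    have "mfps_coeff p x * mfps_coeff q y = 0" if xy: "x + y = a + b" "(x, y) \<noteq> (a, b)" for x y
    proof (rule ccontr)
      assume nz: "mfps_coeff p x * mfps_coeff q y \<noteq> 0"
      have "\<not> total_degree x < j" "\<not> total_degree y < k"
        using nz p(1) q(1) by (auto simp: max_ideal_pow_eq simp del: max_ideal_pow.simps)
      moreover have "total_degree x + total_degree y = j + k" using a b xy total_degree_add by metis
      ultimately have d: "total_degree x = j" "total_degree y = k" by auto
      have le: "key a \<le> key x" "key b \<le> key y" using a(3) b(3) d nz by auto
      have eq: "key x * key y = key a * key b" using key(2) xy(1) by metis
      have "key x \<le> key a"
        using mult_less_le_imp_less[of "key a" "key x" "key b" "key y"] le(2) eq key0[of b] by linarith
      moreover have "key y \<le> key b"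
        using mult_le_less_imp_less[of "key a" "key x" "key b" "key y"] le(1) eq key0[of a] by linarith
      ultimately have "x = a" "y = b" using key(1) le by (auto dest: injD)
      then show False using xy(2) by simp
    qed
    then show "\<forall>i\<in>{(x, y). x + y = a + b} - {(a, b)}. (case i of (x, y) \<Rightarrow> mfps_coeff p x * mfps_coeff q y) = 0"
      by (simp only: Ball_def split_paired_All) (simp del: mult_eq_0_iff)
  qed auto
  also have "\<dots> \<noteq> 0" using a b by simp
  finally have "mfps_coeff (p * q) (a + b) \<noteq> 0" .
  moreover have "total_degree (a + b) < Suc (j + k)" using a b by simp
  ultimately show ?thesis unfolding max_ideal_pow_eq by blast
qed

lemma exact_order:
  assumes "p \<noteq> 0"
  obtains k where "p \<in> max_ideal_pow k" "p \<notin> max_ideal_pow (Suc k)"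
proof -
  obtain j where j: "p \<notin> max_ideal_pow j" using assms max_ideal_pow_separated by blast
  define k where "k = (LEAST j. p \<notin> max_ideal_pow j)"
  have k: "p \<notin> max_ideal_pow k" unfolding k_def using j by (rule LeastI)
  then have "k \<noteq> 0" by (metis UNIV_I max_ideal_pow.simps(1))
  then obtain l where l: "k = Suc l" using not0_implies_Suc by blast
  then have "p \<in> max_ideal_pow l" using not_less_Least[of l "\<lambda>j. p \<notin> max_ideal_pow j"] unfolding k_def by auto
  then show thesis using that k l by blast
qed

text \<open>The principal ideal generated by a nonzero series is closed, since division by that series
  lowers orders by a fixed amount.\<close>

lemma cancel_order:
  assumes "f \<in> max_ideal_pow d" "f \<notin> max_ideal_pow (Suc d)" "v * f \<in> max_ideal_pow (k + d)"
  shows "v \<in> max_ideal_pow k"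
proof (cases "v = 0")
  case False
  then obtain e where e: "v \<in> max_ideal_pow e" "v \<notin> max_ideal_pow (Suc e)" using exact_order by blast
  have "v * f \<notin> max_ideal_pow (Suc (e + d))" using mult_not_in_max_ideal_pow[OF e assms(1,2)] .
  then have "k \<le> e" using assms(3) series.F_mono[of "Suc (e + d)" "k + d"] by (intro leI notI) auto
  then show ?thesis using e(1) series.F_mono by blast
qed (simp add: series.F_0)

lemma closed_principal_ideal:
  assumes "f \<noteq> 0"
  shows "series.closed_subspace {p. f dvd p}"
  unfolding series.closed_subspace_def
proof (intro conjI ballI impI)
  show "series.subspace {p. f dvd p}" by (auto simp: series.subspace_def mfps_scale_def)
  show "{p. f dvd p} \<subseteq> max_ideal_pow 0" by simp
  fix p assume p: "\<forall>k. \<exists>v\<in>{p. f dvd p}. p - v \<in> max_ideal_pow k"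
  obtain d where d: "f \<in> max_ideal_pow d" "f \<notin> max_ideal_pow (Suc d)" using exact_order[OF assms] .
  have "\<forall>k. \<exists>u. p - u * f \<in> max_ideal_pow (k + d)" using p by (metis dvdE mem_Collect_eq mult.commute)
  then obtain u where u: "\<And>k. p - u k * f \<in> max_ideal_pow (k + d)" by metis
  have "u (Suc k) - u k \<in> max_ideal_pow k" for k
  proof (rule cancel_order[OF d])
    have "p - u (Suc k) * f \<in> max_ideal_pow (k + d)" using u[of "Suc k"] series.F_Suc by auto
    from series.F_diff[OF u[of k] this] show "(u (Suc k) - u k) * f \<in> max_ideal_pow (k + d)"
      by (simp add: algebra_simps)
  qed
  then obtain v where v: "\<And>k. v - u k \<in> max_ideal_pow k" using series_complete by blast
  have "p - v * f \<in> max_ideal_pow k" for k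
  proof -
    have "p - u k * f \<in> max_ideal_pow k" using u[of k] series.F_mono[of k "k + d"] by auto
    moreover have "(v - u k) * f \<in> max_ideal_pow k"
      using v max_ideal_pow_mult_left by (metis mult.commute)
    ultimately have "(p - u k * f) - (v - u k) * f \<in> max_ideal_pow k" by (rule series.F_diff)
    then show ?thesis by (simp add: algebra_simps)
  qed
  then have "p = v * f" using series.F_eqI by blast
  then show "p \<in> {p. f dvd p}" by simp
qed

(* From here on the powers are accessed by the orders of their elements. *)
declare max_ideal_pow.simps(2) [simp del]

section \<open>Derivations\<close>


lemma Der_add: "d \<in> Der \<Longrightarrow> d (p + q) = d p + d q"
  and Der_const_mult: "d \<in> Der \<Longrightarrow> d (mfps_const c * p) = mfps_const c * d p"
  and Der_mult: "d \<in> Der \<Longrightarrow> d (p * q) = p * d q + q * d p"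
  unfolding Der_def by blast+

lemma DerI:
  assumes "\<And>p q. d (p + q) = d p + d q" "\<And>c p. d (mfps_const c * p) = mfps_const c * d p"
    "\<And>p q. d (p * q) = p * d q + q * d p"
  shows "d \<in> Der"
  unfolding Der_def using assms by blast

lemma Der_endo: "d \<in> Der \<Longrightarrow> series.endo d"
  unfolding series.endo_def mfps_scale_def Der_def by blast

lemma Der_0: "d \<in> Der \<Longrightarrow> d 0 = 0"
  and Der_diff: "d \<in> Der \<Longrightarrow> d (p - q) = d p - d q"
  and Der_sum: "d \<in> Der \<Longrightarrow> d (sum g A) = (\<Sum>a\<in>A. d (g a))"
  by (auto dest!: Der_endo intro: series.endo_zero series.endo_diff series.endo_sum)

lemma Der_1: "d \<in> Der \<Longrightarrow> d 1 = 0"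
  using Der_mult[of d 1 1] by simp

lemma Der_const: "d \<in> Der \<Longrightarrow> d (mfps_const c) = 0"
  using Der_const_mult[of d c 1] by (simp add: Der_1)

lemma Der_module_subspace: "der_module.subspace Der"
  unfolding der_module.subspace_def
  by (auto intro!: DerI simp: Der_add Der_const Der_mult der_scale_def algebra_simps)

lemma Der_closed:
  "0 \<in> Der" "d \<in> Der \<Longrightarrow> e \<in> Der \<Longrightarrow> d + e \<in> Der" "d \<in> Der \<Longrightarrow> e \<in> Der \<Longrightarrow> d - e \<in> Der"
  "d \<in> Der \<Longrightarrow> der_scale a d \<in> Der" "(\<And>x. x \<in> A \<Longrightarrow> g x \<in> Der) \<Longrightarrow> sum g A \<in> Der"
  by (auto intro: der_module.subspace_0 der_module.subspace_add der_module.subspace_diff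
      der_module.subspace_scale der_module.subspace_sum Der_module_subspace)

lemma lie_bracket_apply: "lie_bracket d e p = d (e p) - e (d p)"
  by (simp add: lie_bracket_def)

lemma lie_bracket_Der: "d \<in> Der \<Longrightarrow> e \<in> Der \<Longrightarrow> lie_bracket d e \<in> Der"
  by (rule DerI) (simp_all add: lie_bracket_apply Der_add Der_const Der_mult Der_0 algebra_simps)

lemma sum_fun_apply: "(sum g A :: 'a \<Rightarrow> 'b::comm_monoid_add) p = (\<Sum>a\<in>A. g a p)"
  by (induction A rule: infinite_finite_induct) auto

text \<open>By the Leibniz rule on products \<open>a b\<close> with \<open>a\<close> in the maximal ideal and \<open>b\<close> in its \<open>k\<close>-th power.\<close>

lemma Der_preserves_max_ideal_pow:
  assumes "d \<in> Der" "\<And>p. d p \<in> max_ideal" "p \<in> max_ideal_pow k"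
  shows "d p \<in> max_ideal_pow k"
proof (cases k)
  case (Suc j)
  have "d p \<in> max_ideal_pow (Suc j)" if "p \<in> max_ideal_pow (Suc j)" for p j
    using that
  proof (induction j arbitrary: p)
    case 0
    then show ?case using assms(2) max_ideal_pow_1 by auto
  next
    case (Suc j)
    have "p \<in> mfps_ideal.span {a * b |a b. a \<in> max_ideal \<and> b \<in> max_ideal_pow (Suc j)}"
      using Suc.prems max_ideal_pow.simps(2) by blast
    then show ?case
    proof (induction rule: mfps_ideal.span_induct_alt)
      case base
      then show ?case using Der_0[OF assms(1)] series.F_0 by simp
    next
      case (step c x y)
      then obtain a b where ab: "x = a * b" "a \<in> max_ideal" "b \<in> max_ideal_pow (Suc j)" by blast
      have 1: "b * d (c * a) \<in> max_ideal_pow (Suc (Suc j))"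
        using max_ideal_mult_pow[OF assms(2) ab(3)] by (metis mult.commute)
      have "c * a \<in> max_ideal" using ab by (auto simp: max_ideal_eq)
      then have 2: "(c * a) * d b \<in> max_ideal_pow (Suc (Suc j))" using Suc.IH[OF ab(3)] max_ideal_mult_pow by blast
      have "d (c * x + y) = ((c * a) * d b + b * d (c * a)) + d y"
        using Der_mult[OF assms(1), of "c * a" b] by (simp add: Der_add[OF assms(1)] ab mult.assoc)
      then show ?case using 1 2 step(2) by (metis series.F_add)
    qed
  qed
  then show ?thesis using assms(3) Suc by blast
qed simp

text \<open>A derivation that kills a coordinate system maps everything into every power of the maximal
  ideal.\<close>

lemma Der_eq_0I:
  assumes d: "d \<in> Der" and y: "formal_coordinates y" and 0: "\<And>i. d (y i) = 0"
  shows "d = 0"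
proof
  fix p
  have "\<forall>p. d p \<in> max_ideal_pow k" for k
  proof (induction k)
    case (Suc k)
    have m: "d p \<in> max_ideal_pow (Suc k)" if "p \<in> max_ideal" for p
    proof -
      have "p \<in> mfps_ideal.span (range y)" using that y by (simp add: formal_coordinates_def)
      then show ?thesis
      proof (induction rule: mfps_ideal.span_induct_alt)
        case base
        then show ?case using Der_0[OF d] series.F_0 by simp
      next
        case (step c x q)
        then have "d x = 0" "x \<in> max_ideal"
          using 0 y mfps_ideal.span_base[of x "range y"] by (auto simp: formal_coordinates_def)
        then have "d (c * x + q) = x * d c + d q" "x * d c \<in> max_ideal_pow (Suc k)"
          using d max_ideal_mult_pow Suc by (auto simp: Der_add Der_mult)
        then show ?case using step by (metis series.F_add)
      qed
    qed
    show ?case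
    proof
      fix p
      have "d p = d (p - mfps_const (mfps_coeff p 0))" using d by (simp add: Der_diff Der_const)
      then show "d p \<in> max_ideal_pow (Suc k)" using m minus_const_in_max_ideal by metis
    qed
  qed simp
  then have "d p \<in> max_ideal_pow k" for k by blast
  from max_ideal_pow_separated[OF this] show "d p = 0 p" by simp
qed

lemma Der_eqI:
  assumes "d \<in> Der" "e \<in> Der" "formal_coordinates y" "\<And>i. d (y i) = e (y i)"
  shows "d = e"
  using Der_eq_0I[of "d - e" y] assms by (simp add: Der_closed)

lemma formal_coordinates_X: "formal_coordinates mfps_X"
  by (simp add: formal_coordinates_def max_ideal_def)

definition partial :: "'n::finite \<Rightarrow> 'n mfps \<Rightarrow> 'n mfps" where
  "partial i p = Abs_mfps (\<lambda>a. of_nat (Suc (a i)) * mfps_coeff p (a + unit_exponent i))"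

lemma mfps_coeff_X_mult_partial: "mfps_coeff (mfps_X i * partial i p) a = of_nat (a i) * mfps_coeff p a"
proof (cases "0 < a i")
  case True
  then have "Suc ((a - unit_exponent i) i) = a i" by (simp add: unit_exponent_def)
  then show ?thesis using True
    by (simp add: mfps_coeff_X_mult partial_def diff_add_exponent unit_exponent_le del: of_nat_Suc)
qed (simp add: mfps_coeff_X_mult)

text \<open>The Leibniz rule is read off from the Euler operator \<open>x\<^sub>i \<partial>\<^sub>i\<close>, which multiplies the coefficient at
  \<open>a\<close> by \<open>a i\<close>; the factor \<open>x\<^sub>i\<close> is cancelled afterwards.\<close>

lemma X_mult_partial_mult:
  "mfps_X i * partial i (p * q) = p * (mfps_X i * partial i q) + q * (mfps_X i * partial i p)"
proof (rule mfps_eqI)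
  fix a
  have "mfps_coeff (q * (mfps_X i * partial i p)) a = mfps_coeff ((mfps_X i * partial i p) * q) a"
    by (simp add: mult.commute)
  also have "\<dots> = (\<Sum>(b, c) | b + c = a. of_nat (b i) * mfps_coeff p b * mfps_coeff q c)"
    by (simp add: mfps_coeff_mult[of "mfps_X i * _"] mfps_coeff_X_mult_partial)
  finally have "mfps_coeff (p * (mfps_X i * partial i q) + q * (mfps_X i * partial i p)) a =
      (\<Sum>(b, c) | b + c = a. mfps_coeff p b * (of_nat (c i) * mfps_coeff q c)) +
      (\<Sum>(b, c) | b + c = a. of_nat (b i) * mfps_coeff p b * mfps_coeff q c)"
    by (simp add: mfps_coeff_mult[of p "mfps_X i * _"] mfps_coeff_X_mult_partial)
  also have "\<dots> = (\<Sum>(b, c) | b + c = a. of_nat (a i) * (mfps_coeff p b * mfps_coeff q c))"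
    unfolding sum.distrib[symmetric] by (rule sum.cong) (auto simp: algebra_simps)
  also have "\<dots> = mfps_coeff (mfps_X i * partial i (p * q)) a"
    by (simp add: mfps_coeff_X_mult_partial mfps_coeff_mult[of p q] sum_distrib_left case_prod_unfold)
  finally show "mfps_coeff (mfps_X i * partial i (p * q)) a =
    mfps_coeff (p * (mfps_X i * partial i q) + q * (mfps_X i * partial i p)) a" by simp
qed

lemma partial_Der: "partial i \<in> Der"
proof (rule DerI)
  fix p q :: "'a mfps" and c
  show "partial i (p + q) = partial i p + partial i q"
    by (rule mfps_eqI) (simp add: partial_def algebra_simps)
  show "partial i (mfps_const c * p) = mfps_const c * partial i p"
    by (rule mfps_eqI) (simp add: partial_def)
  show "partial i (p * q) = p * partial i q + q * partial i p"
    by (rule mfps_X_mult_cancel[of i]) (simp add: X_mult_partial_mult algebra_simps)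
qed

lemma partial_X: "partial i (mfps_X j) = (if i = j then 1 else 0)"
proof (rule mfps_eqI)
  fix a
  have "a + unit_exponent i = unit_exponent j \<longleftrightarrow> i = j \<and> a = 0"
    by (auto simp: unit_exponent_def fun_eq_iff split: if_splits)
  then show "mfps_coeff (partial i (mfps_X j)) a = mfps_coeff (if i = j then 1 else 0) a"
    by (auto simp: partial_def mfps_X.rep_eq unit_exponent_def[symmetric])
qed

lemma Der_eq_sum_partial:
  assumes "d \<in> Der"
  shows "d = (\<Sum>i\<in>UNIV. der_scale (d (mfps_X i)) (partial i))"
proof (rule Der_eqI[OF assms _ formal_coordinates_X])
  show "(\<Sum>i\<in>UNIV. der_scale (d (mfps_X i)) (partial i)) \<in> Der"
    by (intro Der_closed partial_Der)
  show "d (mfps_X j) = (\<Sum>i\<in>UNIV. der_scale (d (mfps_X i)) (partial i)) (mfps_X j)" for j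
    by (simp add: sum_fun_apply der_scale_def partial_X if_distrib cong: if_cong)
qed

lemma max_ideal_Der_eq: "max_ideal_Der = {d \<in> Der. \<forall>p. d p \<in> max_ideal}"
proof (intro equalityI subsetI)
  fix d assume "d \<in> max_ideal_Der"
  then have "d \<in> der_module.span {der_scale a \<delta> |a \<delta>. a \<in> max_ideal \<and> \<delta> \<in> Der}" by (simp add: max_ideal_Der_def)
  then show "d \<in> {d \<in> Der. \<forall>p. d p \<in> max_ideal}"
  proof (induction rule: der_module.span_induct_alt)
    case base
    show ?case by (intro CollectI conjI allI Der_closed(1)) (simp add: max_ideal_eq)
  next
    case (step c x y)
    then obtain a e where "x = der_scale a e" "a \<in> max_ideal" "e \<in> Der" by blast
    then have "x \<in> Der" "\<And>p. x p \<in> max_ideal" by (auto intro: Der_closed) (simp add: der_scale_def max_ideal_eq)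
    moreover from this have "der_scale c x + y \<in> Der" using step(2) by (intro Der_closed) auto
    moreover have "(der_scale c x + y) p \<in> max_ideal" for p
      using calculation(2)[of p] step(2) by (simp add: der_scale_def max_ideal_eq)
    ultimately show ?case by blast
  qed
next
  fix d assume "d \<in> {d \<in> Der. \<forall>p. d p \<in> max_ideal}"
  then have d: "d \<in> Der" "\<And>p. d p \<in> max_ideal" by auto
  show "d \<in> max_ideal_Der"
    unfolding max_ideal_Der_def
    by (subst Der_eq_sum_partial[OF d(1)], intro der_module.span_sum der_module.span_base)
      (use d partial_Der in blast)
qed

definition der_cscale :: "complex \<Rightarrow> ('n::finite mfps \<Rightarrow> 'n mfps) \<Rightarrow> 'n mfps \<Rightarrow> 'n mfps" where
  "der_cscale c = der_scale (mfps_const c)"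

global_interpretation derivs: complex_space der_cscale
  by unfold_locales (simp_all add: der_cscale_def der_scale_def fun_eq_iff mfps_const_simps algebra_simps)

definition Der_filtration :: "nat \<Rightarrow> ('n::finite mfps \<Rightarrow> 'n mfps) set" where
  "Der_filtration k = {d \<in> Der. \<forall>p. d p \<in> max_ideal_pow k}"

lemma Der_filtrationI:
  assumes "d \<in> Der" "\<And>i. d (mfps_X i) \<in> max_ideal_pow k"
  shows "d \<in> Der_filtration k"
proof -
  have "d p \<in> max_ideal_pow k" for p
    by (subst Der_eq_sum_partial[OF assms(1)])
      (auto simp: sum_fun_apply der_scale_def mult.commute[of "d _"] intro!: series.subspace_sum[OF series.subspace_F]
        max_ideal_pow_mult_left assms(2))
  then show ?thesis using assms by (simp add: Der_filtration_def)
qed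

lemma Der_filtration_0: "Der_filtration 0 = Der"
  by (simp add: Der_filtration_def)

lemma derivs_subspaceI: "der_module.subspace V \<Longrightarrow> derivs.subspace V"
  by (auto simp: derivs.subspace_def der_module.subspace_def der_cscale_def)

lemma Der_filtration_subspace: "der_module.subspace (Der_filtration k)"
  unfolding der_module.subspace_def Der_filtration_def
  by (auto simp: Der_closed series.F_0 series.F_add) (auto simp: der_scale_def max_ideal_pow_mult_left)

lemma finite_codim_Der_filtration:
  "\<exists>A\<subseteq>Der. finite A \<and> Der \<subseteq> derivs.span (A \<union> Der_filtration k :: ('n::finite mfps \<Rightarrow> 'n mfps) set)"
proof -
  obtain B :: "'n mfps set" where B: "finite B" "UNIV \<subseteq> series.span (B \<union> max_ideal_pow k)"
    using finite_codim_max_ideal_pow[where 'n = 'n and k = k] by (elim exE conjE)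
  let ?A = "(\<lambda>(b, i). der_scale b (partial i)) ` (B \<times> UNIV)"
  let ?S = "derivs.span (?A \<union> Der_filtration k)"
  have 1: "der_scale p (partial i) \<in> ?S" for p i
  proof -
    have "p \<in> series.span (B \<union> max_ideal_pow k)" using B(2) by (rule subsetD) simp
    then show ?thesis
    proof (induction rule: series.span_induct_alt)
      case base
      then show ?case using derivs.span_zero by (simp add: der_scale_def zero_fun_def)
    next
      case (step c x y)
      have "der_scale x (partial i) \<in> ?A \<union> Der_filtration k"
        using step(1) max_ideal_pow_mult_left[of x k]
        by (auto simp: Der_filtration_def Der_closed partial_Der) (simp add: der_scale_def mult.commute[of x])
      then have "der_cscale c (der_scale x (partial i)) + der_scale y (partial i) \<in> ?S"
        by (intro derivs.span_add[OF derivs.span_scale[OF derivs.span_base] step(2)])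
      moreover have "der_cscale c (der_scale x (partial i)) + der_scale y (partial i) = der_scale (mfps_scale c x + y) (partial i)"
        by (simp add: fun_eq_iff der_cscale_def der_scale_def mfps_scale_def algebra_simps)
      ultimately show ?case by simp
    qed
  qed
  have "Der \<subseteq> ?S"
  proof
    fix d :: "'n mfps \<Rightarrow> 'n mfps" assume "d \<in> Der"
    have "(\<Sum>i\<in>UNIV. der_scale (d (mfps_X i)) (partial i)) \<in> ?S" by (rule derivs.span_sum[OF 1])
    then show "d \<in> ?S" by (subst Der_eq_sum_partial[OF \<open>d \<in> Der\<close>])
  qed
  moreover have "?A \<subseteq> Der" by (auto intro: Der_closed partial_Der)
  moreover have "finite ?A" using B by simp
  ultimately show ?thesis by blast
qed

global_interpretation derivs: filtered_space "der_cscale :: complex \<Rightarrow> ('n::finite mfps \<Rightarrow> 'n mfps) \<Rightarrow> _" Der_filtration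
proof
  fix k :: nat and d :: "'n mfps \<Rightarrow> 'n mfps" and u :: "nat \<Rightarrow> 'n mfps \<Rightarrow> 'n mfps"
  show "derivs.subspace (Der_filtration k :: ('n mfps \<Rightarrow> 'n mfps) set)"
    by (rule derivs_subspaceI[OF Der_filtration_subspace])
  show "(Der_filtration (Suc k) :: ('n mfps \<Rightarrow> 'n mfps) set) \<subseteq> Der_filtration k"
    using series.F_Suc by (auto simp: Der_filtration_def)
  show "(\<And>k. d \<in> Der_filtration k) \<Longrightarrow> d = 0"
    using max_ideal_pow_separated by (fastforce simp: Der_filtration_def)
  show "\<exists>A\<subseteq>Der_filtration 0. finite A \<and> Der_filtration 0 \<subseteq> derivs.span (A \<union> Der_filtration k :: ('n mfps \<Rightarrow> 'n mfps) set)"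
    using finite_codim_Der_filtration by (simp add: Der_filtration_0)
  assume u: "\<And>k. u k \<in> Der_filtration 0" "\<And>k. u (Suc k) - u k \<in> Der_filtration k"
  have "\<forall>i. \<exists>p. \<forall>k. p - u k (mfps_X i) \<in> max_ideal_pow k"
    using u(2) by (intro allI series_complete) (simp add: Der_filtration_def)
  then obtain p where p: "\<And>i k. p i - u k (mfps_X i) \<in> max_ideal_pow k" by metis
  let ?d = "\<Sum>i\<in>UNIV. der_scale (p i) (partial i)"
  have d: "?d \<in> Der" by (intro Der_closed partial_Der)
  have "?d (mfps_X j) = p j" for j
    by (simp add: sum_fun_apply der_scale_def partial_X if_distrib cong: if_cong)
  then have "?d - u k \<in> Der_filtration k" for k
    using u(1) p by (intro Der_filtrationI Der_closed(3) d) (auto simp: Der_filtration_0)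
  then show "\<exists>p\<in>Der_filtration 0. \<forall>k. p - u k \<in> Der_filtration k" using d by (auto simp: Der_filtration_0)
qed

section \<open>Submodules of free modules: standard bases\<close>

lemma monotone_subsequence_nat:
  fixes s :: "nat \<Rightarrow> nat"
  obtains r :: "nat \<Rightarrow> nat" where "strict_mono r" "mono (s \<circ> r)"
proof -
  obtain g where g: "strict_mono g" "monoseq (\<lambda>n. s (g n))" using seq_monosub by blast
  show thesis
  proof (cases "mono (s \<circ> g)")
    case False
    then have dec: "\<And>m n. m \<le> n \<Longrightarrow> s (g n) \<le> s (g m)"
      using g(2) by (auto simp: monoseq_def mono_def)
    define K where "K = arg_min (\<lambda>n. s (g n)) (\<lambda>_. True)"
    have "s (g K) \<le> s (g n)" for n
      unfolding K_def using arg_min_nat_le[of "\<lambda>_. True" n "\<lambda>n. s (g n)"] by simp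
    then have "s (g (n + K)) = s (g K)" for n using dec[of K "n + K"] by (simp add: le_antisym)
    then have "mono (s \<circ> (\<lambda>n. g (n + K)))" by (simp add: mono_def)
    moreover have "strict_mono (\<lambda>n. g (n + K))" using g(1) by (simp add: strict_mono_def)
    ultimately show thesis by (rule that[rotated])
  qed (use that g in blast)
qed

text \<open>An infinite set of minimal elements would contain a sequence along which all components are
  nondecreasing, and its first two members would be comparable.\<close>

lemma dickson:
  fixes S :: "('n::finite \<Rightarrow> nat) set"
  obtains T where "T \<subseteq> S" "finite T" "\<And>a. a \<in> S \<Longrightarrow> \<exists>b\<in>T. b \<le> a"
proof -
  define T where "T = {a \<in> S. \<forall>b\<in>S. b \<le> a \<longrightarrow> b = a}"
  have below: "\<exists>b\<in>T. b \<le> a" if a: "a \<in> S" for a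
  proof -
    let ?P = "\<lambda>b. b \<in> S \<and> b \<le> a"
    let ?b = "arg_min total_degree ?P"
    have b: "?P ?b" using a by (intro arg_min_natI[of ?P a]) simp
    have "c = ?b" if c: "c \<in> S" "c \<le> ?b" for c
    proof (rule ccontr)
      assume "c \<noteq> ?b"
      then have "total_degree c < total_degree ?b"
        using c unfolding total_degree_def
        by (intro sum_strict_mono_ex1) (auto simp: le_fun_def fun_eq_iff less_le)
      moreover have "total_degree ?b \<le> total_degree c"
        using c b by (intro arg_min_nat_le[of ?P]) (auto intro: order_trans)
      ultimately show False by simp
    qed
    then show ?thesis using b by (auto simp: T_def)
  qed
  have "finite T"
  proof (rule ccontr)
    assume "infinite T"
    then obtain f :: "nat \<Rightarrow> 'n \<Rightarrow> nat" where f: "inj f" "range f \<subseteq> T"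
      using infinite_countable_subset by blast
    have "\<exists>r :: nat \<Rightarrow> nat. strict_mono r \<and> (\<forall>j\<in>J. mono (\<lambda>k. f (r k) j))" if "finite J" for J :: "'n set"
      using that
    proof (induction J rule: finite_induct)
      case empty
      then show ?case using strict_mono_id by (intro exI[of _ id]) (simp add: strict_mono_def)
    next
      case (insert j J)
      then obtain r :: "nat \<Rightarrow> nat" where r: "strict_mono r" "\<forall>j\<in>J. mono (\<lambda>k. f (r k) j)" by blast
      obtain g :: "nat \<Rightarrow> nat" where g: "strict_mono g" "mono ((\<lambda>k. f (r k) j) \<circ> g)" using monotone_subsequence_nat by blast
      have "strict_mono (r \<circ> g)" using r g by (simp add: strict_mono_o)
      moreover have "mono (\<lambda>k. f ((r \<circ> g) k) i)" if "i \<in> J" for i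
        using r(2) that g(1) by (auto simp: mono_def strict_mono_less_eq)
      ultimately show ?case using g by (intro exI[of _ "r \<circ> g"]) (auto simp: comp_def)
    qed
    then obtain r :: "nat \<Rightarrow> nat" where r: "strict_mono r" "\<And>j. mono (\<lambda>k. f (r k) j)" by (metis UNIV_I finite)
    have "f (r 0) \<le> f (r 1)" using r(2) by (auto simp: le_fun_def mono_def)
    moreover have "f (r 0) \<in> S" "f (r 1) \<in> T" using f by (auto simp: T_def)
    ultimately have "f (r 0) = f (r 1)" by (auto simp: T_def)
    then show False using f(1) r(1) by (metis injD strict_mono_eq zero_neq_one)
  qed
  moreover have "T \<subseteq> S" by (auto simp: T_def)
  ultimately show thesis using that below by blast
qed

text \<open>A total order on the monomials of a free module: the basis vectors get primes of their own, as if
  they were further variables.\<close>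

lemma module_exponent_key:
  obtains K :: "('n::finite \<Rightarrow> nat) \<times> 'n \<Rightarrow> nat" and key :: "('n \<Rightarrow> nat) \<Rightarrow> nat"
  where "inj K" "\<And>a b i. K (a + b, i) = key b * K (a, i)" "\<And>a i. 2 ^ total_degree a \<le> K (a, i)" "key 0 = 1"
proof -
  obtain kk :: "('n + 'n \<Rightarrow> nat) \<Rightarrow> nat" where kk: "inj kk" "\<And>a b. kk (a + b) = kk a * kk b"
    "\<And>a. 2 ^ total_degree a \<le> kk a" using exponent_key by blast
  define K where "K = (\<lambda>(a, i). kk (case_sum a (unit_exponent i)))"
  define key where "key b = kk (case_sum b 0)" for b
  have "inj K"
  proof (rule injI, clarify)
    fix a b :: "'n \<Rightarrow> nat" and i j assume "K (a, i) = K (b, j)"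
    then have eq: "case_sum a (unit_exponent i) = case_sum b (unit_exponent j)" using kk(1) by (auto simp: K_def dest: injD)
    have "a = b" by (rule ext) (use fun_cong[OF eq, of "Inl _"] in simp)
    moreover have "unit_exponent i i = unit_exponent j i" using fun_cong[OF eq, of "Inr i"] by simp
    then have "i = j" by (auto simp: unit_exponent_def split: if_splits)
    ultimately show "a = b \<and> i = j" ..
  qed
  moreover have "K (a + b, i) = key b * K (a, i)" for a b i
  proof -
    have "case_sum (a + b) (unit_exponent i) = case_sum b 0 + case_sum a (unit_exponent i)"
      by (auto simp: fun_eq_iff split: sum.splits)
    then show ?thesis by (simp add: K_def key_def kk(2))
  qed
  moreover have "2 ^ total_degree a \<le> K (a, i)" for a i
  proof -
    have "total_degree a \<le> total_degree (case_sum a (unit_exponent i))"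
      by (simp add: total_degree_def UNIV_Plus_UNIV[symmetric] sum.Plus del: UNIV_Plus_UNIV)
    then have "(2::nat) ^ total_degree a \<le> 2 ^ total_degree (case_sum a (unit_exponent i))" by (rule power_increasing) simp
    also have "\<dots> \<le> K (a, i)" unfolding K_def using kk(3) by simp
    finally show ?thesis .
  qed
  moreover have "key 0 = 1"
  proof -
    have "case_sum 0 0 = (0 :: 'n + 'n \<Rightarrow> nat)" by (auto simp: fun_eq_iff split: sum.splits)
    moreover have "kk 0 = kk 0 * kk 0" using kk(2)[of 0 0] by simp
    moreover have "kk 0 \<noteq> 0" using kk(3)[of 0] by (simp add: total_degree_def)
    ultimately show ?thesis by (simp add: key_def)
  qed
  ultimately show thesis using that by blast
qed

text \<open>Leading exponents are minimal ones for the key \<open>K\<close>. By Dickson's lemma finitely many elements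
  \<open>g x\<close> of \<open>M\<close> generate all leading exponents of \<open>M\<close>. Division by them removes the term with key
  \<open>N\<close> in step \<open>N\<close>. A coefficient of a quotient is set in one step only, as \<open>N\<close> is determined by
  the position of this coefficient; thus the infinite process converges trivially. An element of
  high order needs no early steps, and then the quotients have no constant terms. This is
  Noetherianity together with the Artin--Rees property.\<close>

theorem standard_basis:
  fixes M :: "('n::finite \<Rightarrow> 'n mfps) set"
  assumes M_diff: "\<And>u v. u \<in> M \<Longrightarrow> v \<in> M \<Longrightarrow> (\<lambda>i. u i - v i) \<in> M"
    and M_scale: "\<And>a v. v \<in> M \<Longrightarrow> (\<lambda>i. a * v i) \<in> M"
  shows "\<exists>(I :: (('n \<Rightarrow> nat) \<times> 'n) set) g k. finite I \<and> g ` I \<subseteq> M \<and>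
    (\<forall>v\<in>M. \<exists>a. (\<forall>i. v i = (\<Sum>x\<in>I. a x * g x i)) \<and>
       ((\<forall>i. v i \<in> max_ideal_pow k) \<longrightarrow> (\<forall>x\<in>I. a x \<in> max_ideal)))"
proof -
  obtain K :: "('n::finite \<Rightarrow> nat) \<times> 'n \<Rightarrow> nat" and key :: "('n \<Rightarrow> nat) \<Rightarrow> nat"
    where K: "inj K" "\<And>a b i. K (a + b, i) = key b * K (a, i)" "\<And>a i. 2 ^ total_degree a \<le> K (a, i)"
      and key0: "key 0 = 1"
    using module_exponent_key by blast
  \<comment> \<open>Terms of a vector are indexed by pairs of an exponent and a position; the vectors in \<open>R N\<close> are those
    without terms whose key is less than \<open>N\<close>.\<close>
  define vc :: "('n \<Rightarrow> 'n mfps) \<Rightarrow> ('n \<Rightarrow> nat) \<times> 'n \<Rightarrow> complex" where "vc v = (\<lambda>(a, i). mfps_coeff (v i) a)" for v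
  define R where "R N = {v. \<forall>x. K x < N \<longrightarrow> vc v x = 0}" for N
  define L where "L = {x. \<exists>v\<in>M. vc v x = 1 \<and> v \<in> R (K x)}"
  have "\<forall>i. \<exists>T. T \<subseteq> {a. (a, i) \<in> L} \<and> finite T \<and> (\<forall>a. (a, i) \<in> L \<longrightarrow> (\<exists>b\<in>T. b \<le> a))"
  proof
    fix i
    show "\<exists>T. T \<subseteq> {a. (a, i) \<in> L} \<and> finite T \<and> (\<forall>a. (a, i) \<in> L \<longrightarrow> (\<exists>b\<in>T. b \<le> a))"
      by (rule dickson[of "{a. (a, i) \<in> L}"]) blast
  qed
  then obtain T where T: "\<And>i. T i \<subseteq> {a. (a, i) \<in> L}" "\<And>i. finite (T i)"
    "\<And>i a. (a, i) \<in> L \<Longrightarrow> \<exists>b\<in>T i. b \<le> a" by metis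
  define I where "I = (\<Union>i. (\<lambda>a. (a, i)) ` T i)"
  have finI: "finite I" using T(2) by (simp add: I_def)
  have "\<forall>x\<in>I. \<exists>v. v \<in> M \<and> vc v x = 1 \<and> v \<in> R (K x)" using T(1) by (auto simp: I_def L_def)
  then obtain g where g: "\<And>x. x \<in> I \<Longrightarrow> g x \<in> M" "\<And>x. x \<in> I \<Longrightarrow> vc (g x) x = 1" "\<And>x. x \<in> I \<Longrightarrow> g x \<in> R (K x)"
    by metis
  \<comment> \<open>The step is idle unless a term with key \<open>N\<close> is present; the last conjunct records this.\<close>
  have step: "\<exists>x b c. (\<lambda>i. v i - mfps_const c * (monomial b * g x i)) \<in> R (Suc N) \<and>
      (c \<noteq> 0 \<longrightarrow> x \<in> I \<and> key b * K x = N \<and> v \<notin> R (Suc N))" if v: "v \<in> M" "v \<in> R N" for v N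
  proof (cases "v \<in> R (Suc N)")
    case True
    then show ?thesis by (intro exI[of _ undefined] exI[of _ 0]) (simp add: mfps_const_simps)
  next
    case False
    then obtain z where z: "K z < Suc N" "vc v z \<noteq> 0" by (auto simp: R_def)
    have "\<not> K z < N" using z(2) v(2) unfolding R_def by blast
    then have zN: "K z = N" using z(1) by simp
    obtain a i where ai: "z = (a, i)" by (cases z)
    define c where "c = vc v z"
    have "(a, i) \<in> L"
    proof -
      have "vc (\<lambda>i. mfps_const (inverse c) * v i) x = inverse c * vc v x" for x by (simp add: vc_def split: prod.splits)
      then have "vc (\<lambda>i. mfps_const (inverse c) * v i) z = 1" "(\<lambda>i. mfps_const (inverse c) * v i) \<in> R (K z)"
        using z v(2) zN by (auto simp: c_def R_def)
      then show ?thesis using M_scale[OF v(1)] ai by (auto simp: L_def)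
    qed
    then obtain a' where a': "a' \<in> T i" "a' \<le> a" using T(3) by blast
    define x where "x = (a', i)"
    define b where "b = a - a'"
    have ab: "a' + b = a" using diff_add_exponent[OF a'(2)] by (simp add: b_def add.commute)
    have x: "x \<in> I" using a' by (auto simp: x_def I_def)
    have Kx: "key b * K x = N" using K(2)[of a' b i] zN ai ab by (simp add: x_def)
    let ?w = "\<lambda>i. v i - mfps_const c * (monomial b * g x i)"
    have "vc ?w y = 0" if y: "K y < Suc N" for y
    proof -
      obtain d j where dj: "y = (d, j)" by (cases y)
      have vw: "vc ?w y = vc v y - c * (if b \<le> d then vc (g x) (d - b, j) else 0)"
        by (simp add: dj vc_def mfps_coeff_monomial_mult)
      show ?thesis
      proof (cases "K y = N")
        case True
        then have "y = z" using K(1) zN by (auto dest: injD)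
        then have "d = a" "j = i" using ai dj by auto
        moreover have "b \<le> a" "a - b = a'" using ab[symmetric] by (simp_all add: le_fun_def fun_eq_iff)
        ultimately show ?thesis using vw g(2)[OF x] \<open>y = z\<close> by (simp add: c_def x_def)
      next
        case False
        then have lt: "K y < N" using y by simp
        have "vc (g x) (d - b, j) = 0" if "b \<le> d"
        proof -
          have "K y = key b * K (d - b, j)" using K(2)[of "d - b" b j] diff_add_exponent[OF that] dj by simp
          then have "K (d - b, j) < K x" using lt Kx by (metis mult_less_cancel1)
          then show ?thesis using g(3)[OF x] by (auto simp: R_def)
        qed
        moreover have "vc v y = 0" using lt v(2) unfolding R_def by blast
        ultimately show ?thesis using vw by simp
      qed
    qed
    then have "?w \<in> R (Suc N)" by (simp add: R_def)
    then show ?thesis using x Kx False by blast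
  qed
  define W where "W v N t \<longleftrightarrow>
      (\<lambda>i. v i - mfps_const (snd (snd t)) * (monomial (fst (snd t)) * g (fst t) i)) \<in> R (Suc N) \<and>
      (snd (snd t) \<noteq> 0 \<longrightarrow> fst t \<in> I \<and> key (fst (snd t)) * K (fst t) = N \<and> v \<notin> R (Suc N))" for v N t
  define tf where "tf v N = (SOME t. W v N t)" for v N
  define xf bf cf where "xf v N = fst (tf v N)" and "bf v N = fst (snd (tf v N))" and "cf v N = snd (snd (tf v N))" for v N
  have f: "(\<lambda>i. v i - mfps_const (cf v N) * (monomial (bf v N) * g (xf v N) i)) \<in> R (Suc N) \<and>
      (cf v N \<noteq> 0 \<longrightarrow> xf v N \<in> I \<and> key (bf v N) * K (xf v N) = N \<and> v \<notin> R (Suc N))"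
    if v: "v \<in> M" "v \<in> R N" for v N
  proof -
    obtain x b c where "W v N (x, b, c)" using step[OF v] unfolding W_def fst_conv snd_conv by blast
    then have "W v N (tf v N)" unfolding tf_def by (rule someI)
    then show ?thesis by (simp add: W_def xf_def bf_def cf_def)
  qed
  define k where "k = (\<Sum>x\<in>I. K x)"
  have "\<exists>a. (\<forall>i. v i = (\<Sum>x\<in>I. a x * g x i)) \<and>
       ((\<forall>i. v i \<in> max_ideal_pow k) \<longrightarrow> (\<forall>x\<in>I. a x \<in> max_ideal))" if v: "v \<in> M" for v
  proof -
    define V where "V = rec_nat v (\<lambda>N u i. u i - mfps_const (cf u N) * (monomial (bf u N) * g (xf u N) i))"
    have V0: "V 0 = v" and VS: "V (Suc N) = (\<lambda>i. V N i - mfps_const (cf (V N) N) * (monomial (bf (V N) N) * g (xf (V N) N) i))" for N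
      by (simp_all add: V_def)
    define x b c where "x N = xf (V N) N" and "b N = bf (V N) N" and "c N = cf (V N) N" for N
    have VMR: "V N \<in> M \<and> V N \<in> R N" for N
    proof (induction N)
      case 0
      then show ?case using v by (simp add: V0 R_def)
    next
      case (Suc N)
      have "V (Suc N) \<in> M"
      proof (cases "c N = 0")
        case True
        then show ?thesis using Suc by (simp add: VS c_def mfps_const_simps)
      next
        case False
        then have "g (x N) \<in> M" using f Suc g(1) by (auto simp: x_def c_def)
        from M_diff[OF conjunct1[OF Suc] M_scale[OF M_scale[OF this, of "monomial (b N)"], of "mfps_const (c N)"]]
        show ?thesis by (simp add: VS x_def b_def c_def)
      qed
      then show ?case using f Suc by (auto simp: VS)
    qed
    have c: "x N \<in> I \<and> key (b N) * K (x N) = N \<and> V N \<notin> R (Suc N)" if "c N \<noteq> 0" for N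
      using f VMR that by (auto simp: x_def b_def c_def)
    \<comment> \<open>Only step \<open>key d * K y\<close> can contribute to the coefficient at \<open>d\<close> of the quotient by \<open>g y\<close>; \<open>P N y\<close>
      is the part of this quotient that has been found before step \<open>N\<close>.\<close>
    define A where "A y = Abs_mfps (\<lambda>d. let N = key d * K y in if x N = y \<and> b N = d then c N else 0)" for y
    define P where "P N y = (\<Sum>n<N. if x n = y then mfps_const (c n) * monomial (b n) else 0)" for N y
    have V_P: "V N i = v i - (\<Sum>y\<in>I. P N y * g y i)" for N i
    proof -
      have "(\<Sum>y\<in>I. P N y * g y i) = (\<Sum>y\<in>I. \<Sum>n<N. if x n = y then mfps_const (c n) * (monomial (b n) * g (x n) i) else 0)"
        unfolding P_def sum_distrib_right by (intro sum.cong) (auto simp: mult.assoc)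
      also have "\<dots> = (\<Sum>n<N. \<Sum>y\<in>I. if x n = y then mfps_const (c n) * (monomial (b n) * g (x n) i) else 0)"
        by (rule sum.swap)
      also have "\<dots> = (\<Sum>n<N. mfps_const (c n) * (monomial (b n) * g (x n) i))"
      proof (intro sum.cong refl)
        fix n
        show "(\<Sum>y\<in>I. if x n = y then mfps_const (c n) * (monomial (b n) * g (x n) i) else 0) =
          mfps_const (c n) * (monomial (b n) * g (x n) i)"
          using c[of n] finI by (cases "c n = 0") (simp_all add: mfps_const_simps)
      qed
      also have "\<dots> = v i - V N i"
        by (induction N) (simp_all add: V0 VS x_def b_def c_def)
      finally show ?thesis by simp
    qed
    have P_A: "mfps_coeff (P N y) d = (if key d * K y < N then mfps_coeff (A y) d else 0)" for N y d
    proof -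
      have "mfps_coeff (P N y) d = (\<Sum>n<N. if n = key d * K y then mfps_coeff (A y) d else 0)"
        unfolding P_def mfps_coeff_sum
      proof (intro sum.cong refl)
        fix n
        show "mfps_coeff (if x n = y then mfps_const (c n) * monomial (b n) else 0) d =
              (if n = key d * K y then mfps_coeff (A y) d else 0)"
          using c[of n] by (cases "c n = 0") (auto simp: A_def monomial_def Let_def)
      qed
      then show ?thesis by simp
    qed
    have tail: "mfps_coeff ((A y - P N y) * g y i) a = 0" if y: "y \<in> I" and "K (a, i) < N" for N y a i
      unfolding mfps_coeff_mult
    proof (rule sum.neutral, clarify)
      fix p q assume a: "a = p + q"
      show "mfps_coeff (A y - P N y) p * mfps_coeff (g y i) q = 0"
      proof (rule ccontr)
        assume nz: "mfps_coeff (A y - P N y) p * mfps_coeff (g y i) q \<noteq> 0"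
        then have "N \<le> key p * K y" by (auto simp: P_A split: if_splits)
        also have "K y \<le> K (q, i)" using nz g(3)[OF y] by (auto simp: R_def vc_def intro: leI)
        then have "key p * K y \<le> key p * K (q, i)" by simp
        also have "\<dots> = K (a, i)" using K(2)[of q p i] a by (simp add: add.commute)
        finally show False using \<open>K (a, i) < N\<close> by simp
      qed
    qed
    have "v i = (\<Sum>y\<in>I. A y * g y i)" for i
    proof (rule mfps_eqI)
      fix a
      define N where "N = Suc (K (a, i))"
      have "v i - (\<Sum>y\<in>I. A y * g y i) = V N i - (\<Sum>y\<in>I. (A y - P N y) * g y i)"
        by (simp add: V_P left_diff_distrib sum_subtractf)
      moreover have "mfps_coeff (V N i) a = 0" using VMR[of N] by (auto simp: R_def vc_def N_def)
      moreover have "mfps_coeff (\<Sum>y\<in>I. (A y - P N y) * g y i) a = 0"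
        unfolding mfps_coeff_sum by (intro sum.neutral ballI tail) (simp_all add: N_def)
      ultimately have "mfps_coeff (v i - (\<Sum>y\<in>I. A y * g y i)) a = 0" by (simp only: mfps_coeff_simps(2) diff_zero)
      then show "mfps_coeff (v i) a = mfps_coeff (\<Sum>y\<in>I. A y * g y i) a" by simp
    qed
    moreover have "A y \<in> max_ideal" if "\<forall>i. v i \<in> max_ideal_pow k" and y: "y \<in> I" for y
    proof -
      have vR: "v \<in> R (2 ^ k)"
      proof -
        have "vc v z = 0" if "K z < 2 ^ k" for z
        proof -
          obtain a i where z: "z = (a, i)" by (cases z)
          have "(2::nat) ^ total_degree a < 2 ^ k"
            by (rule le_less_trans[OF K(3)[of a i]]) (use that z in simp)
          then have "total_degree a < k" by simp
          then show ?thesis using \<open>\<forall>i. v i \<in> max_ideal_pow k\<close> by (simp add: z vc_def max_ideal_pow_eq del: max_ideal_pow.simps)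
        qed
        then show ?thesis by (simp add: R_def)
      qed
      have VN: "N \<le> 2 ^ k \<Longrightarrow> V N = v" for N
      proof (induction N)
        case (Suc N)
        then have "V N \<in> R (Suc N)" using vR by (auto simp: R_def)
        then have "c N = 0" using c by blast
        then show ?case using Suc by (simp add: VS c_def mfps_const_simps)
      qed (simp add: V0)
      have "K y \<le> k" unfolding k_def using finI y by (intro member_le_sum) auto
      then have lt: "K y < 2 ^ k" using less_exp[of k] by linarith
      then have "V (K y) \<in> R (Suc (K y))" using VN[of "K y"] vR by (auto simp: R_def)
      then have "c (K y) = 0" using c by blast
      then show ?thesis by (simp add: max_ideal_eq A_def key0 Let_def)
    qed
    ultimately show ?thesis by blast
  qed
  moreover have "g ` I \<subseteq> M" using g(1) by blast
  ultimately show ?thesis using finI by blast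
qed

section \<open>Minimal generating sets\<close>

text \<open>The elements of \<open>A\<close> are eliminated one after the other: \<open>1 - c\<close> is a unit if \<open>c\<close> is in the maximal
  ideal.\<close>

lemma nakayama:
  fixes scale :: "'n::finite mfps \<Rightarrow> 'b::ab_group_add \<Rightarrow> 'b"
  assumes "module scale" "module.subspace scale N" "finite A"
    and "\<And>a. a \<in> A \<Longrightarrow> \<exists>c. (\<forall>b\<in>A. c b \<in> max_ideal) \<and> a - (\<Sum>b\<in>A. scale (c b) b) \<in> N"
  shows "A \<subseteq> N"
  using assms(3,4)
proof (induction A rule: finite_induct)
  case (insert a A)
  interpret module scale by fact
  note N = \<open>subspace N\<close>
  have "\<forall>e\<in>insert a A. \<exists>c. (\<forall>b\<in>insert a A. c b \<in> max_ideal) \<and> e - (\<Sum>b\<in>insert a A. scale (c b) b) \<in> N"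
    using insert.prems by blast
  then obtain c where c: "\<And>e b. e \<in> insert a A \<Longrightarrow> b \<in> insert a A \<Longrightarrow> c e b \<in> max_ideal"
    "\<And>e. e \<in> insert a A \<Longrightarrow> e - (\<Sum>b\<in>insert a A. scale (c e b) b) \<in> N" by metis
  have c': "e - (scale (c e a) a + (\<Sum>b\<in>A. scale (c e b) b)) \<in> N" if "e \<in> insert a A" for e
    using c(2)[OF that] insert.hyps by simp
  have "1 - c a a \<notin> max_ideal" using c(1)[of a a] by (simp add: max_ideal_eq)
  then obtain u where u: "1 = (1 - c a a) * u" by (elim dvdE[OF mfps_unit])
  have a: "a - (\<Sum>b\<in>A. scale (u * c a b) b) \<in> N"
  proof -
    have "scale u (scale (1 - c a a) a - (\<Sum>b\<in>A. scale (c a b) b)) \<in> N"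
      using c'[of a] by (intro subspace_scale[OF N]) (simp add: scale_left_diff_distrib algebra_simps)
    moreover have "scale u (scale (1 - c a a) a) = a" using u by (simp add: mult.commute)
    ultimately show ?thesis by (simp add: scale_right_diff_distrib scale_sum_right)
  qed
  have "A \<subseteq> N"
  proof (rule insert.IH)
    fix e assume e: "e \<in> A"
    let ?c = "\<lambda>b. c e b + c e a * (u * c a b)"
    have "(e - (scale (c e a) a + (\<Sum>b\<in>A. scale (c e b) b))) + scale (c e a) (a - (\<Sum>b\<in>A. scale (u * c a b) b)) \<in> N"
      using c'[of e] e a by (intro subspace_add[OF N] subspace_scale[OF N]) auto
    then have "e - (\<Sum>b\<in>A. scale (?c b) b) \<in> N"
      by (simp add: scale_right_diff_distrib scale_sum_right scale_left_distrib sum.distrib algebra_simps)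
    moreover have "\<forall>b\<in>A. ?c b \<in> max_ideal" using c(1) e by (auto simp: max_ideal_eq)
    ultimately show "\<exists>c. (\<forall>b\<in>A. c b \<in> max_ideal) \<and> e - (\<Sum>b\<in>A. scale (c b) b) \<in> N"
      by (intro exI[of _ ?c] conjI)
  qed
  moreover from this have "(\<Sum>b\<in>A. scale (u * c a b) b) \<in> N"
    by (intro subspace_sum[OF N] subspace_scale[OF N]) auto
  with a have "a \<in> N" using subspace_add[OF N] by fastforce
  ultimately show ?case by simp
qed simp

definition max_ideal_times :: "('n::finite mfps \<Rightarrow> 'n mfps) set \<Rightarrow> ('n mfps \<Rightarrow> 'n mfps) set" where
  "max_ideal_times M = der_module.span {der_scale a d |a d. a \<in> max_ideal \<and> d \<in> M}"

lemma max_ideal_times_subspace: "der_module.subspace (max_ideal_times M)" "derivs.subspace (max_ideal_times M)"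
  unfolding max_ideal_times_def by (auto intro: derivs_subspaceI)

lemma max_ideal_times_base: "a \<in> max_ideal \<Longrightarrow> d \<in> M \<Longrightarrow> der_scale a d \<in> max_ideal_times M"
  unfolding max_ideal_times_def by (intro der_module.span_base) blast

text \<open>Noetherianity, and the Artin--Rees property in its weakest form.\<close>

lemma derivation_module_noetherian:
  fixes M :: "('n::finite mfps \<Rightarrow> 'n mfps) set"
  assumes M: "der_module.subspace M" "M \<subseteq> Der"
  obtains A k where "finite A" "A \<subseteq> M" "M \<subseteq> der_module.span A" "M \<inter> Der_filtration k \<subseteq> max_ideal_times M"
proof -
  let ?V = "\<lambda>d i. d (mfps_X i) :: 'n mfps"
  have diff: "(\<lambda>i. u i - v i) \<in> ?V ` M" if uv: "u \<in> ?V ` M" "v \<in> ?V ` M" for u v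
  proof -
    obtain d e where "d \<in> M" "e \<in> M" "u = ?V d" "v = ?V e" using uv by blast
    then show ?thesis using der_module.subspace_diff[OF M(1), of d e] by (intro image_eqI[of _ _ "d - e"]) auto
  qed
  have scale: "(\<lambda>i. a * v i) \<in> ?V ` M" if v: "v \<in> ?V ` M" for a v
  proof -
    obtain d where "d \<in> M" "v = ?V d" using v by blast
    then show ?thesis using der_module.subspace_scale[OF M(1), of d a]
      by (intro image_eqI[of _ _ "der_scale a d"]) (auto simp: der_scale_def)
  qed
  obtain I :: "(('n \<Rightarrow> nat) \<times> 'n) set" and g k where I: "finite I" "g ` I \<subseteq> ?V ` M"
    "\<forall>v\<in>?V ` M. \<exists>a. (\<forall>i. v i = (\<Sum>x\<in>I. a x * g x i)) \<and>
       ((\<forall>i. v i \<in> max_ideal_pow k) \<longrightarrow> (\<forall>x\<in>I. a x \<in> max_ideal))"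
    using standard_basis[of "?V ` M", OF diff scale] by blast
  have "\<forall>x\<in>I. \<exists>d\<in>M. g x = ?V d" using I(2) by blast
  then obtain e where e: "\<And>x. x \<in> I \<Longrightarrow> e x \<in> M" "\<And>x. x \<in> I \<Longrightarrow> g x = ?V (e x)" by metis
  have rep: "\<exists>a. d = (\<Sum>x\<in>I. der_scale (a x) (e x)) \<and> (d \<in> Der_filtration k \<longrightarrow> (\<forall>x\<in>I. a x \<in> max_ideal))"
    if d: "d \<in> M" for d
  proof -
    obtain a where a: "\<And>i. d (mfps_X i) = (\<Sum>x\<in>I. a x * g x i)"
      "(\<forall>i. d (mfps_X i) \<in> max_ideal_pow k) \<longrightarrow> (\<forall>x\<in>I. a x \<in> max_ideal)"
      using I(3) d by fastforce
    have "d = (\<Sum>x\<in>I. der_scale (a x) (e x))"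
      using e M d a(1) by (intro Der_eqI[OF _ _ formal_coordinates_X] Der_closed)
        (auto simp: sum_fun_apply der_scale_def intro!: sum.cong)
    then show ?thesis using a(2) by (auto simp: Der_filtration_def)
  qed
  show thesis
  proof (rule that)
    show "finite (e ` I)" "e ` I \<subseteq> M" using I e by auto
    show "M \<subseteq> der_module.span (e ` I)"
    proof
      fix d assume "d \<in> M"
      then obtain a where a: "d = (\<Sum>x\<in>I. der_scale (a x) (e x))" using rep by blast
      show "d \<in> der_module.span (e ` I)"
        unfolding a by (intro der_module.span_sum der_module.span_scale der_module.span_base) auto
    qed
    show "M \<inter> Der_filtration k \<subseteq> max_ideal_times M"
    proof
      fix d assume d: "d \<in> M \<inter> Der_filtration k"
      then obtain a where a: "d = (\<Sum>x\<in>I. der_scale (a x) (e x))" "\<forall>x\<in>I. a x \<in> max_ideal" using rep by blast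
      show "d \<in> max_ideal_times M"
        unfolding a(1) using a(2) e
        by (intro der_module.subspace_sum[OF max_ideal_times_subspace(1)] max_ideal_times_base) auto
    qed
  qed
qed

context
  fixes M :: "('n::finite mfps \<Rightarrow> 'n mfps) set"
  assumes M: "der_module.subspace M" "M \<subseteq> Der"
begin

lemma max_ideal_times_representation:
  assumes A: "finite A" "M \<subseteq> der_module.span A" and d: "d \<in> max_ideal_times M"
  shows "\<exists>c. (\<forall>b\<in>A. c b \<in> max_ideal) \<and> d = (\<Sum>b\<in>A. der_scale (c b) b)"
  using d unfolding max_ideal_times_def
proof (induction rule: der_module.span_induct_alt)
  case base
  then show ?case by (intro exI[of _ "\<lambda>_. 0"]) (simp add: max_ideal_eq)
next
  case (step r x y)
  then obtain a e c where ae: "x = der_scale a e" "a \<in> max_ideal" "e \<in> M"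
    and c: "\<forall>b\<in>A. c b \<in> max_ideal" "y = (\<Sum>b\<in>A. der_scale (c b) b)" by blast
  obtain q where q: "e = (\<Sum>b\<in>A. der_scale (q b) b)"
    using A ae(3) by (auto simp: der_module.span_finite)
  have "der_scale r x + y = (\<Sum>b\<in>A. der_scale (r * (a * q b) + c b) b)"
    by (simp add: ae(1) q c(2) der_module.scale_sum_right der_module.scale_left_distrib sum.distrib)
  moreover have "\<forall>b\<in>A. r * (a * q b) + c b \<in> max_ideal" using ae c by (auto simp: max_ideal_eq)
  ultimately show ?case by (intro exI[of _ "\<lambda>b. r * (a * q b) + c b"]) simp
qed

lemma generates_if_generates_mod:
  assumes N: "der_module.subspace N" and "M \<subseteq> derivs.span (H \<union> max_ideal_times M)" "H \<subseteq> N"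
  shows "M \<subseteq> N"
proof -
  obtain A k where A: "finite A" "A \<subseteq> M" "M \<subseteq> der_module.span A" using derivation_module_noetherian[OF M] by metis
  have HN: "derivs.span H \<subseteq> N" by (intro derivs.span_minimal derivs_subspaceI assms)
  have "A \<subseteq> N"
  proof (rule nakayama[OF der_module.module_axioms N A(1)])
    fix a assume "a \<in> A"
    then have "a \<in> derivs.span (H \<union> max_ideal_times M)" using A assms by blast
    then obtain s where s: "s \<in> derivs.span H" "a - s \<in> max_ideal_times M"
      using derivs.span_Un_subspace[OF max_ideal_times_subspace(2)] by blast
    obtain c where c: "\<forall>b\<in>A. c b \<in> max_ideal" "a - s = (\<Sum>b\<in>A. der_scale (c b) b)"
      using max_ideal_times_representation[OF A(1,3) s(2)] by blast
    have "a - (\<Sum>b\<in>A. der_scale (c b) b) \<in> N" using c(2)[symmetric] s(1) HN by auto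
    then show "\<exists>c. (\<forall>b\<in>A. c b \<in> max_ideal) \<and> a - (\<Sum>b\<in>A. der_scale (c b) b) \<in> N" using c(1) by blast
  qed
  then show ?thesis using A(3) der_module.span_minimal[OF _ N] by blast
qed

lemma span_subset_span_mod:
  assumes "H \<subseteq> M"
  shows "der_module.span H \<subseteq> derivs.span (H \<union> max_ideal_times M)"
proof
  fix d assume "d \<in> der_module.span H"
  then show "d \<in> derivs.span (H \<union> max_ideal_times M)"
  proof (induction rule: der_module.span_induct_alt)
    case base
    then show ?case by (rule derivs.span_zero)
  next
    case (step c x y)
    have "der_scale c x = der_cscale (mfps_coeff c 0) x + der_scale (c - mfps_const (mfps_coeff c 0)) x"
      by (simp add: der_cscale_def der_module.scale_left_diff_distrib)
    moreover have "der_scale (c - mfps_const (mfps_coeff c 0)) x \<in> max_ideal_times M"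
      using step(1) assms minus_const_in_max_ideal by (intro max_ideal_times_base) auto
    ultimately have "der_scale c x \<in> derivs.span (H \<union> max_ideal_times M)"
      using step(1) by (auto intro!: derivs.span_add derivs.span_scale intro: derivs.span_base)
    then show ?case using step(2) by (rule derivs.span_add)
  qed
qed

lemma minimal_generating_set_if_basis_mod:
  assumes B: "B \<subseteq> M" "derivs.independent_mod (max_ideal_times M) B" "M \<subseteq> derivs.span (B \<union> max_ideal_times M)"
  shows "minimal_generating_set M B"
  unfolding minimal_generating_set_def
proof (intro conjI allI impI)
  show "der_module.span B = M"
    using generates_if_generates_mod[OF der_module.subspace_span B(3) der_module.span_superset]
      der_module.span_minimal[OF B(1) M(1)] by auto
  fix H assume H: "H \<subset> B"
  then obtain b where b: "b \<in> B" "b \<notin> H" by blast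
  show "der_module.span H \<noteq> M"
  proof
    assume "der_module.span H = M"
    then have "b \<in> derivs.span (H \<union> max_ideal_times M)" using span_subset_span_mod[of H] H B(1) b by blast
    moreover have "derivs.span (H \<union> max_ideal_times M) \<subseteq> derivs.span ((B - {b}) \<union> max_ideal_times M)"
      using H b by (intro derivs.span_mono) auto
    ultimately show False
      using derivs.independent_mod_not_in_span[OF max_ideal_times_subspace(2) B(2) b(1)] by blast
  qed
qed

lemma minimal_generating_set_subset: "minimal_generating_set M G \<Longrightarrow> G \<subseteq> M"
  unfolding minimal_generating_set_def using der_module.span_superset by blast

text \<open>If \<open>v\<close> is a combination of the others modulo \<open>max_ideal_times M\<close>, then the others generate \<open>M\<close> by
  Nakayama's lemma.\<close>

lemma minimal_generating_set_independent_mod: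
  assumes G: "minimal_generating_set M G" and S: "finite S" "S \<subseteq> G"
  shows "derivs.independent_mod (max_ideal_times M) S"
proof (rule derivs.independent_modI_notin[OF max_ideal_times_subspace(2) S(1)], rule notI)
  fix v assume v: "v \<in> S" "v \<in> derivs.span ((S - {v}) \<union> max_ideal_times M)"
  let ?H = "G - {v}"
  have GM: "G \<subseteq> M" using G by (rule minimal_generating_set_subset)
  have "derivs.span ((S - {v}) \<union> max_ideal_times M) \<subseteq> derivs.span (?H \<union> max_ideal_times M)"
    using S by (intro derivs.span_mono) auto
  then have "v \<in> derivs.span (?H \<union> max_ideal_times M)" using v(2) by blast
  then have "G \<subseteq> derivs.span (?H \<union> max_ideal_times M)"
    using derivs.span_superset[of "?H \<union> max_ideal_times M"] by blast
  then have "derivs.span (G \<union> max_ideal_times M) \<subseteq> derivs.span (?H \<union> max_ideal_times M)"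
    by (rule derivs.span_Un_trans)
  moreover have "M \<subseteq> derivs.span (G \<union> max_ideal_times M)"
    using span_subset_span_mod[OF GM] G by (simp add: minimal_generating_set_def)
  ultimately have "M \<subseteq> derivs.span (?H \<union> max_ideal_times M)" by blast
  then have "M \<subseteq> der_module.span ?H"
    by (rule generates_if_generates_mod[OF der_module.subspace_span _ der_module.span_superset])
  moreover have "der_module.span ?H \<subseteq> M" using GM by (intro der_module.span_minimal M) auto
  moreover have "?H \<subset> G" using v S by blast
  ultimately show False using G by (auto simp: minimal_generating_set_def)
qed

lemma independent_mod_card_bounded:
  obtains m where "\<And>S. S \<subseteq> M \<Longrightarrow> derivs.independent_mod (max_ideal_times M) S \<Longrightarrow> card S \<le> m"
proof -
  obtain A k where A: "finite A" "A \<subseteq> M" "M \<subseteq> der_module.span A" using derivation_module_noetherian[OF M] by metis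
  have "M \<subseteq> derivs.span (A \<union> max_ideal_times M)" using A span_subset_span_mod by blast
  then show thesis
    using derivs.card_independent_mod_le[OF max_ideal_times_subspace(2) A(1)] by (intro that[of "card A"]) blast
qed

lemma finite_minimal_generating_set:
  assumes "minimal_generating_set M G"
  shows "finite G"
proof (rule ccontr)
  assume inf: "infinite G"
  obtain m where m: "\<And>S. S \<subseteq> M \<Longrightarrow> derivs.independent_mod (max_ideal_times M) S \<Longrightarrow> card S \<le> m"
    using independent_mod_card_bounded by blast
  obtain S where "finite S" "card S = Suc m" "S \<subseteq> G" using infinite_arbitrarily_large[OF inf] by blast
  then show False using m[of S] minimal_generating_set_independent_mod[OF assms] minimal_generating_set_subset[OF assms] by auto
qed

lemma extend_to_minimal_generating_set:
  assumes S: "S \<subseteq> M" "derivs.independent_mod (max_ideal_times M) S"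
    and C: "C \<subseteq> M" "M \<subseteq> derivs.span (C \<union> max_ideal_times M)"
  obtains B where "S \<subseteq> B" "B \<subseteq> S \<union> C" "finite B" "minimal_generating_set M B"
proof -
  let ?W = "max_ideal_times M"
  obtain A k where A: "finite A" "A \<subseteq> M" "M \<subseteq> der_module.span A" using derivation_module_noetherian[OF M] by metis
  obtain T where T: "finite T" "T \<subseteq> C" "A \<subseteq> derivs.span (T \<union> ?W)"
    by (rule derivs.finite_subset_spanning[OF A(1) subset_trans[OF A(2) C(2)]])
  obtain B where B: "S \<subseteq> B" "B \<subseteq> S \<union> T" "derivs.independent_mod ?W B" "T \<subseteq> derivs.span (B \<union> ?W)"
    using derivs.extend_independent_mod[OF max_ideal_times_subspace(2) S(2) T(1)] by metis
  have "M \<subseteq> derivs.span (A \<union> ?W)" using A span_subset_span_mod by blast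
  also have "\<dots> \<subseteq> derivs.span (T \<union> ?W)" by (rule derivs.span_Un_trans[OF T(3)])
  also have "\<dots> \<subseteq> derivs.span (B \<union> ?W)" by (rule derivs.span_Un_trans[OF B(4)])
  finally have gen: "M \<subseteq> derivs.span (B \<union> ?W)" .
  have "B \<subseteq> M" using B(2) T(2) C(1) S(1) by blast
  then have "minimal_generating_set M B" using B(3) gen by (rule minimal_generating_set_if_basis_mod)
  moreover have "finite B" using B(3) by (simp add: derivs.independent_mod_def)
  ultimately show thesis using that B T by blast
qed

end

section \<open>Semisimple derivations\<close>

lemma singular_filtered_endo:
  assumes "d \<in> max_ideal_Der"
  shows "series.filtered_endo d"
  using assms Der_endo Der_preserves_max_ideal_pow
  by (auto simp: max_ideal_Der_eq series.filtered_endo_def)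

text \<open>The operator \<open>d - (x + y)\<close> maps \<open>p q\<close> to \<open>((d - x) p) q + p ((d - y) q)\<close>, by the Leibniz rule.\<close>

lemma gen_eigen_mult:
  assumes d: "d \<in> max_ideal_Der"
    and "p \<in> series.gen_eigen d k x" "q \<in> series.gen_eigen d k y"
  shows "p * q \<in> series.gen_eigen d k (x + y)"
proof -
  have dD: "d \<in> Der" using d by (simp add: max_ideal_Der_eq)
  note E = Der_endo[OF dD]
  have Suc_pow: "series.poly_op d ([:- z, 1:] ^ Suc n) r = series.poly_op d ([:- z, 1:] ^ n) (d r - mfps_scale z r)" for z n r
    by (simp only: power_Suc2 series.poly_op_mult[OF E] series.poly_op_linear_factor[OF E])
  have "series.poly_op d ([:- (x + y), 1:] ^ (m + n)) (p * q) \<in> max_ideal_pow k"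
    if "series.poly_op d ([:- x, 1:] ^ m) p \<in> max_ideal_pow k" "series.poly_op d ([:- y, 1:] ^ n) q \<in> max_ideal_pow k" for m n p q
    using that
  proof (induction "m + n" arbitrary: m n p q)
    case 0
    then show ?case using max_ideal_pow_mult_left by (simp add: series.poly_op_1[OF E])
  next
    case (Suc l)
    show ?case
    proof (cases "m = 0 \<or> n = 0")
      case True
      then have "p * q \<in> max_ideal_pow k"
        using Suc.prems max_ideal_pow_mult_left[of p k q] max_ideal_pow_mult_left[of q k p]
        by (auto simp: series.poly_op_1[OF E] mult.commute)
      then show ?thesis by (rule series.poly_op_F[OF singular_filtered_endo[OF d]])
    next
      case False
      then obtain m' n' where mn: "m = Suc m'" "n = Suc n'" using not0_implies_Suc by blast
      let ?p = "d p - mfps_scale x p" and ?q = "d q - mfps_scale y q"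
      have 1: "series.poly_op d ([:- (x + y), 1:] ^ l) (?p * q) \<in> max_ideal_pow k"
        using Suc.hyps(1)[of m' n ?p q] Suc.hyps(2) Suc.prems mn by (simp only: Suc_pow add_Suc nat.inject)
      have 2: "series.poly_op d ([:- (x + y), 1:] ^ l) (p * ?q) \<in> max_ideal_pow k"
        using Suc.hyps(1)[of m n' p ?q] Suc.hyps(2) Suc.prems mn by (simp only: Suc_pow add_Suc add_Suc_right nat.inject)
      have "d (p * q) - mfps_scale (x + y) (p * q) = ?p * q + p * ?q"
        by (simp add: Der_mult[OF dD] mfps_scale_def mfps_const_simps algebra_simps)
      then have "series.poly_op d ([:- (x + y), 1:] ^ Suc l) (p * q) \<in> max_ideal_pow k"
        using series.F_add[OF 1 2] by (simp only: Suc_pow series.endo_add[OF series.endo_poly_op[OF E]])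
      then show ?thesis using Suc.hyps(2) by simp
    qed
  qed
  moreover obtain m n where "series.poly_op d ([:- x, 1:] ^ m) p \<in> max_ideal_pow k"
    "series.poly_op d ([:- y, 1:] ^ n) q \<in> max_ideal_pow k"
    using assms(2,3) unfolding series.gen_eigen_def by blast
  ultimately show ?thesis unfolding series.gen_eigen_def by (intro CollectI conjI exI[of _ "m + n"]) simp_all
qed

text \<open>It suffices to check the Leibniz rule on generalised eigenvectors \<open>p\<close> and \<open>q\<close>, where it says that
  \<open>h (x + y) = h x + h y\<close> for the eigenvalues \<open>x\<close> and \<open>y\<close>.\<close>

lemma fcalc_derivation:
  assumes d: "d \<in> max_ideal_Der" and h: "\<And>x y. h (x + y) = h x + h y"
  shows "series.fcalc d h \<in> max_ideal_Der"
proof -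
  note T = singular_filtered_endo[OF d]
  let ?D = "series.fcalc d h"
  have dD: "d \<in> Der" using d by (simp add: max_ideal_Der_eq)
  have add: "?D (p + q) = ?D p + ?D q" for p q by (rule series.fcalc_add[OF T]) simp_all
  have scale: "?D (mfps_const c * p) = mfps_const c * ?D p" for c p
    using series.fcalc_scale[OF T, of p h c] by (simp add: mfps_scale_def)
  have D0: "?D 0 = 0" using add[of 0 0] by simp
  have lin: "?D (mfps_scale c a + b) = mfps_const c * ?D a + ?D b" for a b c
    by (simp only: add scale mfps_scale_def)
  have "?D (p * q) - (p * ?D q + q * ?D p) \<in> max_ideal_pow k" for p q k
  proof (rule series.gen_eigen_induct[OF T, of p k])
    fix x p assume p: "p \<in> series.gen_eigen d k x"
    show "?D (p * q) - (p * ?D q + q * ?D p) \<in> max_ideal_pow k"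
    proof (rule series.gen_eigen_induct[OF T, of q k])
      fix y q assume q: "q \<in> series.gen_eigen d k y"
      have "?D (p * q) - mfps_scale (h (x + y)) (p * q) \<in> max_ideal_pow k"
        by (rule series.fcalc_gen_eigen[OF T gen_eigen_mult[OF d p q]])
      moreover have "p * (?D q - mfps_scale (h y) q) + q * (?D p - mfps_scale (h x) p) \<in> max_ideal_pow k"
        by (intro series.F_add max_ideal_pow_mult_left series.fcalc_gen_eigen[OF T] p q)
      ultimately have "?D (p * q) - mfps_scale (h (x + y)) (p * q) -
          (p * (?D q - mfps_scale (h y) q) + q * (?D p - mfps_scale (h x) p)) \<in> max_ideal_pow k"
        by (rule series.F_diff)
      then show "?D (p * q) - (p * ?D q + q * ?D p) \<in> max_ideal_pow k"
        by (simp add: h mfps_scale_def mfps_const_simps algebra_simps)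
    next
      fix a b c assume "?D (p * a) - (p * ?D a + a * ?D p) \<in> max_ideal_pow k"
        "?D (p * b) - (p * ?D b + b * ?D p) \<in> max_ideal_pow k"
      from series.F_add[OF max_ideal_pow_mult_left[OF this(1), of "mfps_const c"] this(2)]
      moreover have "p * (mfps_scale c a + b) = mfps_scale c (p * a) + p * b" by (simp add: mfps_scale_def algebra_simps)
      ultimately show "?D (p * (mfps_scale c a + b)) - (p * ?D (mfps_scale c a + b) + (mfps_scale c a + b) * ?D p) \<in> max_ideal_pow k"
        by (simp only: lin) (simp add: mfps_scale_def algebra_simps)
    qed (simp_all add: D0 series.F_0)
  next
    fix a b c assume "?D (a * q) - (a * ?D q + q * ?D a) \<in> max_ideal_pow k"
      "?D (b * q) - (b * ?D q + q * ?D b) \<in> max_ideal_pow k"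
    from series.F_add[OF max_ideal_pow_mult_left[OF this(1), of "mfps_const c"] this(2)]
    moreover have "(mfps_scale c a + b) * q = mfps_scale c (a * q) + b * q" by (simp add: mfps_scale_def algebra_simps)
    ultimately show "?D ((mfps_scale c a + b) * q) - ((mfps_scale c a + b) * ?D q + q * ?D (mfps_scale c a + b)) \<in> max_ideal_pow k"
      by (simp only: lin) (simp add: mfps_scale_def algebra_simps)
  qed (simp_all add: D0 series.F_0)
  then have "?D (p * q) = p * ?D q + q * ?D p" for p q by (rule series.F_eqI)
  then have D: "?D \<in> Der" by (intro DerI add scale)
  have "?D p \<in> max_ideal" for p
  proof -
    have "p - mfps_const (mfps_coeff p 0) \<in> max_ideal_pow (Suc 0)"
      using minus_const_in_max_ideal max_ideal_pow_1 by blast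
    then have "?D (p - mfps_const (mfps_coeff p 0)) \<in> max_ideal_pow (Suc 0)" by (rule series.fcalc_F[OF T])
    then show ?thesis using D by (simp add: Der_diff Der_const max_ideal_pow_1)
  qed
  then show ?thesis using D by (simp add: max_ideal_Der_eq)
qed

lemma semisimple_imp_op:
  assumes "semisimple d"
  shows "series.semisimple_op d"
proof (rule series.semisimple_opI)
  show "series.filtered_endo d" using assms by (intro singular_filtered_endo) (simp add: semisimple_def)
  fix k p
  let ?G = "{r \<in> max_ideal_pow 0. \<exists>z. d r - mfps_scale z r \<in> max_ideal_pow k} \<union> max_ideal_pow k"
  obtain B where B: "basis_mod (max_ideal_pow k) B" "\<forall>b\<in>B. \<exists>c. d b - mfps_const c * b \<in> max_ideal_pow k"
    using assms by (auto simp: semisimple_def diagonalizable_mod_def)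
  obtain c where c: "p - (\<Sum>b\<in>B. mfps_const (c b) * b) \<in> max_ideal_pow k" using B(1) unfolding basis_mod_def by blast
  have "(\<Sum>b\<in>B. mfps_scale (c b) b) \<in> series.span ?G"
    using B(2) by (intro series.span_sum series.span_scale series.span_base) (auto simp: mfps_scale_def)
  moreover have "p - (\<Sum>b\<in>B. mfps_scale (c b) b) \<in> series.span ?G"
    using c by (intro series.span_base) (auto simp: mfps_scale_def)
  ultimately show "p \<in> series.span ?G" using series.span_add by fastforce
qed

text \<open>A basis of the quotient is selected among the eigenvectors.\<close>

lemma semisimpleI:
  fixes d :: "'n::finite mfps \<Rightarrow> 'n mfps"
  assumes d: "d \<in> max_ideal_Der"
    and span: "\<And>k. UNIV \<subseteq> series.span ({r. \<exists>z. d r = mfps_scale z r} \<union> max_ideal_pow k)"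
  shows "semisimple d"
  unfolding semisimple_def diagonalizable_mod_def
proof (intro conjI d allI)
  fix k
  let ?W = "max_ideal_pow k"
  obtain A :: "'n mfps set" where A: "finite A" "UNIV \<subseteq> series.span (A \<union> ?W)"
    using finite_codim_max_ideal_pow[where 'n = 'n and k = k] by (elim exE conjE)
  obtain T where T: "finite T" "T \<subseteq> {r. \<exists>z. d r = mfps_scale z r}" "A \<subseteq> series.span (T \<union> ?W)"
    by (rule series.finite_subset_spanning[OF A(1) subset_trans[OF subset_UNIV span]])
  obtain B where B: "B \<subseteq> {} \<union> T" "series.independent_mod ?W B" "T \<subseteq> series.span (B \<union> ?W)"
    using series.extend_independent_mod[OF series.subspace_F series.independent_mod_empty T(1)] by metis
  have "UNIV \<subseteq> series.span (B \<union> ?W)"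
    using A(2) series.span_Un_trans[OF T(3)] series.span_Un_trans[OF B(3)] by blast
  then have "\<exists>s\<in>series.span B. p - s \<in> ?W" for p
    using series.span_Un_subspace[OF series.subspace_F, of p B k] by blast
  moreover have "finite B" using B(2) by (simp add: series.independent_mod_def)
  ultimately have "basis_mod ?W B"
    using B(2) by (auto simp: basis_mod_def series.independent_mod_def mfps_scale_def[symmetric] series.span_finite)
  moreover have "\<forall>b\<in>B. \<exists>c. d b - mfps_const c * b \<in> ?W"
  proof
    fix b assume "b \<in> B"
    then obtain z where "d b = mfps_scale z b" using B(1) T(2) by blast
    then show "\<exists>c. d b - mfps_const c * b \<in> ?W" by (intro exI[of _ z]) (simp add: mfps_scale_def series.F_0)
  qed
  ultimately show "\<exists>B. basis_mod ?W B \<and> (\<forall>b\<in>B. \<exists>c. d b - mfps_const c * b \<in> ?W)" by blast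
qed

lemma fcalc_semisimple:
  assumes d: "d \<in> max_ideal_Der" and h: "\<And>x y. h (x + y) = h x + h y"
  shows "semisimple (series.fcalc d h)"
proof (rule semisimpleI[OF fcalc_derivation[OF assms]], rule subsetI)
  note T = singular_filtered_endo[OF d]
  fix k p
  let ?G = "{r. \<exists>z. series.fcalc d h r = mfps_scale z r} \<union> max_ideal_pow k"
  obtain L where L: "finite L" "\<And>p. p \<in> max_ideal_pow 0 \<Longrightarrow> p - (\<Sum>z\<in>L. series.eigenproj d z p) \<in> max_ideal_pow k"
    using series.sum_eigenproj[OF T] by metis
  have "(\<Sum>z\<in>L. series.eigenproj d z p) \<in> series.span ?G"
    using series.fcalc_eigenproj[OF T, of p h] by (intro series.span_sum series.span_base) auto
  moreover have "p - (\<Sum>z\<in>L. series.eigenproj d z p) \<in> series.span ?G" using L(2)[of p] by (intro series.span_base) simp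
  ultimately show "p \<in> series.span ?G" using series.span_add by fastforce
qed

lemma semisimple_part_complement:
  assumes d: "d \<in> max_ideal_Der"
  shows "topologically_nilpotent (d - series.fcalc d (\<lambda>z. z))"
proof -
  let ?s = "series.fcalc d (\<lambda>z. z)"
  have "?s \<in> max_ideal_Der" using d by (rule fcalc_derivation) simp
  then have "d - ?s \<in> max_ideal_Der" using d by (auto simp: max_ideal_Der_eq Der_closed max_ideal_eq)
  moreover have "d - ?s = (\<lambda>p. d p - ?s p)" by (simp add: fun_eq_iff)
  ultimately show ?thesis
    using series.semisimple_part_nilpotent[OF singular_filtered_endo[OF d]]
    by (auto simp: topologically_nilpotent_def nilpotent_mod_def)
qed

lemma Der_log_subspace: "der_module.subspace (Der_log f)"
  unfolding der_module.subspace_def Der_log_def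
  by (auto simp: Der_closed) (auto simp: der_scale_def)

lemma Der_log_ideal_stable: "d \<in> Der_log f \<Longrightarrow> f dvd p \<Longrightarrow> f dvd d p"
  by (auto simp: Der_log_def Der_mult elim!: dvdE)

lemma fcalc_Der_log:
  assumes f: "f \<noteq> 0" and d: "d \<in> max_ideal_Der" "d \<in> Der_log f" and h: "\<And>x y. h (x + y) = h x + h y"
  shows "series.fcalc d h \<in> Der_log f"
proof -
  have "series.fcalc d h f \<in> {p. f dvd p}"
    using Der_log_ideal_stable[OF d(2)]
    by (intro series.fcalc_closed_subspace[OF singular_filtered_endo[OF d(1)] closed_principal_ideal[OF f]]) auto
  then show ?thesis using fcalc_derivation[OF d(1) h] by (simp add: Der_log_def max_ideal_Der_eq)
qed

section \<open>Joint eigen-coordinates\<close>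

lemma max_ideal_pow_2_representation:
  assumes "p \<in> max_ideal_pow (Suc (Suc 0))"
  obtains q where "p = (\<Sum>i\<in>UNIV. mfps_X i * q i)" "\<And>i. q i \<in> max_ideal"
proof -
  have c: "mfps_coeff p a = 0" if "total_degree a < Suc (Suc 0)" for a using assms that by (auto simp: max_ideal_pow_eq)
  obtain q where q: "p = (\<Sum>i\<in>UNIV. mfps_X i * q i)"
    "\<And>i a. mfps_coeff (q i) a \<noteq> 0 \<Longrightarrow> mfps_coeff p (a + unit_exponent i) \<noteq> 0"
    using split_off_variables[of p] c[of 0] by (metis (no_types) total_degree_eq_0 zero_less_Suc)
  have "q i \<in> max_ideal" for i
    unfolding max_ideal_eq
  proof (rule CollectI, rule ccontr)
    assume "mfps_coeff (q i) 0 \<noteq> 0"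
    then have "mfps_coeff p (0 + unit_exponent i) \<noteq> 0" by (rule q(2))
    then show False using c[of "0 + unit_exponent i"] by (simp add: total_degree_eq_0[THEN iffD2])
  qed
  then show thesis using that q(1) by blast
qed

lemma inj_mfps_X: "inj (mfps_X :: 'n::finite \<Rightarrow> _)"
proof (rule injI)
  fix i j :: 'n assume "mfps_X i = mfps_X j"
  then have "partial i (mfps_X i) = partial i (mfps_X j)" by simp
  then show "i = j" by (simp add: partial_X split: if_splits)
qed

lemma closed_subspace_max_ideal: "series.closed_subspace max_ideal"
  unfolding series.closed_subspace_def max_ideal_pow_1[symmetric]
proof (intro conjI ballI impI series.subspace_F)
  fix p :: "'n::finite mfps" assume "\<forall>k. \<exists>v\<in>max_ideal_pow (Suc 0). p - v \<in> max_ideal_pow k"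
  then obtain v where "v \<in> max_ideal_pow (Suc 0)" "p - v \<in> max_ideal_pow (Suc 0)" by blast
  then show "p \<in> max_ideal_pow (Suc 0)" using series.F_congruent by blast
qed simp

text \<open>Nakayama's lemma for the maximal ideal.\<close>

lemma formal_coordinatesI:
  assumes "range y \<subseteq> max_ideal" "range mfps_X \<subseteq> series.span (range y \<union> max_ideal_pow (Suc (Suc 0)))"
  shows "formal_coordinates (y :: 'n::finite \<Rightarrow> 'n mfps)"
proof -
  let ?N = "mfps_ideal.span (range y)"
  have m: "mfps_ideal.subspace max_ideal" using max_ideal_pow_subspace[of "Suc 0"] by (simp only: max_ideal_pow_1)
  have "range mfps_X \<subseteq> ?N"
  proof (rule nakayama[OF mfps_ideal.module_axioms mfps_ideal.subspace_span])
    fix a :: "'n mfps" assume "a \<in> range mfps_X"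
    then have "a \<in> series.span (range y \<union> max_ideal_pow (Suc (Suc 0)))" using assms by blast
    then obtain s where s: "s \<in> series.span (range y)" "a - s \<in> max_ideal_pow (Suc (Suc 0))"
      using series.span_Un_subspace[OF series.subspace_F] by blast
    have "series.span (range y) \<subseteq> ?N"
      by (rule series.span_minimal[OF mfps_ideal.span_superset])
        (use mfps_ideal.subspace_span[of "range y"] in \<open>auto simp: series.subspace_def mfps_ideal.subspace_def mfps_scale_def\<close>)
    then have sN: "s \<in> ?N" using s(1) by blast
    obtain q where q: "a - s = (\<Sum>i\<in>UNIV. mfps_X i * q i)" "\<And>i. q i \<in> max_ideal"
      using max_ideal_pow_2_representation[OF s(2)] by metis
    define c where "c b = q (inv mfps_X b)" for b
    have "(\<Sum>b\<in>range mfps_X. c b * b) = (\<Sum>i\<in>UNIV. q i * mfps_X i)"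
      by (simp add: sum.reindex[OF inj_mfps_X] inv_f_f[OF inj_mfps_X] c_def)
    then have "a - (\<Sum>b\<in>range mfps_X. c b * b) = s" using q(1) by (simp add: mult.commute algebra_simps)
    then show "\<exists>c. (\<forall>b\<in>range mfps_X. c b \<in> max_ideal) \<and> a - (\<Sum>b\<in>range mfps_X. c b * b) \<in> ?N"
      using sN q(2) by (intro exI[of _ c]) (auto simp: c_def)
  qed simp
  then have "max_ideal \<subseteq> ?N" unfolding max_ideal_def by (rule mfps_ideal.span_minimal) simp
  moreover have "?N \<subseteq> max_ideal" by (rule mfps_ideal.span_minimal[OF assms(1) m])
  ultimately show ?thesis by (auto simp: formal_coordinates_def)
qed

lemma X_independent_mod: "series.independent_mod (max_ideal_pow (Suc (Suc 0))) (range (mfps_X :: 'n::finite \<Rightarrow> _))"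
  unfolding series.independent_mod_def
proof (intro conjI allI impI ballI)
  fix c :: "'n mfps \<Rightarrow> complex" and v :: "'n mfps"
  assume c: "(\<Sum>v\<in>range mfps_X. mfps_scale (c v) v) \<in> max_ideal_pow (Suc (Suc 0))" and "v \<in> range mfps_X"
  then obtain i where v: "v = mfps_X i" by blast
  have "mfps_coeff (\<Sum>v\<in>range mfps_X. mfps_scale (c v) v) (unit_exponent i) = 0"
    using c by (simp add: max_ideal_pow_eq del: mfps_coeff_sum)
  moreover have "mfps_coeff (mfps_scale (c u) u) (unit_exponent i) = (if u = mfps_X i then c u else 0)"
    if u: "u \<in> range mfps_X" for u
  proof -
    obtain j where j: "u = mfps_X j" using u by blast
    have "unit_exponent i = unit_exponent j \<longleftrightarrow> i = j" by (auto simp: unit_exponent_def fun_eq_iff split: if_splits)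
    moreover have "mfps_X j = mfps_X i \<longleftrightarrow> j = i" using inj_mfps_X by (rule inj_eq)
    ultimately show ?thesis
      by (auto simp: j mfps_scale_def mfps_X.rep_eq unit_exponent_def[symmetric])
  qed
  ultimately show "c v = 0" by (simp add: v)
qed simp

text \<open>Joint eigenvectors span the maximal ideal modulo its square, so a basis of that quotient, which
  has as many elements as there are variables, can be chosen among them.\<close>

lemma joint_eigen_coordinates:
  fixes S :: "('n::finite mfps \<Rightarrow> 'n mfps) set"
  assumes "finite S" "\<And>s. s \<in> S \<Longrightarrow> semisimple s" "\<And>s t. s \<in> S \<Longrightarrow> t \<in> S \<Longrightarrow> lie_bracket s t = 0"
  obtains y w where "formal_coordinates y" "\<And>s j. s \<in> S \<Longrightarrow> s (y j) = mfps_scale (w s j) (y j)"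
    "\<And>j. y j \<notin> max_ideal_pow (Suc (Suc 0))"
proof -
  let ?W = "max_ideal_pow (Suc (Suc 0)) :: 'n mfps set"
  let ?J = "max_ideal \<inter> series.joint_eigenvectors S"
  have "max_ideal \<subseteq> series.span (?J \<union> ?W)"
  proof (rule series.joint_eigenvectors_span[OF assms(1) _ _ closed_subspace_max_ideal])
    show "\<forall>s\<in>S. series.semisimple_op s" using assms(2) semisimple_imp_op by blast
    show "\<forall>s\<in>S. \<forall>t\<in>S. \<forall>p. s (t p) = t (s p)"
    proof (intro ballI allI)
      fix s t p assume "s \<in> S" "t \<in> S"
      from fun_cong[OF assms(3)[OF this], of p] show "s (t p) = t (s p)" by (simp add: lie_bracket_apply)
    qed
    show "\<forall>s\<in>S. \<forall>p\<in>max_ideal. s p \<in> max_ideal"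
      using assms(2) by (simp add: semisimple_def max_ideal_Der_eq)
  qed
  then have XJ: "range mfps_X \<subseteq> series.span (?J \<union> ?W)" using mfps_X_in_max_ideal by blast
  obtain T where T: "finite T" "T \<subseteq> ?J" "range mfps_X \<subseteq> series.span (T \<union> ?W)"
    by (rule series.finite_subset_spanning[OF finite_imageI[OF finite] XJ])
  obtain B where B: "B \<subseteq> {} \<union> T" "series.independent_mod ?W B" "T \<subseteq> series.span (B \<union> ?W)"
    using series.extend_independent_mod[OF series.subspace_F series.independent_mod_empty T(1)] by metis
  have finB: "finite B" using B(2) by (simp add: series.independent_mod_def)
  have XB: "range mfps_X \<subseteq> series.span (B \<union> ?W)" using T(3) series.span_Un_trans[OF B(3)] by blast
  have BX: "B \<subseteq> series.span (range mfps_X \<union> ?W)"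
  proof
    fix b assume "b \<in> B"
    then have "mfps_coeff b 0 = 0" using B T by (auto simp: max_ideal_eq)
    then obtain q where q: "b = (\<Sum>i\<in>UNIV. mfps_X i * q i)" using split_off_variables by metis
    have "mfps_X i * q i = mfps_scale (mfps_coeff (q i) 0) (mfps_X i) + mfps_X i * (q i - mfps_const (mfps_coeff (q i) 0))" for i
      by (simp add: mfps_scale_def algebra_simps)
    moreover have "mfps_X i * (q i - mfps_const (mfps_coeff (q i) 0)) \<in> ?W" for i
      using max_ideal_mult_pow[of _ _ "Suc 0"] mfps_X_in_max_ideal minus_const_in_max_ideal unfolding max_ideal_pow_1 by blast
    moreover have "mfps_scale (mfps_coeff (q i) 0) (mfps_X i) + w \<in> series.span (range mfps_X \<union> ?W)"
      if "w \<in> ?W" for i w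
      using that by (intro series.span_add series.span_scale) (auto intro: series.span_base)
    ultimately have "mfps_X i * q i \<in> series.span (range mfps_X \<union> ?W)" for i by presburger
    then show "b \<in> series.span (range mfps_X \<union> ?W)" unfolding q by (rule series.span_sum)
  qed
  have "card B = card (range (mfps_X :: 'n \<Rightarrow> _))"
    using series.card_independent_mod_le[OF series.subspace_F _ B(2) BX]
      series.card_independent_mod_le[OF series.subspace_F finB X_independent_mod XB] by auto
  then have "card B = CARD('n)" by (simp add: card_image[OF inj_mfps_X])
  then obtain y :: "'n \<Rightarrow> 'n mfps" where "bij_betw y UNIV B"
    using finB finite_same_card_bij[of "UNIV :: 'n set" B] by auto
  then have y: "range y = B" by (simp add: bij_betw_def)
  have "formal_coordinates y" using B(1) T(2) XB by (intro formal_coordinatesI) (auto simp: y)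
  moreover define w where "w s j = (SOME z. s (y j) = mfps_scale z (y j))" for s j
  have "s (y j) = mfps_scale (w s j) (y j)" if "s \<in> S" for s j
  proof -
    have "y j \<in> series.joint_eigenvectors S" using y B(1) T(2) by blast
    then have "\<exists>z. s (y j) = mfps_scale z (y j)" using that unfolding series.joint_eigenvectors_def by blast
    then show ?thesis unfolding w_def by (rule someI_ex)
  qed
  moreover have "y j \<notin> ?W" for j
  proof
    assume "y j \<in> ?W"
    then have "y j \<in> series.span ((B - {y j}) \<union> ?W)" by (intro series.span_base) simp
    then show False using series.independent_mod_not_in_span[OF series.subspace_F B(2)] y by blast
  qed
  ultimately show thesis using that by blast
qed

section \<open>Derivations that are diagonal in a coordinate system\<close>

text \<open>If \<open>X = C Y\<close> with a matrix \<open>C\<close> of series, then \<open>C\<close> times the Jacobian matrix of \<open>y\<close> is the identity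
  at the origin. The constant terms of \<open>C\<close> thus give derivations that are dual to \<open>y\<close> modulo the
  maximal ideal, and Nakayama's lemma makes them dual.\<close>

lemma coordinate_derivations_exist:
  fixes y :: "'n::finite \<Rightarrow> 'n mfps"
  assumes y: "formal_coordinates y"
  obtains E where "\<And>j. E j \<in> Der" "\<And>i j. E j (y i) = (if i = j then 1 else 0)"
proof -
  let ?scale = "\<lambda>a (v :: 'n \<Rightarrow> 'n mfps) i. a * v i"
  have mod: "module ?scale" by unfold_locales (auto simp: fun_eq_iff algebra_simps)
  interpret vec: module ?scale by (rule mod)
  let ?N = "(\<lambda>d i. d (y i)) ` Der"
  let ?e = "\<lambda>(j :: 'n) i. if i = j then 1 else 0 :: 'n mfps"
  have N: "vec.subspace ?N"
    unfolding vec.subspace_def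
  proof (intro conjI ballI allI)
    show "0 \<in> ?N" using Der_closed(1) by (intro image_eqI[of _ _ 0]) auto
    fix u assume "u \<in> ?N"
    then obtain d where d: "d \<in> Der" "u = (\<lambda>i. d (y i))" by blast
    show "?scale a u \<in> ?N" for a
      using Der_closed(4)[OF d(1), of a] by (intro image_eqI[of _ _ "der_scale a d"]) (auto simp: d der_scale_def)
    fix v assume "v \<in> ?N"
    then obtain e where e: "e \<in> Der" "v = (\<lambda>i. e (y i))" by blast
    show "u + v \<in> ?N" using Der_closed(2)[OF d(1) e(1)] by (intro image_eqI[of _ _ "d + e"]) (auto simp: d e)
  qed
  have "\<exists>c. mfps_X l = (\<Sum>i\<in>UNIV. c i * y i)" for l
  proof -
    have "mfps_X l \<in> mfps_ideal.span (range y)" using y mfps_X_in_max_ideal by (auto simp: formal_coordinates_def)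
    then show ?thesis
    proof (induction rule: mfps_ideal.span_induct_alt)
      case base
      then show ?case by (intro exI[of _ "\<lambda>_. 0"]) simp
    next
      case (step r x p)
      then obtain j c where "x = y j" "p = (\<Sum>i\<in>UNIV. c i * y i)" by blast
      moreover have "(\<Sum>i\<in>UNIV. (c i + (if i = j then r else 0)) * y i) = r * y j + (\<Sum>i\<in>UNIV. c i * y i)"
      proof -
        have "(\<Sum>i\<in>UNIV. (c i + (if i = j then r else 0)) * y i) = (\<Sum>i\<in>UNIV. c i * y i + (if i = j then r * y j else 0))"
          by (intro sum.cong) (auto simp: algebra_simps)
        then show ?thesis by (simp add: sum.distrib add.commute)
      qed
      ultimately show ?case by (intro exI[of _ "\<lambda>i. c i + (if i = j then r else 0)"]) simp
    qed
  qed
  then obtain c where c: "\<And>l. mfps_X l = (\<Sum>i\<in>UNIV. c l i * y i)" by metis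
  define C :: "complex^'n^'n" where "C = (\<chi> l i. mfps_coeff (c l i) 0)"
  define J :: "complex^'n^'n" where "J = (\<chi> i k. mfps_coeff (partial k (y i)) 0)"
  have y0: "mfps_coeff (y i) 0 = 0" for i
    using y mfps_ideal.span_base[of "y i" "range y"] by (auto simp: formal_coordinates_def max_ideal_eq)
  have "C ** J = mat 1"
  proof (rule vec_eq_iff[THEN iffD2], intro allI, rule vec_eq_iff[THEN iffD2], intro allI)
    fix l k
    have "partial k (mfps_X l) = (\<Sum>i\<in>UNIV. c l i * partial k (y i) + y i * partial k (c l i))"
      unfolding c[of l] by (simp add: Der_sum[OF partial_Der] Der_mult[OF partial_Der])
    then have "mfps_coeff (partial k (mfps_X l)) 0 = (\<Sum>i\<in>UNIV. mfps_coeff (c l i) 0 * mfps_coeff (partial k (y i)) 0)"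
      by (simp add: y0)
    then show "(C ** J) $ l $ k = mat 1 $ l $ k"
      by (auto simp: C_def J_def matrix_matrix_mult_def mat_def partial_X)
  qed
  then have JC: "J ** C = mat 1" by (simp add: matrix_left_right_inverse)
  \<comment> \<open>These derivations are dual to \<open>y\<close> modulo the maximal ideal.\<close>
  define D where "D l = (\<Sum>k\<in>UNIV. der_scale (mfps_const (C $ k $ l)) (partial k))" for l
  have D: "D l \<in> Der" for l unfolding D_def by (intro Der_closed partial_Der)
  have D0: "mfps_coeff (D l (y i)) 0 = (if i = l then 1 else 0)" for i l
  proof -
    have "mfps_coeff (D l (y i)) 0 = (J ** C) $ i $ l"
      by (simp add: D_def sum_fun_apply der_scale_def matrix_matrix_mult_def J_def mult.commute)
    then show ?thesis by (simp add: JC mat_def)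
  qed
  have inj_e: "inj ?e"
  proof (rule injI)
    fix i j assume "?e i = ?e j"
    from fun_cong[OF this, of i] show "i = j" by (simp split: if_splits)
  qed
  have "range ?e \<subseteq> ?N"
  proof (rule nakayama[OF mod N])
    fix a assume "a \<in> range ?e"
    then obtain l where l: "a = ?e l" by blast
    define r where "r b = (?e l (inv ?e b) - D l (y (inv ?e b)))" for b
    have "(\<Sum>b\<in>range ?e. ?scale (r b) b) = (\<lambda>i. ?e l i - D l (y i))"
    proof
      fix i
      have "(\<Sum>b\<in>range ?e. ?scale (r b) b) i = (\<Sum>j\<in>UNIV. r (?e j) * ?e j i)"
        by (simp add: sum.reindex[OF inj_e] sum_fun_apply)
      also have "\<dots> = (\<Sum>j\<in>UNIV. if j = i then r (?e j) else 0)" by (intro sum.cong) auto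
      also have "\<dots> = ?e l i - D l (y i)" by (simp add: r_def inv_f_f[OF inj_e])
      finally show "(\<Sum>b\<in>range ?e. ?scale (r b) b) i = ?e l i - D l (y i)" .
    qed
    then have "a - (\<Sum>b\<in>range ?e. ?scale (r b) b) = (\<lambda>i. D l (y i))" by (auto simp: l fun_eq_iff)
    moreover have "r b \<in> max_ideal" for b by (auto simp: r_def max_ideal_eq D0)
    ultimately show "\<exists>r. (\<forall>b\<in>range ?e. r b \<in> max_ideal) \<and> a - (\<Sum>b\<in>range ?e. ?scale (r b) b) \<in> ?N"
      using D by (intro exI[of _ r]) auto
  qed simp
  then have "\<forall>j. \<exists>d\<in>Der. ?e j = (\<lambda>i. d (y i))" by blast
  then obtain E where "\<And>j. E j \<in> Der" "\<And>j. ?e j = (\<lambda>i. E j (y i))" by metis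
  then show thesis using that[of E] by (metis (no_types, lifting))
qed

lemma coord_deriv:
  assumes y: "formal_coordinates y"
  shows "coord_deriv y j \<in> Der" "coord_deriv y j (y i) = (if i = j then 1 else 0)"
proof -
  obtain E where E: "\<And>j. E j \<in> Der" "\<And>i j. E j (y i) = (if i = j then 1 else 0)"
    using coordinate_derivations_exist[OF y] by blast
  have "\<exists>!d. d \<in> Der \<and> (\<forall>i. d (y i) = (if i = j then 1 else 0))"
    using E by (intro ex1I[of _ "E j"]) (auto intro: Der_eqI[OF _ _ y])
  from theI'[OF this] show "coord_deriv y j \<in> Der" "coord_deriv y j (y i) = (if i = j then 1 else 0)"
    unfolding coord_deriv_def by auto
qed

lemma Der_coordinate_expansion:
  assumes y: "formal_coordinates y" and d: "d \<in> Der"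
  shows "d = (\<Sum>j\<in>UNIV. der_scale (d (y j)) (coord_deriv y j))"
proof (rule Der_eqI[OF d _ y])
  show "(\<Sum>j\<in>UNIV. der_scale (d (y j)) (coord_deriv y j)) \<in> Der" by (intro Der_closed coord_deriv(1)[OF y])
  show "d (y i) = (\<Sum>j\<in>UNIV. der_scale (d (y j)) (coord_deriv y j)) (y i)" for i
    by (simp add: sum_fun_apply der_scale_def coord_deriv(2)[OF y] if_distrib cong: if_cong)
qed

text \<open>The span of the eigenvectors with eigenvalues in the additive monoid \<open>L\<close> is a subalgebra, since
  eigenvalues add up in products, and it contains the coordinates.\<close>

lemma eigenvectors_dense:
  fixes y :: "'n::finite \<Rightarrow> 'n mfps"
  assumes y: "formal_coordinates y" and d: "d \<in> Der" "\<And>j. d (y j) = mfps_scale (w j) (y j)"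
    and L: "0 \<in> L" "\<And>a b. a \<in> L \<Longrightarrow> b \<in> L \<Longrightarrow> a + b \<in> L" "\<And>j. w j \<in> L"
  shows "UNIV \<subseteq> series.span ({q. \<exists>z\<in>L. d q = mfps_scale z q} \<union> max_ideal_pow k)"
proof (induction k)
  case 0
  then show ?case by (auto intro: series.span_base)
next
  case (Suc k)
  let ?R = "{q. \<exists>z\<in>L. d q = mfps_scale z q}"
  let ?S = "series.span (?R \<union> max_ideal_pow (Suc k))"
  have yS: "p * y j \<in> ?S" for p j
  proof -
    have "y j * p \<in> ?S"
    proof (rule series.endo_span[OF series_endo_mult])
      show "p \<in> series.span (?R \<union> max_ideal_pow k)" using Suc by blast
      show "y j * a \<in> ?S" if "a \<in> ?R \<union> max_ideal_pow k" for a
        using that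
      proof
        assume "a \<in> ?R"
        then obtain z where z: "z \<in> L" "d a = mfps_scale z a" by blast
        have "d (y j * a) = mfps_scale (z + w j) (y j * a)"
          by (simp add: Der_mult[OF d(1)] d(2) z mfps_scale_def mfps_const_simps algebra_simps)
        then show ?thesis using L z by (intro series.span_base) blast
      next
        assume a: "a \<in> max_ideal_pow k"
        have "y j \<in> max_ideal" using y mfps_ideal.span_base[of "y j" "range y"] by (auto simp: formal_coordinates_def)
        then show ?thesis using max_ideal_mult_pow[OF _ a] by (intro series.span_base) blast
      qed
    qed (rule series.subspace_span)
    then show ?thesis by (simp add: mult.commute)
  qed
  have "p \<in> ?S" for p
  proof -
    let ?c = "mfps_coeff p 0"
    have "p - mfps_const ?c \<in> mfps_ideal.span (range y)"
      using y minus_const_in_max_ideal by (auto simp: formal_coordinates_def)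
    then have "p - mfps_const ?c \<in> ?S"
    proof (induction rule: mfps_ideal.span_induct_alt)
      case base
      then show ?case by (rule series.span_zero)
    next
      case (step r x q)
      then show ?case using yS by (auto intro: series.span_add)
    qed
    moreover have "d (mfps_const ?c) = mfps_scale 0 (mfps_const ?c)" by (simp add: Der_const[OF d(1)] mfps_scale_def mfps_const_simps)
    then have "mfps_const ?c \<in> ?S" using L(1) by (intro series.span_base) blast
    ultimately show ?thesis using series.span_add by fastforce
  qed
  then show ?case by blast
qed

text \<open>The functional calculus for the indicator function of \<open>L\<close> is the identity on a dense subspace,
  hence everywhere, but it maps an eigenvector with eigenvalue outside \<open>L\<close> to 0.\<close>

lemma diagonal_eigenvalue_in:
  fixes y :: "'n::finite \<Rightarrow> 'n mfps"
  assumes y: "formal_coordinates y" and d: "d \<in> max_ideal_Der" "\<And>j. d (y j) = mfps_scale (w j) (y j)"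
    and L: "0 \<in> L" "\<And>a b. a \<in> L \<Longrightarrow> b \<in> L \<Longrightarrow> a + b \<in> L" "\<And>j. w j \<in> L"
    and g: "g \<noteq> 0" "d g = mfps_scale z g"
  shows "z \<in> L"
proof (rule ccontr)
  assume z: "z \<notin> L"
  note T = singular_filtered_endo[OF d(1)]
  have dD: "d \<in> Der" using d(1) by (simp add: max_ideal_Der_eq)
  define h where "h x = (if x \<in> L then 1 else 0 :: complex)" for x
  have "series.fcalc d h p - p \<in> max_ideal_pow k" for p k
  proof -
    have "p \<in> series.span ({q. \<exists>z\<in>L. d q = mfps_scale z q} \<union> max_ideal_pow k)"
      using eigenvectors_dense[OF y dD d(2) L] by blast
    then show ?thesis
    proof (induction rule: series.span_induct_alt)
      case base
      then show ?case using series.fcalc_scale[OF T, of 0 h 0] by (simp add: series.F_0)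
    next
      case (step c x q)
      have "series.fcalc d h x - x \<in> max_ideal_pow k"
      proof (cases "x \<in> max_ideal_pow k")
        case True
        then show ?thesis using series.fcalc_F[OF T] series.F_diff by blast
      next
        case False
        then obtain l where "l \<in> L" "d x = mfps_scale l x" using step(1) by blast
        then show ?thesis using series.fcalc_eigenvector[OF T, of x l h] by (simp add: h_def series.F_0)
      qed
      from series.F_add[OF series.F_scale[OF this, of c] step(2)]
      show ?case by (simp add: series.fcalc_add[OF T] series.fcalc_scale[OF T] series.scale_right_diff_distrib algebra_simps)
    qed
  qed
  then have "series.fcalc d h g = g" by (rule series.F_eqI)
  moreover have "series.fcalc d h g = 0" using series.fcalc_eigenvector[OF T _ g(2), of h] z by (simp add: h_def)
  ultimately show False using g(1) by simp
qed

lemma lie_bracket_endo: "d \<in> Der \<Longrightarrow> derivs.endo (lie_bracket d)"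
  by (rule derivs.endoI)
    (auto simp: fun_eq_iff lie_bracket_apply Der_add Der_mult Der_const der_cscale_def der_scale_def algebra_simps)

lemma lie_bracket_filtered_endo:
  assumes d: "d \<in> max_ideal_Der"
  shows "derivs.filtered_endo (lie_bracket d)"
proof -
  have dD: "d \<in> Der" using d by (simp add: max_ideal_Der_eq)
  have "lie_bracket d e \<in> Der_filtration k" if e: "e \<in> Der_filtration k" for e k
  proof -
    have "d (e p) - e (d p) \<in> max_ideal_pow k" for p
      using singular_filtered_endo[OF d] e by (intro series.F_diff) (auto simp: series.filtered_endo_def Der_filtration_def)
    then show ?thesis using e dD by (auto simp: Der_filtration_def lie_bracket_Der lie_bracket_apply)
  qed
  then show ?thesis using lie_bracket_endo[OF dD] by (simp add: derivs.filtered_endo_def)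
qed

text \<open>If \<open>x\<close> is an eigenvector of \<open>d\<close> for \<open>z\<close>, then \<open>x \<partial>/\<partial>y\<^sub>j\<close> is an eigenvector of the bracket with \<open>d\<close>
  for \<open>z - w j\<close>.\<close>

lemma lie_bracket_semisimple_op:
  fixes y :: "'n::finite \<Rightarrow> 'n mfps"
  assumes y: "formal_coordinates y" and d: "d \<in> max_ideal_Der" "\<And>j. d (y j) = mfps_scale (w j) (y j)"
  shows "derivs.semisimple_op (lie_bracket d)"
proof (rule derivs.semisimple_opI[OF lie_bracket_filtered_endo[OF d(1)]])
  fix k and e :: "'n mfps \<Rightarrow> 'n mfps" assume "e \<in> Der_filtration 0"
  then have e: "e \<in> Der" by (simp add: Der_filtration_0)
  have dD: "d \<in> Der" using d(1) by (simp add: max_ideal_Der_eq)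
  let ?G = "{r \<in> Der_filtration 0. \<exists>z. lie_bracket d r - der_cscale z r \<in> Der_filtration k} \<union> Der_filtration k"
  note E = coord_deriv[OF y]
  have "der_scale q (coord_deriv y j) \<in> derivs.span ?G" for q j
  proof -
    have "q \<in> series.span ({q. \<exists>z\<in>UNIV. d q = mfps_scale z q} \<union> max_ideal_pow k)"
      using eigenvectors_dense[OF y dD d(2), of UNIV k] by blast
    then show ?thesis
    proof (induction rule: series.span_induct_alt)
      case base
      then show ?case using derivs.span_zero by (simp add: der_scale_def zero_fun_def)
    next
      case (step c x q)
      have xD: "der_scale x (coord_deriv y j) \<in> Der" by (intro Der_closed E)
      have "der_scale x (coord_deriv y j) \<in> ?G"
      proof (cases "x \<in> max_ideal_pow k")
        case True
        then have "der_scale x (coord_deriv y j) \<in> Der_filtration k"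
          using xD max_ideal_pow_mult_left[OF True] by (auto simp: Der_filtration_def) (simp add: der_scale_def mult.commute[of x])
        then show ?thesis ..
      next
        case False
        then obtain z where z: "d x = mfps_scale z x" using step(1) by blast
        have "lie_bracket d (der_scale x (coord_deriv y j)) = der_cscale (z - w j) (der_scale x (coord_deriv y j))"
        proof (rule Der_eqI[OF _ _ y])
          show "lie_bracket d (der_scale x (coord_deriv y j)) \<in> Der" by (rule lie_bracket_Der[OF dD xD])
          show "der_cscale (z - w j) (der_scale x (coord_deriv y j)) \<in> Der"
            unfolding der_cscale_def by (rule Der_closed(4)[OF xD])
          show "lie_bracket d (der_scale x (coord_deriv y j)) (y i) = der_cscale (z - w j) (der_scale x (coord_deriv y j)) (y i)" for i
            by (simp add: lie_bracket_apply der_cscale_def der_scale_def E d(2) z mfps_scale_def Der_mult[OF E(1)] Der_const[OF E(1)]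
                Der_0[OF dD] mfps_const_simps algebra_simps)
        qed
        then have "lie_bracket d (der_scale x (coord_deriv y j)) - der_cscale (z - w j) (der_scale x (coord_deriv y j)) \<in> Der_filtration k"
          by (simp add: derivs.F_0)
        then show ?thesis using xD unfolding Der_filtration_0 by blast
      qed
      then have "der_cscale c (der_scale x (coord_deriv y j)) + der_scale q (coord_deriv y j) \<in> derivs.span ?G"
        by (intro derivs.span_add[OF derivs.span_scale[OF derivs.span_base] step(2)])
      moreover have "der_cscale c (der_scale x (coord_deriv y j)) + der_scale q (coord_deriv y j) = der_scale (mfps_scale c x + q) (coord_deriv y j)"
        by (simp add: fun_eq_iff der_cscale_def der_scale_def mfps_scale_def algebra_simps)
      ultimately show ?case by (simp only:)
    qed
  qed
  from derivs.span_sum[OF this] show "e \<in> derivs.span ?G"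
    by (subst Der_coordinate_expansion[OF y e])
qed

text \<open>The derivation \<open>v\<close> moves the generalised eigenspace of \<open>s\<close> for \<open>z\<close> to the one for \<open>z + c\<close>. As the
  quotient by the \<open>k\<close>-th power of the maximal ideal has finitely many eigenvalues, iterating \<open>v\<close>
  leads to 0.\<close>

lemma nonzero_weight_topologically_nilpotent:
  assumes s: "s \<in> max_ideal_Der" and v: "v \<in> max_ideal_Der" and c: "c \<noteq> 0"
    and br: "lie_bracket s v = der_cscale c v"
  shows "topologically_nilpotent v"
  unfolding topologically_nilpotent_def nilpotent_mod_def
proof (intro conjI v allI)
  fix k
  note T = singular_filtered_endo[OF s]
  have vD: "v \<in> Der" using v by (simp add: max_ideal_Der_eq)
  have E: "series.endo s" and Ev: "series.endo v" using s v by (auto simp: max_ideal_Der_eq intro: Der_endo)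
  have vF: "(v ^^ n) p \<in> max_ideal_pow k" if "p \<in> max_ideal_pow k" for p n
    using that singular_filtered_endo[OF v] by (induction n) (auto simp: series.filtered_endo_def)
  obtain L N where L: "finite L" "\<And>p. p \<in> max_ideal_pow 0 \<Longrightarrow> series.poly_op s (\<Prod>x\<in>L. [:- x, 1:] ^ N) p \<in> max_ideal_pow k"
    using series.annihilating_poly[OF T] by metis
  have comm: "s (v p) - mfps_scale (z + c) (v p) = v (s p - mfps_scale z p)" for p z
    using fun_cong[OF br, of p] by (simp add: lie_bracket_apply der_cscale_def der_scale_def mfps_scale_def
      mfps_const_simps Der_diff[OF vD] Der_mult[OF vD] Der_const[OF vD] algebra_simps)
  have pow: "series.poly_op s ([:- (z + c), 1:] ^ n) (v p) = v (series.poly_op s ([:- z, 1:] ^ n) p)" for n z p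
  proof (induction n arbitrary: p)
    case (Suc n)
    then show ?case
      by (simp only: power_Suc2 series.poly_op_mult[OF E] series.poly_op_linear_factor[OF E] comm)
  qed (simp add: series.poly_op_1[OF E])
  have gen: "(v ^^ n) r \<in> series.gen_eigen s k (z + of_nat n * c)" if r: "r \<in> series.gen_eigen s k z" for r z n
  proof (induction n)
    case (Suc n)
    then obtain m where "series.poly_op s ([:- (z + of_nat n * c), 1:] ^ m) ((v ^^ n) r) \<in> max_ideal_pow k"
      by (auto simp: series.gen_eigen_def)
    then have "series.poly_op s ([:- (z + of_nat n * c + c), 1:] ^ m) (v ((v ^^ n) r)) \<in> max_ideal_pow k"
      using vF[of _ 1] by (simp only: pow) simp
    then show ?case by (auto simp: series.gen_eigen_def algebra_simps)
  qed (use r in simp)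
  have zero: "r \<in> max_ideal_pow k" if r: "r \<in> series.gen_eigen s k z" "z \<notin> L" for r z
  proof -
    \<comment> \<open>The zero polynomial interpolates, on \<open>L\<close>, the function that is 1 outside of \<open>L\<close>.\<close>
    have "[:- x, 1:] ^ N dvd 0 - [:if x \<in> L then 0 else 1:]" if "x \<in> L" for x using that by simp
    from series.interpolation_on_gen_eigen[OF T L this r(1)]
    have "series.poly_op s 0 r - mfps_scale 1 r \<in> max_ideal_pow k" using r(2) by simp
    then show ?thesis using series.F_sym[of 0 r k] by (simp add: series.poly_op_0[OF E])
  qed
  have "\<exists>n. z + of_nat n * c \<notin> L" for z
  proof (rule ccontr)
    assume "\<not> ?thesis"
    then have "range (\<lambda>n. z + of_nat n * c) \<subseteq> L" by auto
    moreover have "inj (\<lambda>n :: nat. z + of_nat n * c)" using c by (auto simp: inj_def)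
    ultimately show False using L(1) by (meson finite_subset infinite_UNIV_nat finite_imageD)
  qed
  then obtain n where n: "\<And>z. z + of_nat (n z) * c \<notin> L" by metis
  define M where "M = (\<Sum>z\<in>L. n z)"
  have nil: "(v ^^ M) r \<in> max_ideal_pow k" if r: "r \<in> series.gen_eigen s k z" for r z
  proof (cases "z \<in> L")
    case True
    then have "n z \<le> M" using L(1) by (auto simp: M_def intro: member_le_sum)
    then have "(v ^^ M) r = (v ^^ (M - n z)) ((v ^^ n z) r)" by (metis funpow_add comp_apply le_add_diff_inverse2)
    then show ?thesis using zero[OF gen[OF r] n] vF by simp
  next
    case False
    then show ?thesis using zero[OF r] vF by blast
  qed
  have lin: "(v ^^ n) (mfps_scale c a + b) = mfps_scale c ((v ^^ n) a) + (v ^^ n) b" for n a b c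
    by (induction n) (simp_all add: series.endo_add[OF Ev] series.endo_scale[OF Ev])
  have "(v ^^ M) p \<in> max_ideal_pow k" for p
    by (rule series.gen_eigen_induct[OF T, of p k])
      (simp_all add: nil vF lin series.F_0 series.F_add series.F_scale)
  then show "\<exists>N. \<forall>p. (v ^^ N) p \<in> max_ideal_pow k" by blast
qed

section \<open>Commuting semisimple logarithmic derivations\<close>

lemma lie_bracket_diagonal:
  assumes y: "formal_coordinates y" and "s \<in> Der" "t \<in> Der"
    and "\<And>j. s (y j) = mfps_scale (v j) (y j)" "\<And>j. t (y j) = mfps_scale (w j) (y j)"
  shows "lie_bracket s t = 0"
  by (rule Der_eq_0I[OF lie_bracket_Der y])
    (use assms in \<open>simp_all add: lie_bracket_apply mfps_scale_def Der_mult Der_const mult_ac\<close>)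

text \<open>All derivations are logarithmic along 0, and the partial derivatives are not singular.\<close>

lemma Der_log_singular_nonzero:
  assumes "Der_log f \<subseteq> max_ideal_Der"
  shows "f \<noteq> (0 :: 'n::finite mfps)"
proof
  assume "f = 0"
  fix i :: 'n
  have "partial i \<in> Der_log f" using partial_Der[of i] by (simp add: Der_log_def \<open>f = 0\<close> Der_0)
  then have "partial i (mfps_X i) \<in> max_ideal" using assms by (auto simp: max_ideal_Der_eq)
  then show False by (simp add: partial_X one_not_in_max_ideal)
qed

lemma Der_log_lie_bracket: "s \<in> Der_log f \<Longrightarrow> t \<in> Der_log f \<Longrightarrow> lie_bracket s t \<in> Der_log f"
  using Der_log_ideal_stable[of s f "t f"] Der_log_ideal_stable[of t f "s f"]
  by (auto simp: Der_log_def lie_bracket_Der lie_bracket_apply intro: dvd_diff)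

definition toral :: "'n::finite mfps \<Rightarrow> ('n mfps \<Rightarrow> 'n mfps) set \<Rightarrow> bool" where
  "toral f S \<longleftrightarrow> finite S \<and> S \<subseteq> Der_log f \<and> (\<forall>s\<in>S. semisimple s) \<and> (\<forall>s\<in>S. \<forall>t\<in>S. lie_bracket s t = 0)"

lemma toral_coordinates:
  assumes "toral f S"
  shows "\<exists>y w. formal_coordinates y \<and> (\<forall>s\<in>S. \<forall>j. s (y j) = mfps_scale (w s j) (y j)) \<and>
    (\<forall>j. y j \<notin> max_ideal_pow (Suc (Suc 0)))"
proof -
  have S: "finite S" "\<And>s. s \<in> S \<Longrightarrow> semisimple s" "\<And>s t. s \<in> S \<Longrightarrow> t \<in> S \<Longrightarrow> lie_bracket s t = 0"
    using assms unfolding toral_def by blast+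
  show ?thesis
    by (rule joint_eigen_coordinates[of S]) (use S in blast)+
qed

context
  fixes f :: "'n::finite mfps"
  assumes singular: "Der_log f \<subseteq> max_ideal_Der"
begin

lemma f_nonzero: "f \<noteq> 0"
  using Der_log_singular_nonzero[OF singular] .

lemma Der_log_Der: "Der_log f \<subseteq> Der"
  by (auto simp: Der_log_def)

abbreviation "max_ideal_Der_log \<equiv> max_ideal_times (Der_log f)"

text \<open>The hypothesis that logarithmic derivations are singular enters here: their products with the
  maximal ideal have no linear part, so that a nonzero diagonal derivation is not among them.\<close>

lemma max_ideal_times_order:
  assumes "d \<in> max_ideal_Der_log"
  shows "d p \<in> max_ideal_pow (Suc (Suc 0))"
  using assms unfolding max_ideal_times_def
proof (induction rule: der_module.span_induct_alt)
  case base
  then show ?case by (simp add: series.F_0)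
next
  case (step c x y)
  then obtain a e where ae: "x = der_scale a e" "a \<in> max_ideal" "e \<in> Der_log f" by blast
  then have "e p \<in> max_ideal_pow (Suc 0)" using singular by (auto simp: max_ideal_Der_eq max_ideal_pow_1)
  then have "x p \<in> max_ideal_pow (Suc (Suc 0))" using ae max_ideal_mult_pow by (simp add: der_scale_def)
  then show ?case using step(2) by (simp add: der_scale_def series.F_add max_ideal_pow_mult_left)
qed

text \<open>In joint eigen-coordinates \<open>y\<close> the combination is diagonal. It maps each \<open>y j\<close> into the square of
  the maximal ideal, which does not contain \<open>y j\<close>; hence all its weights vanish.\<close>

lemma toral_combination_zero:
  assumes S: "toral f S" and D: "(\<Sum>s\<in>S. der_cscale (c s) s) \<in> max_ideal_Der_log"
  shows "(\<Sum>s\<in>S. der_cscale (c s) s) = 0"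
proof -
  obtain y w where y: "formal_coordinates y" "\<And>s j. s \<in> S \<Longrightarrow> s (y j) = mfps_scale (w s j) (y j)"
    "\<And>j. y j \<notin> max_ideal_pow (Suc (Suc 0))"
    using toral_coordinates[OF S] by blast
  let ?D = "\<Sum>s\<in>S. der_cscale (c s) s"
  have DD: "?D \<in> Der"
    unfolding der_cscale_def using S Der_log_Der by (intro Der_closed) (auto simp: toral_def)
  have "?D (y j) = 0" for j
  proof -
    let ?l = "\<Sum>s\<in>S. c s * w s j"
    have eq: "?D (y j) = mfps_scale ?l (y j)"
      by (simp add: sum_fun_apply der_cscale_def der_scale_def series.scale_sum_left y(2) mult.commute)
        (simp add: mfps_scale_def mfps_const_simps mult_ac)
    have "?l = 0"
    proof (rule ccontr)
      assume l: "?l \<noteq> 0"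
      have "mfps_scale ?l (y j) \<in> max_ideal_pow (Suc (Suc 0))" using max_ideal_times_order[OF D, of "y j"] eq by simp
      then have "mfps_scale (inverse ?l) (mfps_scale ?l (y j)) \<in> max_ideal_pow (Suc (Suc 0))" by (rule series.F_scale)
      then show False using l y(3) by simp
    qed
    then show ?thesis using eq by simp
  qed
  then show ?thesis by (rule Der_eq_0I[OF DD y(1)])
qed

lemma toral_subset: "toral f S \<Longrightarrow> T \<subseteq> S \<Longrightarrow> toral f T"
  unfolding toral_def by (meson finite_subset subset_eq)

text \<open>The maximum of a set of numbers means what it says only if the set is finite and not empty.\<close>

lemma max_commuting_semisimple_set:
  fixes X defines "X \<equiv> {card S |S G. minimal_generating_set (Der_log f) G \<and> S \<subseteq> G \<and>
                       (\<forall>\<sigma>\<in>S. semisimple \<sigma>) \<and> (\<forall>\<sigma>\<in>S. \<forall>\<tau>\<in>S. lie_bracket \<sigma> \<tau> = 0)}"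
  shows "finite X" "X \<noteq> {}"
proof -
  note M = Der_log_subspace[of f] Der_log_Der
  obtain m where m: "\<And>S. S \<subseteq> Der_log f \<Longrightarrow> derivs.independent_mod max_ideal_Der_log S \<Longrightarrow> card S \<le> m"
    using independent_mod_card_bounded[OF M] by blast
  have "X \<subseteq> {..m}"
  proof
    fix n assume "n \<in> X"
    then obtain S G where S: "n = card S" "minimal_generating_set (Der_log f) G" "S \<subseteq> G" unfolding X_def by blast
    have "finite S" using finite_minimal_generating_set[OF M S(2)] S(3) finite_subset by blast
    then show "n \<in> {..m}"
      using m[of S] minimal_generating_set_independent_mod[OF M S(2) _ S(3)] minimal_generating_set_subset[OF M S(2)] S by auto
  qed
  then show "finite X" using finite_subset by blast
  have "Der_log f \<subseteq> derivs.span (Der_log f \<union> max_ideal_Der_log)" using derivs.span_superset by blast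
  then obtain B where "minimal_generating_set (Der_log f) B"
    using extend_to_minimal_generating_set[OF M empty_subsetI derivs.independent_mod_empty subset_refl] by metis
  then have "card ({} :: ('n mfps \<Rightarrow> 'n mfps) set) \<in> X" unfolding X_def by blast
  then show "X \<noteq> {}" by blast
qed

lemma toral_card_le:
  assumes S: "toral f S" "derivs.independent_mod max_ideal_Der_log S"
  shows "card S \<le> max_commuting_semisimple f"
proof -
  note M = Der_log_subspace[of f] Der_log_Der
  have SM: "S \<subseteq> Der_log f" using S by (simp add: toral_def)
  have "Der_log f \<subseteq> derivs.span (Der_log f \<union> max_ideal_Der_log)" using derivs.span_superset by blast
  then obtain B where "S \<subseteq> B" "minimal_generating_set (Der_log f) B"
    using extend_to_minimal_generating_set[OF M SM S(2) subset_refl] by metis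
  then show ?thesis
    unfolding max_commuting_semisimple_def using S(1)
    by (intro Max_ge max_commuting_semisimple_set) (auto simp: toral_def)
qed

lemma maximal_toral_exists:
  obtains S where "toral f S" "derivs.independent_mod max_ideal_Der_log S" "card S = max_commuting_semisimple f"
proof -
  note M = Der_log_subspace[of f] Der_log_Der
  have "max_commuting_semisimple f \<in> {card S |S G. minimal_generating_set (Der_log f) G \<and> S \<subseteq> G \<and>
                       (\<forall>\<sigma>\<in>S. semisimple \<sigma>) \<and> (\<forall>\<sigma>\<in>S. \<forall>\<tau>\<in>S. lie_bracket \<sigma> \<tau> = 0)}"
    unfolding max_commuting_semisimple_def by (rule Max_in[OF max_commuting_semisimple_set])
  then obtain S G where S: "max_commuting_semisimple f = card S" "minimal_generating_set (Der_log f) G" "S \<subseteq> G"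
    "\<forall>\<sigma>\<in>S. semisimple \<sigma>" "\<forall>\<sigma>\<in>S. \<forall>\<tau>\<in>S. lie_bracket \<sigma> \<tau> = 0" by blast
  have "finite S" using finite_minimal_generating_set[OF M S(2)] S(3) finite_subset by blast
  moreover have "toral f S"
    using minimal_generating_set_subset[OF M S(2)] S \<open>finite S\<close> by (auto simp: toral_def)
  ultimately show thesis
    using that minimal_generating_set_independent_mod[OF M S(2) _ S(3)] S(1) by simp
qed

lemma semisimple_part_Der_log:
  assumes "d \<in> Der_log f"
  shows "series.fcalc d (\<lambda>z. z) \<in> Der_log f" "semisimple (series.fcalc d (\<lambda>z. z))"
    "topologically_nilpotent (d - series.fcalc d (\<lambda>z. z))"
proof -
  have d: "d \<in> max_ideal_Der" using assms singular by blast
  show "series.fcalc d (\<lambda>z. z) \<in> Der_log f" by (rule fcalc_Der_log[OF f_nonzero d assms refl])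
  show "semisimple (series.fcalc d (\<lambda>z. z))" by (rule fcalc_semisimple[OF d refl])
  show "topologically_nilpotent (d - series.fcalc d (\<lambda>z. z))" by (rule semisimple_part_complement[OF d])
qed

text \<open>A nonzero semisimple part would be a commuting family with one element, and could be extended to
  a minimal generating set.\<close>

lemma no_semisimple_imp_topologically_nilpotent:
  assumes "max_commuting_semisimple f = 0" "d \<in> Der_log f"
  shows "topologically_nilpotent d"
proof -
  let ?e = "series.fcalc d (\<lambda>z. z)"
  note e = semisimple_part_Der_log[OF assms(2)]
  have "?e = 0"
  proof (rule ccontr)
    assume e0: "?e \<noteq> 0"
    have tor: "toral f {?e}" using e by (simp add: toral_def lie_bracket_def)
    have "derivs.independent_mod max_ideal_Der_log {?e}"
      unfolding derivs.independent_mod_def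
      using toral_combination_zero[OF tor] e0 by simp
    then show False using toral_card_le[OF tor] assms(1) by simp
  qed
  then show ?thesis using e(3) by simp
qed

text \<open>Coordinate functionals of \<open>\<complex>\<close> over \<open>\<rat>\<close> are additive. Each of them turns a diagonal derivation into
  one with rational weights, and the original derivation is a linear combination of those that are
  obtained in this way.\<close>

lemma rational_toral:
  assumes S: "toral f S" "derivs.independent_mod max_ideal_Der_log S"
  obtains B y w where "toral f B" "derivs.independent_mod max_ideal_Der_log B" "card S \<le> card B" "formal_coordinates y"
    "\<And>s j. s \<in> B \<Longrightarrow> s (y j) = mfps_scale (of_rat (w s j)) (y j)"
proof -
  obtain y w where y: "formal_coordinates y" "\<And>s j. s \<in> S \<Longrightarrow> s (y j) = mfps_scale (w s j) (y j)"
    using toral_coordinates[OF S(1)] by blast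
  interpret ratv: vector_space "\<lambda>(q :: rat) (c :: complex). of_rat q * c"
    by unfold_locales (simp_all add: algebra_simps of_rat_add of_rat_mult)
  obtain Q :: "complex set" where Q: "ratv.independent Q" "ratv.span Q = UNIV"
    using ratv.extend_basis_superset[OF ratv.independent_empty] ratv.span_extend_basis[OF ratv.independent_empty]
      ratv.independent_extend_basis[OF ratv.independent_empty] by blast
  define h where "h b c = (of_rat (ratv.representation Q c b) :: complex)" for b c
  have h_add: "h b (c + d) = h b c + h b d" for b c d
    using Q by (simp add: h_def ratv.representation_add of_rat_add)
  \<comment> \<open>The finitely many basis elements that occur in a weight.\<close>
  define P where "P = (\<Union>s\<in>S. \<Union>j. {b. ratv.representation Q (w s j) b \<noteq> 0})"
  have finS: "finite S" and SM: "S \<subseteq> Der_log f" using S(1) by (auto simp: toral_def)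
  have finP: "finite P" unfolding P_def using finS ratv.finite_representation by auto
  have expand: "(\<Sum>b\<in>P. h b (w s j) * b) = w s j" if "s \<in> S" for s j
  proof -
    have "(\<Sum>b\<in>P. h b (w s j) * b) = (\<Sum>b | ratv.representation Q (w s j) b \<noteq> 0. h b (w s j) * b)"
      using that finP by (intro sum.mono_neutral_right) (auto simp: P_def h_def)
    also have "\<dots> = w s j" unfolding h_def by (rule ratv.sum_nonzero_representation_eq) (use Q in auto)
    finally show ?thesis .
  qed
  define R where "R = (\<lambda>(s, b). series.fcalc s (h b)) ` (S \<times> P)"
  have finR: "finite R" using finS finP by (simp add: R_def)
  have Ry: "series.fcalc s (h b) (y j) = mfps_scale (h b (w s j)) (y j)" if "s \<in> S" for s b j
    using that SM singular y(2) by (intro series.fcalc_eigenvector[OF singular_filtered_endo]) auto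
  have Rs: "series.fcalc s (h b) \<in> Der_log f" "semisimple (series.fcalc s (h b))" if "s \<in> S" for s b
    using that SM singular by (auto intro!: fcalc_Der_log[OF f_nonzero] fcalc_semisimple h_add)
  have RM: "R \<subseteq> Der_log f" using Rs by (auto simp: R_def)
  have Rw: "\<exists>w. \<forall>j. r (y j) = mfps_scale (of_rat (w j)) (y j)" if "r \<in> R" for r
  proof -
    obtain s b where "s \<in> S" "r = series.fcalc s (h b)" using \<open>r \<in> R\<close> by (auto simp: R_def)
    then show ?thesis using Ry by (intro exI[of _ "\<lambda>j. ratv.representation Q (w s j) b"]) (simp add: h_def)
  qed
  then obtain v where v: "\<And>r j. r \<in> R \<Longrightarrow> r (y j) = mfps_scale (of_rat (v r j)) (y j)" by metis
  have torR: "toral f R"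
    unfolding toral_def
  proof (intro conjI ballI finR RM)
    show "semisimple r" if "r \<in> R" for r
      using that Rs by (auto simp: R_def)
    show "lie_bracket r t = 0" if "r \<in> R" "t \<in> R" for r t
      using that v RM Der_log_Der by (intro lie_bracket_diagonal[OF y(1), of _ _ "\<lambda>j. of_rat (v r j)" "\<lambda>j. of_rat (v t j)"]) auto
  qed
  obtain B where B: "B \<subseteq> {} \<union> R" "derivs.independent_mod max_ideal_Der_log B" "R \<subseteq> derivs.span (B \<union> max_ideal_Der_log)"
    using derivs.extend_independent_mod[OF max_ideal_times_subspace(2) derivs.independent_mod_empty finR] by metis
  have finB: "finite B" using B(2) by (simp add: derivs.independent_mod_def)
  have "S \<subseteq> derivs.span (B \<union> max_ideal_Der_log)"
  proof
    fix s assume s: "s \<in> S"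
    have "s = (\<Sum>b\<in>P. der_cscale b (series.fcalc s (h b)))"
    proof (rule Der_eqI[OF _ _ y(1)])
      show "s \<in> Der" using s SM Der_log_Der by blast
      show "(\<Sum>b\<in>P. der_cscale b (series.fcalc s (h b))) \<in> Der"
        unfolding der_cscale_def using s RM Der_log_Der by (intro Der_closed) (auto simp: R_def)
      show "s (y j) = (\<Sum>b\<in>P. der_cscale b (series.fcalc s (h b))) (y j)" for j
      proof -
        have "(\<Sum>b\<in>P. der_cscale b (series.fcalc s (h b))) (y j) = (\<Sum>b\<in>P. mfps_scale (h b (w s j) * b) (y j))"
          using Ry[OF s] by (simp add: sum_fun_apply der_cscale_def der_scale_def mfps_scale_def mfps_const_simps mult_ac)
        also have "\<dots> = mfps_scale (w s j) (y j)" by (simp add: series.scale_sum_left[symmetric] expand[OF s])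
        finally show ?thesis using y(2)[OF s] by simp
      qed
    qed
    moreover have "(\<Sum>b\<in>P. der_cscale b (series.fcalc s (h b))) \<in> derivs.span (B \<union> max_ideal_Der_log)"
      using s B(3) by (intro derivs.span_sum derivs.span_scale) (auto simp: R_def)
    ultimately show "s \<in> derivs.span (B \<union> max_ideal_Der_log)" by simp
  qed
  then have "card S \<le> card B"
    by (rule derivs.card_independent_mod_le[OF max_ideal_times_subspace(2) finB S(2)])
  moreover have "toral f B" using toral_subset[OF torR] B(1) by simp
  ultimately show thesis using that[of B y v] B v y(1) by auto
qed

context
  fixes B :: "('n mfps \<Rightarrow> 'n mfps) set" and y :: "'n \<Rightarrow> 'n mfps" and w
  assumes B: "toral f B" "derivs.independent_mod max_ideal_Der_log B" "card B = max_commuting_semisimple f"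
    and y: "formal_coordinates y"
    and w_all: "\<forall>s\<in>B. \<forall>j. s (y j) = mfps_scale (of_rat (w s j)) (y j)"
begin

lemma toral_diagonal: "s \<in> B \<Longrightarrow> s (y j) = mfps_scale (of_rat (w s j)) (y j)"
  using w_all by blast

lemma toral_members: "finite B" "B \<subseteq> Der_log f" "s \<in> B \<Longrightarrow> s \<in> max_ideal_Der" "s \<in> B \<Longrightarrow> s \<in> Der"
    "s \<in> B \<Longrightarrow> semisimple s" "s \<in> B \<Longrightarrow> t \<in> B \<Longrightarrow> lie_bracket s t = 0"
  using B(1) singular by (auto simp: toral_def max_ideal_Der_eq Der_log_def)

text \<open>Otherwise \<open>B\<close> could be enlarged by \<open>t\<close>, against the maximality of its cardinality. This shows that
  \<open>t\<close> is in the span of \<open>B\<close> up to an element of the maximal ideal times the module, and that element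
  is 0 by \<open>toral_combination_zero\<close>.\<close>

lemma maximal_toral_contains:
  assumes t: "t \<in> Der_log f" "semisimple t" "\<And>s. s \<in> B \<Longrightarrow> lie_bracket s t = 0"
  shows "t \<in> derivs.span B"
proof (cases "t \<in> B")
  case False
  have "lie_bracket t s = 0" if "s \<in> B" for s
    using t(3)[OF that] by (auto simp: lie_bracket_def fun_eq_iff)
  then have tor: "toral f (insert t B)"
    using t toral_members by (auto simp: toral_def lie_bracket_def[of t t])
  have "t \<in> derivs.span (B \<union> max_ideal_Der_log)"
  proof (rule ccontr)
    assume "t \<notin> derivs.span (B \<union> max_ideal_Der_log)"
    then have "derivs.independent_mod max_ideal_Der_log (insert t B)"
      by (rule derivs.independent_mod_insert[OF max_ideal_times_subspace(2) B(2)])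
    from toral_card_le[OF tor this] show False using B(3) False toral_members(1) by simp
  qed
  then obtain s where s: "s \<in> derivs.span B" "t - s \<in> max_ideal_Der_log"
    using derivs.span_Un_subspace[OF max_ideal_times_subspace(2)] by blast
  obtain r where r: "s = (\<Sum>v\<in>B. der_cscale (r v) v)" using s(1) toral_members(1) by (auto simp: derivs.span_finite)
  define c where "c v = (if v = t then 1 else - r v)" for v
  have "(\<Sum>v\<in>insert t B. der_cscale (c v) v) = t + (\<Sum>v\<in>B. der_cscale (c v) v)"
    using toral_members(1) False by (simp add: c_def)
  also have "(\<Sum>v\<in>B. der_cscale (c v) v) = - s"
    unfolding r sum_negf[symmetric] using False by (intro sum.cong) (auto simp: c_def)
  finally have eq: "t - s = (\<Sum>v\<in>insert t B. der_cscale (c v) v)"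
    by (simp only: diff_conv_add_uminus)
  have "t - s = 0" using s(2) unfolding eq by (rule toral_combination_zero[OF tor])
  then have "t = s" by (rule eq_iff_diff_eq_0[THEN iffD2])
  then show ?thesis using s(1) by (simp only:)
qed (rule derivs.span_base)

lemma eigenvalue_rational:
  assumes "s \<in> B" "g \<noteq> 0" "s g = mfps_scale z g"
  shows "z \<in> \<rat>"
  using diagonal_eigenvalue_in[OF y toral_members(3)[OF assms(1)] toral_diagonal[OF assms(1)] _ _ _ assms(2,3), of "\<rat>"] by auto

text \<open>In terms of a grading: the ideal of \<open>f\<close> is homogeneous, so some homogeneous component of \<open>f\<close>
  of the same order is a multiple of \<open>f\<close>, by a unit.\<close>

lemma homogeneous_unit_multiple:
  obtains u where "u dvd 1" "\<And>s. s \<in> B \<Longrightarrow> \<exists>z. s (u * f) = mfps_scale z (u * f)"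
proof -
  obtain d where d: "f \<in> max_ideal_pow d" "f \<notin> max_ideal_pow (Suc d)" using exact_order[OF f_nonzero] .
  let ?V = "{p. f dvd p}"
  have "?V \<subseteq> series.span ((?V \<inter> series.joint_eigenvectors B) \<union> max_ideal_pow (Suc d))"
  proof (rule series.joint_eigenvectors_span[OF toral_members(1) _ _ closed_principal_ideal[OF f_nonzero]])
    show "\<forall>s\<in>B. series.semisimple_op s" using toral_members(5) semisimple_imp_op by blast
    show "\<forall>s\<in>B. \<forall>t\<in>B. \<forall>p. s (t p) = t (s p)"
    proof (intro ballI allI)
      fix s t p assume "s \<in> B" "t \<in> B"
      from fun_cong[OF toral_members(6)[OF this], of p] show "s (t p) = t (s p)" by (simp add: lie_bracket_apply)
    qed
    show "\<forall>s\<in>B. \<forall>p\<in>?V. s p \<in> ?V" using toral_members(2) Der_log_ideal_stable by auto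
  qed
  then have f: "f \<in> series.span ((?V \<inter> series.joint_eigenvectors B) \<union> max_ideal_pow (Suc d))"
    by (rule subsetD) simp
  have "\<not> ?V \<inter> series.joint_eigenvectors B \<subseteq> max_ideal_pow (Suc d)"
  proof
    assume "?V \<inter> series.joint_eigenvectors B \<subseteq> max_ideal_pow (Suc d)"
    then have "series.span ((?V \<inter> series.joint_eigenvectors B) \<union> max_ideal_pow (Suc d)) \<subseteq> max_ideal_pow (Suc d)"
      by (intro series.span_minimal series.subspace_F) simp
    then show False using f d(2) by blast
  qed
  then obtain g where g: "f dvd g" "g \<in> series.joint_eigenvectors B" "g \<notin> max_ideal_pow (Suc d)" by blast
  obtain u where u: "g = f * u" using g(1) by (rule dvdE)
  have "u \<notin> max_ideal" using max_ideal_mult_pow[of u f d] d(1) g(3) by (auto simp: u mult.commute)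
  then have "u dvd 1" by (rule mfps_unit)
  then show thesis using that[of u] g(2) by (auto simp: series.joint_eigenvectors_def u mult.commute)
qed

lemma closed_subspace_Der_log: "derivs.closed_subspace (Der_log f)"
  unfolding derivs.closed_subspace_def
proof (intro conjI ballI impI)
  show "derivs.subspace (Der_log f)" by (rule derivs_subspaceI[OF Der_log_subspace])
  show "Der_log f \<subseteq> Der_filtration 0" using Der_log_Der by (simp add: Der_filtration_0)
  fix d assume d: "d \<in> Der_filtration 0" "\<forall>k. \<exists>v\<in>Der_log f. d - v \<in> Der_filtration k"
  have "\<exists>p\<in>{p. f dvd p}. d f - p \<in> max_ideal_pow k" for k
  proof -
    obtain v where "v \<in> Der_log f" "d - v \<in> Der_filtration k" using d(2) by blast
    then show ?thesis by (intro bexI[of _ "v f"]) (auto simp: Der_log_def Der_filtration_def)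
  qed
  then have "d f \<in> {p. f dvd p}"
    using closed_principal_ideal[OF f_nonzero] by (simp add: series.closed_subspace_def)
  then show "d \<in> Der_log f" using d(1) by (simp add: Der_log_def Der_filtration_0)
qed

text \<open>The candidates for the \<open>\<nu>\<^sub>j\<close> of the theorem.\<close>

definition homogeneous_nilpotents :: "('n mfps \<Rightarrow> 'n mfps) set" where
  "homogeneous_nilpotents = {e \<in> Der_log f. topologically_nilpotent e \<and>
     (\<forall>s\<in>B. \<exists>q. lie_bracket s e = der_cscale (of_rat q) e)}"

text \<open>An element of nonzero weight is topologically nilpotent already. An element \<open>e\<close> of weight zero is
  corrected by its semisimple part, which commutes with \<open>B\<close> because \<open>e\<close> does, and therefore is in
  the span of \<open>B\<close>. For the rationality of a weight \<open>z\<close> note that \<open>e (y j)\<close>, if it is not 0, is an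
  eigenvector of \<open>t\<close> for \<open>z + w t j\<close>.\<close>

lemma homogeneous_subset_span:
  "Der_log f \<inter> derivs.joint_eigenvectors (lie_bracket ` B) \<subseteq> derivs.span (B \<union> homogeneous_nilpotents)"
proof
  fix e assume "e \<in> Der_log f \<inter> derivs.joint_eigenvectors (lie_bracket ` B)"
  then have e: "e \<in> Der_log f" "\<And>s. s \<in> B \<Longrightarrow> \<exists>z. lie_bracket s e = der_cscale z e"
    by (auto simp: derivs.joint_eigenvectors_def)
  have eD: "e \<in> Der" using e(1) Der_log_Der by blast
  have em: "e \<in> max_ideal_Der" using e(1) singular by blast
  show "e \<in> derivs.span (B \<union> homogeneous_nilpotents)"
  proof (cases "\<exists>s\<in>B. lie_bracket s e \<noteq> 0")
    case True
    then obtain s z where s: "s \<in> B" "lie_bracket s e = der_cscale z e" "lie_bracket s e \<noteq> 0" using e(2) by blast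
    then have "z \<noteq> 0" by auto
    have nil: "topologically_nilpotent e"
      using nonzero_weight_topologically_nilpotent[OF toral_members(3)[OF s(1)] em \<open>z \<noteq> 0\<close> s(2)] .
    have "e \<noteq> 0" using s by auto
    then obtain j where j: "e (y j) \<noteq> 0" using Der_eq_0I[OF eD y] by blast
    have "\<exists>q. lie_bracket t e = der_cscale (of_rat q) e" if t: "t \<in> B" for t
    proof -
      obtain z where z: "lie_bracket t e = der_cscale z e" using e(2)[OF t] by blast
      have "t (e (y j)) = mfps_scale (z + of_rat (w t j)) (e (y j))"
        using fun_cong[OF z, of "y j"] toral_diagonal[OF t, of j]
        by (simp add: lie_bracket_apply der_cscale_def der_scale_def mfps_scale_def Der_mult[OF eD] Der_const[OF eD] mfps_const_simps algebra_simps)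
      then have "z + of_rat (w t j) \<in> \<rat>" using eigenvalue_rational[OF t j] by blast
      then have "z + of_rat (w t j) - of_rat (w t j) \<in> \<rat>" by (intro Rats_diff) auto
      then obtain q where "z = of_rat q" by (auto elim: Rats_cases)
      then show ?thesis using z by blast
    qed
    then show ?thesis using e(1) nil by (intro derivs.span_base) (auto simp: homogeneous_nilpotents_def)
  next
    case False
    let ?e = "series.fcalc e (\<lambda>z. z)"
    note part = semisimple_part_Der_log[OF e(1)]
    have br: "lie_bracket s ?e = 0" if s: "s \<in> B" for s
    proof
      fix p
      have "lie_bracket s e = 0" using False s by blast
      from fun_cong[OF this] have "s (e p) = e (s p)" for p by (simp add: lie_bracket_apply)
      then have "s (?e p) = ?e (s p)"
        by (intro series.fcalc_commute[OF singular_filtered_endo[OF em] singular_filtered_endo[OF toral_members(3)[OF s]]]) auto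
      then show "lie_bracket s ?e p = 0 p" by (simp add: lie_bracket_apply)
    qed
    then have "?e \<in> derivs.span B" by (rule maximal_toral_contains[OF part(1,2)])
    then have 1: "?e \<in> derivs.span (B \<union> homogeneous_nilpotents)" using derivs.span_mono[of B] by blast
    have "lie_bracket s (e - ?e) = der_cscale (of_rat 0) (e - ?e)" if s: "s \<in> B" for s
    proof -
      have "lie_bracket s (e - ?e) = lie_bracket s e - lie_bracket s ?e"
        using toral_members(4)[OF s] by (simp add: fun_eq_iff lie_bracket_apply Der_diff)
      then show ?thesis using br[OF s] False s by simp
    qed
    moreover have "e - ?e \<in> Der_log f" using der_module.subspace_diff[OF Der_log_subspace e(1) part(1)] .
    ultimately have "e - ?e \<in> homogeneous_nilpotents" using part(3) unfolding homogeneous_nilpotents_def by blast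
    then have "?e + (e - ?e) \<in> derivs.span (B \<union> homogeneous_nilpotents)"
      using 1 by (intro derivs.span_add) (auto intro: derivs.span_base)
    then show ?thesis by simp
  qed
qed

text \<open>The adjoint action of \<open>B\<close> decomposes a logarithmic derivation into homogeneous ones up to an error
  of high order, and the Artin--Rees property puts this error into the maximal ideal times the
  module.\<close>

lemma Der_log_spanned: "Der_log f \<subseteq> derivs.span ((B \<union> homogeneous_nilpotents) \<union> max_ideal_Der_log)"
proof
  fix d assume d: "d \<in> Der_log f"
  note M = Der_log_subspace[of f] Der_log_Der
  obtain k where k: "Der_log f \<inter> Der_filtration k \<subseteq> max_ideal_Der_log"
    using derivation_module_noetherian[OF M] by metis
  let ?H = "Der_log f \<inter> derivs.joint_eigenvectors (lie_bracket ` B)"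
  have ss: "\<forall>T\<in>lie_bracket ` B. derivs.semisimple_op T"
  proof (rule ballI)
    fix T assume "T \<in> lie_bracket ` B"
    then obtain s where s: "s \<in> B" "T = lie_bracket s" by blast
    show "derivs.semisimple_op T"
      unfolding s(2) by (rule lie_bracket_semisimple_op[OF y toral_members(3)[OF s(1)] toral_diagonal[OF s(1)]])
  qed
  have comm: "\<forall>T\<in>lie_bracket ` B. \<forall>U\<in>lie_bracket ` B. \<forall>e. T (U e) = U (T e)"
  proof (intro ballI allI)
    fix T U e assume "T \<in> lie_bracket ` B" "U \<in> lie_bracket ` B"
    then obtain s t where st: "s \<in> B" "t \<in> B" "T = lie_bracket s" "U = lie_bracket t" by blast
    have "s (t q) = t (s q)" for q using fun_cong[OF toral_members(6)[OF st(1,2)], of q] by (simp add: lie_bracket_apply)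
    then show "T (U e) = U (T e)"
      using toral_members(4)[OF st(1)] toral_members(4)[OF st(2)] by (auto simp: st fun_eq_iff lie_bracket_apply Der_diff)
  qed
  have stable: "\<forall>T\<in>lie_bracket ` B. \<forall>e\<in>Der_log f. T e \<in> Der_log f"
    using toral_members(2) Der_log_lie_bracket by auto
  have "Der_log f \<subseteq> derivs.span (?H \<union> Der_filtration k)"
    by (rule derivs.joint_eigenvectors_span[OF finite_imageI[OF toral_members(1)] ss comm closed_subspace_Der_log stable])
  then have "d \<in> derivs.span (?H \<union> Der_filtration k)" using d by blast
  then obtain s where s: "s \<in> derivs.span ?H" "d - s \<in> Der_filtration k"
    using derivs.span_Un_subspace[OF derivs.subspace_F] by blast
  have "derivs.span ?H \<subseteq> Der_log f" by (intro derivs.span_minimal derivs_subspaceI M) auto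
  then have "d - s \<in> max_ideal_Der_log" using k s d der_module.subspace_diff[OF M(1)] by blast
  moreover have "derivs.span ?H \<subseteq> derivs.span (B \<union> homogeneous_nilpotents)"
    by (rule derivs.span_minimal[OF homogeneous_subset_span derivs.subspace_span])
  ultimately show "d \<in> derivs.span ((B \<union> homogeneous_nilpotents) \<union> max_ideal_Der_log)"
    using s(1) derivs.span_Un_subspace[OF max_ideal_times_subspace(2)] by blast
qed

lemma homogeneous_minimal_generating_set:
  obtains N where "finite N" "N \<subseteq> homogeneous_nilpotents" "B \<inter> N = {}" "minimal_generating_set (Der_log f) (B \<union> N)"
proof -
  note M = Der_log_subspace[of f] Der_log_Der
  have "B \<union> homogeneous_nilpotents \<subseteq> Der_log f" using toral_members(2) by (auto simp: homogeneous_nilpotents_def)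
  then obtain G where G: "B \<subseteq> G" "G \<subseteq> B \<union> (B \<union> homogeneous_nilpotents)" "finite G" "minimal_generating_set (Der_log f) G"
    using extend_to_minimal_generating_set[OF M toral_members(2) B(2) _ Der_log_spanned] by metis
  moreover have "B \<union> (G - B) = G" using G(1) by blast
  ultimately show thesis using that[of "G - B"] by auto
qed

end

end

theorem theorem6p8:
  fixes f :: "'n::finite mfps" and s :: nat
  assumes "Der_log f \<subseteq> max_ideal_Der"
    and "s = max_commuting_semisimple f"
  shows "(s = 0 \<longrightarrow>
            (\<forall>G. minimal_generating_set (Der_log f) G \<longrightarrow> (\<forall>\<delta>\<in>G. topologically_nilpotent \<delta>))) \<and>
         (s \<noteq> 0 \<longrightarrow>
            (\<exists>(r :: nat) (\<sigma> :: nat \<Rightarrow> 'n mfps \<Rightarrow> 'n mfps) (\<nu> :: nat \<Rightarrow> 'n mfps \<Rightarrow> 'n mfps)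
              (y :: 'n \<Rightarrow> 'n mfps) (u :: 'n mfps).
              minimal_generating_set (Der_log f) (\<sigma> ` {1..s} \<union> \<nu> ` {1..r}) \<and>
              inj_on \<sigma> {1..s} \<and> inj_on \<nu> {1..r} \<and> \<sigma> ` {1..s} \<inter> \<nu> ` {1..r} = {} \<and>
              formal_coordinates y \<and> u dvd 1 \<and>
              (\<exists>w :: nat \<Rightarrow> 'n \<Rightarrow> rat. \<forall>i\<in>{1..s}.
                 \<sigma> i = (\<Sum>j\<in>UNIV. der_scale (mfps_const (of_rat (w i j)) * y j) (coord_deriv y j))) \<and>
              (\<exists>\<alpha> :: nat \<Rightarrow> rat. \<forall>i\<in>{1..s}.
                 \<sigma> i (u * f) = mfps_const (of_rat (\<alpha> i)) * (u * f)) \<and>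
              (\<forall>j\<in>{1..r}. topologically_nilpotent (\<nu> j)) \<and>
              (\<exists>c :: nat \<Rightarrow> nat \<Rightarrow> rat. \<forall>i\<in>{1..s}. \<forall>j\<in>{1..r}.
                 lie_bracket (\<sigma> i) (\<nu> j) = der_scale (mfps_const (of_rat (c i j))) (\<nu> j))))"
proof (intro conjI impI allI ballI, goal_cases)
  case (1 G \<delta>)
  have "\<delta> \<in> Der_log f"
    using minimal_generating_set_subset[OF Der_log_subspace Der_log_Der[OF assms(1)] 1(2)] 1(3) by blast
  then show ?case
    using no_semisimple_imp_topologically_nilpotent[OF assms(1)] assms(2) 1(1) by simp
next
  case 2
  note f = assms(1)
  obtain S where S: "toral f S" "derivs.independent_mod (max_ideal_times (Der_log f)) S" "card S = s"
    using maximal_toral_exists[OF f] assms(2) by metis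
  obtain B y w where B: "toral f B" "derivs.independent_mod (max_ideal_times (Der_log f)) B" "card S \<le> card B"
    and y: "formal_coordinates y" and w_all: "\<forall>s\<in>B. \<forall>j. s (y j) = mfps_scale (of_rat (w s j)) (y j)"
    using rational_toral[OF f S(1,2)] by metis
  have card: "card B = max_commuting_semisimple f"
    using toral_card_le[OF f B(1,2)] B(3) S(3) assms(2) by simp
  note ctx = f B(1,2) card y w_all
  note facts = toral_members[OF ctx]
  obtain u where u: "u dvd 1" "\<And>s. s \<in> B \<Longrightarrow> \<exists>z. s (u * f) = mfps_scale z (u * f)"
    using homogeneous_unit_multiple[OF ctx] by metis
  obtain N where N: "finite N" "N \<subseteq> homogeneous_nilpotents f B" "B \<inter> N = {}"
    "minimal_generating_set (Der_log f) (B \<union> N)"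
    using homogeneous_minimal_generating_set[OF ctx] by metis
  obtain \<sigma> where \<sigma>: "bij_betw \<sigma> {1..s} B" using ex_bij_betw_nat_finite_1[OF facts(1)] card assms(2) by auto
  obtain \<nu> where \<nu>: "bij_betw \<nu> {1..card N} N" using ex_bij_betw_nat_finite_1[OF N(1)] by auto
  have im: "\<sigma> ` {1..s} = B" "\<nu> ` {1..card N} = N" and inj: "inj_on \<sigma> {1..s}" "inj_on \<nu> {1..card N}"
    using \<sigma> \<nu> by (auto simp: bij_betw_def)
  have \<sigma>B: "\<sigma> i \<in> B" if "i \<in> {1..s}" for i using im that by blast
  have \<nu>N: "\<nu> j \<in> homogeneous_nilpotents f B" if "j \<in> {1..card N}" for j using im N(2) that by blast
  have w': "\<exists>w :: nat \<Rightarrow> 'n \<Rightarrow> rat. \<forall>i\<in>{1..s}.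
      \<sigma> i = (\<Sum>j\<in>UNIV. der_scale (mfps_const (of_rat (w i j)) * y j) (coord_deriv y j))"
  proof (intro exI ballI)
    fix i assume "i \<in> {1..s}"
    then have i: "\<sigma> i \<in> B" by (rule \<sigma>B)
    show "\<sigma> i = (\<Sum>j\<in>UNIV. der_scale (mfps_const (of_rat (w (\<sigma> i) j)) * y j) (coord_deriv y j))"
      using Der_coordinate_expansion[OF y facts(4)[OF i]] by (simp only: toral_diagonal[OF ctx i] mfps_scale_def)
  qed
  have uf: "u * f \<noteq> 0"
  proof
    assume "u * f = 0"
    obtain v where "1 = u * v" using u(1) by (rule dvdE)
    then have "f = v * (u * f)" by (metis mult.assoc mult.commute mult_1_left)
    then show False using f_nonzero[OF f] \<open>u * f = 0\<close> by simp
  qed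
  have "\<forall>i\<in>{1..s}. \<exists>q. \<sigma> i (u * f) = mfps_const (of_rat q) * (u * f)"
  proof
    fix i assume "i \<in> {1..s}"
    then have i: "\<sigma> i \<in> B" by (rule \<sigma>B)
    obtain z where z: "\<sigma> i (u * f) = mfps_scale z (u * f)" using u(2)[OF i] by blast
    then have "z \<in> \<rat>" using eigenvalue_rational[OF ctx i uf] by blast
    then obtain q where "z = of_rat q" by (rule Rats_cases)
    then show "\<exists>q. \<sigma> i (u * f) = mfps_const (of_rat q) * (u * f)" using z by (auto simp: mfps_scale_def)
  qed
  then have \<alpha>: "\<exists>\<alpha> :: nat \<Rightarrow> rat. \<forall>i\<in>{1..s}. \<sigma> i (u * f) = mfps_const (of_rat (\<alpha> i)) * (u * f)" by (rule bchoice)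
  have "\<forall>i\<in>{1..s}. \<exists>c :: nat \<Rightarrow> rat. \<forall>j\<in>{1..card N}. lie_bracket (\<sigma> i) (\<nu> j) = der_scale (mfps_const (of_rat (c j))) (\<nu> j)"
  proof (intro ballI bchoice)
    fix i j assume "i \<in> {1..s}" "j \<in> {1..card N}"
    then show "\<exists>c. lie_bracket (\<sigma> i) (\<nu> j) = der_scale (mfps_const (of_rat c)) (\<nu> j)"
      using \<sigma>B[of i] \<nu>N[of j] by (auto simp: homogeneous_nilpotents_def[OF ctx] der_cscale_def)
  qed
  then have c: "\<exists>c :: nat \<Rightarrow> nat \<Rightarrow> rat. \<forall>i\<in>{1..s}. \<forall>j\<in>{1..card N}.
      lie_bracket (\<sigma> i) (\<nu> j) = der_scale (mfps_const (of_rat (c i j))) (\<nu> j)" by (rule bchoice)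
  have nil: "\<forall>j\<in>{1..card N}. topologically_nilpotent (\<nu> j)"
    using \<nu>N by (auto simp: homogeneous_nilpotents_def[OF ctx])
  show ?case
    by (rule exI[of _ "card N"], rule exI[of _ \<sigma>], rule exI[of _ \<nu>], rule exI[of _ y], rule exI[of _ u])
      (intro conjI w' \<alpha> c nil y u(1) inj; simp only: im N)
qed

end
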